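(* Let $K$ be a field, let $L$ be a finite lattice with at least two elements, and let $A$ be the incidence algebra of $L$ over $K$. (1) If $L$ is not distributive, then $A$ is not $2$-Gorenstein. (2) $L$ is distributive if and only if $A$ is Auslander regular.
   Context: The incidence algebra of a finite poset $P$ over a field $K$ is the $K$-algebra with $K$-basis $\{p_y^x \mid x,y\in P,\ x\le y\}$ and multiplication $p_{x_2}^{x_1}p_{y_2}^{y_1}=p_{y_2}^{x_1}$ if $x_2=y_1$ and $0$ otherwise. It is a finite dimensional algebra. All modules are finitely generated right modules, and $\operatorname{pdim}$ denotes projective dimension. Let $A$ be a finite dimensional algebra and let $0\to A\to I^0\to I^1\to\cdots$ be a minimal injective coresolution of the right $A$-module $A$. For $n\ge 1$, $A$ is called $n$-Gorenstein if $\operatorname{pdim} I^i\le i$ for all $i=0,\dots,n-1$. $A$ is called Auslander regular if it is $n$-Gorenstein for all $n\ge1$ and has finite global dimension. *)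

theory Defs
  imports "HOL-Algebra.Module" "HOL-Algebra.AbelCoset" "HOL-Library.Extended_Nat"
    "HOL-Library.Cardinality"
begin

section \<open>Finitely generated right modules over a ring\<close>

text \<open>
  \<open>Module.module\<close> requires a commutative ring, so right modules are introduced here, on the same
  record type. The library writes scalars on the left: \<open>a \<odot>\<^bsub>M\<^esub> x\<close> denotes the
  right action \<open>x \<cdot> a\<close>. Hence the order in the associativity law,
  \<open>x \<cdot> (a b) = (x \<cdot> a) \<cdot> b\<close>. As for \<open>Module.module\<close>, the fields
  \<open>mult\<close> and \<open>one\<close> of the record \<open>M\<close> play no role.
\<close>

locale right_module = R?: ring A + M?: abelian_group M
  for A (structure) and M :: "('a, 'm, 'e) module_scheme" (structure) +
  assumes ract_closed:
      "\<lbrakk>a \<in> carrier A; x \<in> carrier M\<rbrakk> \<Longrightarrow> a \<odot>\<^bsub>M\<^esub> x \<in> carrier M"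
    and ract_distr_ring:
      "\<lbrakk>a \<in> carrier A; b \<in> carrier A; x \<in> carrier M\<rbrakk> \<Longrightarrow>
        (a \<oplus>\<^bsub>A\<^esub> b) \<odot>\<^bsub>M\<^esub> x = a \<odot>\<^bsub>M\<^esub> x \<oplus>\<^bsub>M\<^esub> b \<odot>\<^bsub>M\<^esub> x"
    and ract_distr_module:
      "\<lbrakk>a \<in> carrier A; x \<in> carrier M; y \<in> carrier M\<rbrakk> \<Longrightarrow>
        a \<odot>\<^bsub>M\<^esub> (x \<oplus>\<^bsub>M\<^esub> y) = a \<odot>\<^bsub>M\<^esub> x \<oplus>\<^bsub>M\<^esub> a \<odot>\<^bsub>M\<^esub> y"
    and ract_assoc:
      "\<lbrakk>a \<in> carrier A; b \<in> carrier A; x \<in> carrier M\<rbrakk> \<Longrightarrow>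
        (a \<otimes>\<^bsub>A\<^esub> b) \<odot>\<^bsub>M\<^esub> x = b \<odot>\<^bsub>M\<^esub> (a \<odot>\<^bsub>M\<^esub> x)"
    and ract_one:
      "x \<in> carrier M \<Longrightarrow> \<one>\<^bsub>A\<^esub> \<odot>\<^bsub>M\<^esub> x = x"

definition fg_module :: "('a, 'r) ring_scheme \<Rightarrow> ('a, 'm, 'e) module_scheme \<Rightarrow> bool" where
  "fg_module A M \<longleftrightarrow> right_module A M \<and>
     (\<exists>S. finite S \<and> S \<subseteq> carrier M \<and>
        (\<forall>x \<in> carrier M. \<exists>c \<in> S \<rightarrow> carrier A. x = (\<Oplus>\<^bsub>M\<^esub>s\<in>S. c s \<odot>\<^bsub>M\<^esub> s)))"

definition rmod_hom ::
  "('a, 'r) ring_scheme \<Rightarrow> ('a, 'm, 'e) module_scheme \<Rightarrow> ('a, 'n, 'f) module_scheme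
    \<Rightarrow> ('m \<Rightarrow> 'n) set" where
  "rmod_hom A M N = {f \<in> hom (add_monoid M) (add_monoid N).
     \<forall>a \<in> carrier A. \<forall>x \<in> carrier M. f (a \<odot>\<^bsub>M\<^esub> x) = a \<odot>\<^bsub>N\<^esub> f x}"

definition regular_module :: "('a, 'r) ring_scheme \<Rightarrow> ('a, 'a) module" where
  "regular_module A = \<lparr>carrier = carrier A, mult = mult A, one = one A, zero = zero A,
     add = add A, smult = (\<lambda>a x. x \<otimes>\<^bsub>A\<^esub> a)\<rparr>"

text \<open>
  A definition cannot quantify over the types of module carriers. A finitely generated module over a
  ring with elements of type \<open>'a\<close> is, as a set, no larger than \<open>nat \<Rightarrow> 'a\<close>,
  so up to isomorphism all of them live on that type; this is the lemma \<open>fg_module_iso_fgmod\<close>.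
\<close>

type_synonym 'a fgmod = "('a, nat \<Rightarrow> 'a) module"

lemma fg_module_iso_fgmod:
  fixes A :: "('a, 'r) ring_scheme" and M :: "('a, 'm) module"
  assumes "fg_module A M"
  shows "\<exists>(N :: 'a fgmod) f. fg_module A N \<and> f \<in> rmod_hom A M N \<and>
           bij_betw f (carrier M) (carrier N)"
proof -
  interpret right_module A M using assms by (simp add: fg_module_def)
  obtain S where S: "finite S" "S \<subseteq> carrier M"
    and gen: "\<And>x. x \<in> carrier M \<Longrightarrow> \<exists>c \<in> S \<rightarrow> carrier A. x = (\<Oplus>\<^bsub>M\<^esub>s\<in>S. c s \<odot>\<^bsub>M\<^esub> s)"
    using assms by (auto simp: fg_module_def)
  obtain c where c: "\<And>x. x \<in> carrier M \<Longrightarrow> c x \<in> S \<rightarrow> carrier A"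
    "\<And>x. x \<in> carrier M \<Longrightarrow> x = (\<Oplus>\<^bsub>M\<^esub>s\<in>S. c x s \<odot>\<^bsub>M\<^esub> s)"
    using gen by metis
  obtain t :: "'m \<Rightarrow> nat" where t: "inj_on t S"
    using finite_imp_inj_to_nat_seg[OF S(1)] by auto
  define f where "f x = (\<lambda>n. c x (inv_into S t n))" for x
  have inj: "inj_on f (carrier M)"
  proof (rule inj_onI)
    fix x y assume x: "x \<in> carrier M" and y: "y \<in> carrier M" and e: "f x = f y"
    have "c x s = c y s" if "s \<in> S" for s
      using fun_cong[OF e, of "t s"] t that by (simp add: f_def)
    then have "(\<Oplus>\<^bsub>M\<^esub>s\<in>S. c x s \<odot>\<^bsub>M\<^esub> s) = (\<Oplus>\<^bsub>M\<^esub>s\<in>S. c y s \<odot>\<^bsub>M\<^esub> s)"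
      using c(1)[OF y] S(2) by (intro M.finsum_cong') (auto intro!: ract_closed)
    then show "x = y" using c(2)[OF x] c(2)[OF y] by simp
  qed
  define g where "g = inv_into (carrier M) f"
  have gf [simp]: "g (f x) = x" if "x \<in> carrier M" for x
    using inj that by (simp add: g_def)
  define N :: "'a fgmod" where
    "N = \<lparr>carrier = f ` carrier M, mult = (\<lambda>x y. undefined), one = undefined,
          zero = f \<zero>\<^bsub>M\<^esub>, add = (\<lambda>x y. f (g x \<oplus>\<^bsub>M\<^esub> g y)), smult = (\<lambda>a x. f (a \<odot>\<^bsub>M\<^esub> g x))\<rparr>"
  have gN: "abelian_group N"
  proof (rule abelian_groupI)
    fix x assume "x \<in> carrier N"
    then obtain u where u: "u \<in> carrier M" "x = f u" by (auto simp: N_def)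
    then have "f (\<ominus>\<^bsub>M\<^esub> u) \<in> carrier N \<and> f (\<ominus>\<^bsub>M\<^esub> u) \<oplus>\<^bsub>N\<^esub> x = \<zero>\<^bsub>N\<^esub>"
      by (simp add: N_def M.l_neg)
    then show "\<exists>y\<in>carrier N. y \<oplus>\<^bsub>N\<^esub> x = \<zero>\<^bsub>N\<^esub>" by blast
  qed (auto simp: N_def M.a_ac)
  have rN: "right_module A N"
  proof (intro right_module.intro gN right_module_axioms.intro)
    show "ring A" by (rule R.ring_axioms)
  qed (auto simp: N_def ract_closed ract_distr_ring ract_distr_module ract_assoc ract_one)
  interpret N: right_module A N by (rule rN)
  have fhom: "f \<in> rmod_hom A M N"
    by (auto simp: rmod_hom_def hom_def N_def ract_closed)
  have fsum: "f (\<Oplus>\<^bsub>M\<^esub>s\<in>T. h s) = (\<Oplus>\<^bsub>N\<^esub>s\<in>T. f (h s))"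
    if "finite T" "h \<in> T \<rightarrow> carrier M" for T and h :: "'m \<Rightarrow> 'm"
    using that
  proof (induction T rule: finite_induct)
    case empty
    have "f \<zero>\<^bsub>M\<^esub> = \<zero>\<^bsub>N\<^esub>" by (simp add: N_def)
    then show ?case by simp
  next
    case (insert u T)
    have "f (h u \<oplus>\<^bsub>M\<^esub> (\<Oplus>\<^bsub>M\<^esub>s\<in>T. h s)) = f (h u) \<oplus>\<^bsub>N\<^esub> f (\<Oplus>\<^bsub>M\<^esub>s\<in>T. h s)"
      using insert.prems by (simp add: N_def Pi_def)
    moreover have "(\<lambda>s. f (h s)) \<in> T \<rightarrow> carrier N" "f (h u) \<in> carrier N"
      using insert.prems by (auto simp: N_def Pi_def)
    ultimately show ?case
      using insert by (simp add: Pi_def)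
  qed
  have "fg_module A N"
    unfolding fg_module_def
  proof (intro conjI rN exI[of _ "f ` S"] ballI)
    show "finite (f ` S)" using S(1) by simp
    show "f ` S \<subseteq> carrier N" using S(2) by (auto simp: N_def)
    fix y assume "y \<in> carrier N"
    then obtain x where x: "x \<in> carrier M" "y = f x" by (auto simp: N_def)
    have cl: "(\<lambda>s. c x s \<odot>\<^bsub>M\<^esub> s) \<in> S \<rightarrow> carrier M"
      using c(1)[OF x(1)] S(2) by (auto intro!: ract_closed)
    have inS: "inj_on f S" using inj S(2) by (rule inj_on_subset)
    have "y = (\<Oplus>\<^bsub>N\<^esub>s\<in>S. f (c x s \<odot>\<^bsub>M\<^esub> s))"
      using fsum[OF S(1) cl] c(2)[OF x(1)] x(2) by simp
    also have "\<dots> = (\<Oplus>\<^bsub>N\<^esub>s\<in>S. c x (g (f s)) \<odot>\<^bsub>N\<^esub> f s)"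
      using cl S(2) by (intro N.M.finsum_cong') (auto simp: N_def Pi_def subset_iff)
    also have "\<dots> = (\<Oplus>\<^bsub>N\<^esub>s\<in>f ` S. c x (g s) \<odot>\<^bsub>N\<^esub> s)"
      using c(1)[OF x(1)] S(2)
      by (intro N.M.finsum_reindex[symmetric] inS) (auto simp: Pi_def subset_iff N_def ract_closed)
    finally have "y = (\<Oplus>\<^bsub>N\<^esub>s\<in>f ` S. c x (g s) \<odot>\<^bsub>N\<^esub> s)" .
    moreover have "(\<lambda>s. c x (g s)) \<in> f ` S \<rightarrow> carrier A"
      using c(1)[OF x(1)] S(2) by (auto simp: Pi_def subset_iff)
    ultimately show "\<exists>c\<in>f ` S \<rightarrow> carrier A. y = (\<Oplus>\<^bsub>N\<^esub>s\<in>f ` S. c s \<odot>\<^bsub>N\<^esub> s)"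
      by (intro bexI[of _ "\<lambda>s. c x (g s)"])
  qed
  moreover have "bij_betw f (carrier M) (carrier N)"
    using inj by (simp add: bij_betw_def N_def)
  ultimately show ?thesis using fhom by blast
qed


section \<open>Projective and injective modules, projective dimension\<close>

definition projective_module :: "('a, 'r) ring_scheme \<Rightarrow> ('a, 'm, 'e) module_scheme \<Rightarrow> bool" where
  "projective_module A P \<longleftrightarrow> fg_module A P \<and>
     (\<forall>(M :: 'a fgmod) (N :: 'a fgmod). fg_module A M \<longrightarrow> fg_module A N \<longrightarrow>
        (\<forall>g \<in> rmod_hom A M N. \<forall>f \<in> rmod_hom A P N. g ` carrier M = carrier N \<longrightarrow>
           (\<exists>h \<in> rmod_hom A P M. \<forall>x \<in> carrier P. g (h x) = f x)))"

definition injective_module :: "('a, 'r) ring_scheme \<Rightarrow> ('a, 'm, 'e) module_scheme \<Rightarrow> bool" where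
  "injective_module A E \<longleftrightarrow> fg_module A E \<and>
     (\<forall>(M :: 'a fgmod) (N :: 'a fgmod). fg_module A M \<longrightarrow> fg_module A N \<longrightarrow>
        (\<forall>g \<in> rmod_hom A M N. \<forall>f \<in> rmod_hom A M E. inj_on g (carrier M) \<longrightarrow>
           (\<exists>h \<in> rmod_hom A N E. \<forall>x \<in> carrier M. h (g x) = f x)))"

text \<open>
  \<open>\<dots> \<rightarrow> P 1 \<rightarrow> P 0 \<rightarrow> M \<rightarrow> 0\<close> with augmentation \<open>e\<close> and differentials
  \<open>d i\<close> from \<open>P (Suc i)\<close> to \<open>P i\<close>.
\<close>

definition projective_resolution ::
  "('a, 'r) ring_scheme \<Rightarrow> ('a, 'm, 'e) module_scheme \<Rightarrow> (nat \<Rightarrow> 'a fgmod)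
    \<Rightarrow> ((nat \<Rightarrow> 'a) \<Rightarrow> 'm) \<Rightarrow> (nat \<Rightarrow> (nat \<Rightarrow> 'a) \<Rightarrow> (nat \<Rightarrow> 'a)) \<Rightarrow> bool" where
  "projective_resolution A M P e d \<longleftrightarrow>
     (\<forall>i. projective_module A (P i)) \<and>
     e \<in> rmod_hom A (P 0) M \<and> e ` carrier (P 0) = carrier M \<and>
     (\<forall>i. d i \<in> rmod_hom A (P (Suc i)) (P i)) \<and>
     d 0 ` carrier (P (Suc 0)) = a_kernel (P 0) M e \<and>
     (\<forall>i. d (Suc i) ` carrier (P (Suc (Suc i))) = a_kernel (P (Suc i)) (P i) (d i))"

text \<open>The infimum of the empty set in \<^typ>\<open>enat\<close> is \<open>\<infinity>\<close>; the zero module gets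
  projective dimension \<open>0\<close>.\<close>

definition pdim :: "('a, 'r) ring_scheme \<Rightarrow> ('a, 'm, 'e) module_scheme \<Rightarrow> enat" where
  "pdim A M = Inf {enat n | n. \<exists>P e d. projective_resolution A M P e d \<and>
     (\<forall>i>n. carrier (P i) = {\<zero>\<^bsub>P i\<^esub>})}"

definition gldim :: "('a, 'r) ring_scheme \<Rightarrow> enat" where
  "gldim A = Sup {pdim A M | M :: 'a fgmod. fg_module A M}"


section \<open>Minimal injective coresolutions and Auslander regular algebras\<close>

definition essential_in ::
  "('a, 'r) ring_scheme \<Rightarrow> 'm set \<Rightarrow> ('a, 'm, 'e) module_scheme \<Rightarrow> bool" where
  "essential_in A U M \<longleftrightarrow> submodule U A M \<and>
     (\<forall>V. submodule V A M \<longrightarrow> V \<noteq> {\<zero>\<^bsub>M\<^esub>} \<longrightarrow> U \<inter> V \<noteq> {\<zero>\<^bsub>M\<^esub>})"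

text \<open>
  \<open>0 \<rightarrow> M \<rightarrow> I 0 \<rightarrow> I 1 \<rightarrow> \<dots>\<close> with coaugmentation \<open>e\<close> and differentials
  \<open>d i\<close> from \<open>I i\<close> to \<open>I (Suc i)\<close>. Minimality: each term is an injective envelope of the
  image of the map into it.
\<close>

definition minimal_injective_coresolution ::
  "('a, 'r) ring_scheme \<Rightarrow> ('a, 'm, 'e) module_scheme \<Rightarrow> (nat \<Rightarrow> 'a fgmod)
    \<Rightarrow> ('m \<Rightarrow> (nat \<Rightarrow> 'a)) \<Rightarrow> (nat \<Rightarrow> (nat \<Rightarrow> 'a) \<Rightarrow> (nat \<Rightarrow> 'a)) \<Rightarrow> bool" where
  "minimal_injective_coresolution A M I e d \<longleftrightarrow>
     (\<forall>i. injective_module A (I i)) \<and>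
     e \<in> rmod_hom A M (I 0) \<and> inj_on e (carrier M) \<and>
     (\<forall>i. d i \<in> rmod_hom A (I i) (I (Suc i))) \<and>
     e ` carrier M = a_kernel (I 0) (I (Suc 0)) (d 0) \<and>
     (\<forall>i. d i ` carrier (I i) = a_kernel (I (Suc i)) (I (Suc (Suc i))) (d (Suc i))) \<and>
     essential_in A (e ` carrier M) (I 0) \<and>
     (\<forall>i. essential_in A (d i ` carrier (I i)) (I (Suc i)))"

text \<open>
  Over a finite dimensional algebra, a minimal injective coresolution of the regular module exists
  and is unique up to isomorphism, so the existential quantifier below makes no choice.
\<close>

definition n_Gorenstein :: "nat \<Rightarrow> ('a, 'r) ring_scheme \<Rightarrow> bool" where
  "n_Gorenstein n A \<longleftrightarrow>
     (\<exists>I e d. minimal_injective_coresolution A (regular_module A) I e d \<and>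
        (\<forall>i<n. pdim A (I i) \<le> enat i))"

definition Auslander_regular :: "('a, 'r) ring_scheme \<Rightarrow> bool" where
  "Auslander_regular A \<longleftrightarrow> (\<forall>n\<ge>1. n_Gorenstein n A) \<and> gldim A < \<infinity>"


section \<open>The incidence algebra of a finite poset\<close>

text \<open>
  The element \<open>f\<close> stands for the linear combination with coefficient \<open>f x y\<close> at the
  basis element indexed by the pair \<open>x \<le> y\<close>.
\<close>

definition incidence_algebra ::
  "'k::field itself \<Rightarrow> 'p::{finite,order} itself \<Rightarrow> ('k, 'p \<Rightarrow> 'p \<Rightarrow> 'k) module" where
  "incidence_algebra _ _ =
     \<lparr>carrier = {f. \<forall>x y. \<not> x \<le> y \<longrightarrow> f x y = 0},
      mult = (\<lambda>f g x z. \<Sum>y\<in>UNIV. f x y * g y z),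
      one = (\<lambda>x y. if x = y then 1 else 0),
      zero = (\<lambda>x y. 0),
      add = (\<lambda>f g x y. f x y + g x y),
      smult = (\<lambda>c f x y. c * f x y)\<rparr>"

definition incidence_basis :: "'p \<Rightarrow> 'p \<Rightarrow> 'p::{finite,order} \<Rightarrow> 'p \<Rightarrow> 'k::field" where
  "incidence_basis x y = (\<lambda>u v. if u = x \<and> v = y then 1 else 0)"

lemma ring_incidence_algebra:
  "ring (incidence_algebra TYPE('k::field) TYPE('p::{finite,order}))"
proof -
  let ?A = "incidence_algebra TYPE('k) TYPE('p)"
  have neg: "\<exists>g\<in>carrier ?A. g \<oplus>\<^bsub>?A\<^esub> f = \<zero>\<^bsub>?A\<^esub>" if "f \<in> carrier ?A" for f
    using that by (intro bexI[of _ "\<lambda>x y. - f x y"]) (auto simp: incidence_algebra_def)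
  have mult: "(\<Sum>y\<in>UNIV. f x y * g y z) = 0"
    if "f \<in> carrier ?A" "g \<in> carrier ?A" "\<not> x \<le> z" for f g x z
  proof (intro sum.neutral ballI)
    fix y
    have "\<not> x \<le> y \<or> \<not> y \<le> z" using that(3) order_trans by blast
    then show "f x y * g y z = 0" using that(1,2) by (auto simp: incidence_algebra_def)
  qed
  have assoc: "(\<Sum>y\<in>UNIV. (\<Sum>w\<in>UNIV. f x w * g w y) * h y z)
      = (\<Sum>w\<in>UNIV. f x w * (\<Sum>y\<in>UNIV. g w y * h y z))" for f g h :: "'p \<Rightarrow> 'p \<Rightarrow> 'k" and x z
    unfolding sum_distrib_left sum_distrib_right by (subst sum.swap) (simp add: mult.assoc)
  show ?thesis
  proof (rule ringI)
    show "abelian_group ?A"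
      by (rule abelian_groupI)
        (use neg in \<open>auto simp: incidence_algebra_def algebra_simps\<close>)
    show "Group.monoid ?A"
    proof (rule monoidI)
      fix f g assume "f \<in> carrier ?A" "g \<in> carrier ?A"
      then show "f \<otimes>\<^bsub>?A\<^esub> g \<in> carrier ?A"
        using mult by (simp add: incidence_algebra_def)
    qed (auto simp: incidence_algebra_def assoc if_distrib[of "\<lambda>x. x * _"] if_distrib[of "\<lambda>x. _ * x"]
        cong: if_cong)
  qed (auto simp: incidence_algebra_def algebra_simps sum.distrib)
qed

lemma incidence_basis_closed:
  "x \<le> y \<Longrightarrow> (incidence_basis x y :: 'p \<Rightarrow> 'p \<Rightarrow> 'k)
     \<in> carrier (incidence_algebra TYPE('k::field) TYPE('p::{finite,order}))"
  by (auto simp: incidence_algebra_def incidence_basis_def)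

lemma incidence_basis_expansion:
  fixes f :: "'p::{finite,order} \<Rightarrow> 'p \<Rightarrow> 'k::field"
  assumes "f \<in> carrier (incidence_algebra TYPE('k) TYPE('p))"
  shows "f u v = (\<Sum>(x, y)\<in>{(x, y). x \<le> y}. f x y * incidence_basis x y u v)"
proof -
  have "(\<Sum>(x, y)\<in>{(x, y). x \<le> y}. f x y * incidence_basis x y u v)
      = (\<Sum>p\<in>{(x, y). x \<le> y}. if p = (u, v) then f u v else 0)"
    by (intro sum.cong) (auto simp: incidence_basis_def split: if_splits)
  then show ?thesis
    using assms by (auto simp: incidence_algebra_def)
qed

lemma incidence_basis_mult:
  "(incidence_basis x1 x2 :: 'p \<Rightarrow> 'p \<Rightarrow> 'k)
     \<otimes>\<^bsub>incidence_algebra TYPE('k::field) TYPE('p::{finite,order})\<^esub> incidence_basis y1 y2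
   = (if x2 = y1 then incidence_basis x1 y2
      else \<zero>\<^bsub>incidence_algebra TYPE('k) TYPE('p)\<^esub>)"
proof (intro ext)
  fix u v
  show "((incidence_basis x1 x2 :: 'p \<Rightarrow> 'p \<Rightarrow> 'k)
      \<otimes>\<^bsub>incidence_algebra TYPE('k) TYPE('p)\<^esub> incidence_basis y1 y2) u v
    = (if x2 = y1 then incidence_basis x1 y2
       else \<zero>\<^bsub>incidence_algebra TYPE('k) TYPE('p)\<^esub>) u v"
    by (auto simp: incidence_algebra_def incidence_basis_def if_distrib[of "\<lambda>x. x * _"]
        cong: if_cong intro!: sum.neutral)
qed

end

theory Submission
  imports Defs "HOL-Library.Function_Algebras"
begin

text \<open>
  Right modules are covariant representations of the lattice; write \<open>P x\<close> and \<open>I y\<close> for the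
  representations with value \<open>K\<close> on the up-set of \<open>x\<close> and the down-set of \<open>y\<close>.

  If the lattice is not distributive, some \<open>y\<close> is maximal among the elements not above some \<open>x\<close>, but is not
  meet prime, say \<open>x1 \<sqinter> x2 \<le> y\<close>. Extending the inclusion of \<open>P x\<close> into the constant representation produces a
  socle vector at \<open>y\<close> in the term of degree one of the minimal injective coresolution, and the copy of
  \<open>I y\<close> that it generates contains a vector at \<open>x1 \<sqinter> x2\<close> that dies at \<open>x1\<close> and at \<open>x2\<close>. This is
  impossible in a representation of projective dimension at most one.

  In a distributive lattice let \<open>Y\<close> be the set of maximal elements not above \<open>x\<close>. Pointwise the Koszul complex
  whose term of degree \<open>i\<close> is the sum of the \<open>I (\<Sqinter>T)\<close> over the subsets \<open>T\<close> of \<open>Y\<close> with \<open>i\<close> elements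
  is the cochain complex of a simplex, so it coresolves \<open>P x\<close>; it is minimal because the elements of \<open>Y\<close> are
  incomparable meet primes. Dually, the complement of the down-set of a meet prime is a principal
  up-set, and another Koszul complex, of length \<open>i\<close>, resolves \<open>I (\<Sqinter>T)\<close> by projectives.
\<close>

section \<open>Right modules\<close>

text \<open>In a free representation a generator at \<open>u\<close> contributes at
  \<open>x1\<close> and at \<open>x2\<close> exactly when \<open>u\<close> lies below
  \<open>inf x1 x2\<close>; so vectors at \<open>x1\<close> and \<open>x2\<close> that agree at the
  top come from the meet. A resolution of length one has a projective first syzygy, which inherits
  this gluing: hence the obstruction. The terms of the given coresolution have unknown shape and are
  probed by maps from interval representations.

  The Koszul coresolution is exact in every finite lattice. Distributivity makes the elements of
  \<open>Y\<close> meet prime, and primality is used for the essential kernels and for the principal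
  up-sets in the projective resolutions. Finite global dimension is a separate matter and holds for
  every finite poset.

  All modules built here have vectors of type
  \<open>nat \<Rightarrow> 'l \<Rightarrow> 'l \<Rightarrow> 'k\<close>. The arguments are a number,
  a vertex naming a row of the algebra, and the vertex where the coordinate sits; the number counts
  copies of the algebra or codes a set or a pair of sets. Unknown modules are reached through covers
  by free modules of this form.\<close>

lemma rmod_homI:
  assumes "\<And>x. x \<in> carrier M \<Longrightarrow> f x \<in> carrier N"
    and "\<And>x y. x \<in> carrier M \<Longrightarrow> y \<in> carrier M \<Longrightarrow> f (x \<oplus>\<^bsub>M\<^esub> y) = f x \<oplus>\<^bsub>N\<^esub> f y"
    and "\<And>a x. a \<in> carrier A \<Longrightarrow> x \<in> carrier M \<Longrightarrow> f (a \<odot>\<^bsub>M\<^esub> x) = a \<odot>\<^bsub>N\<^esub> f x"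
  shows "f \<in> rmod_hom A M N"
  using assms by (auto simp: rmod_hom_def hom_def)

lemma rmod_homD:
  assumes "f \<in> rmod_hom A M N"
  shows "x \<in> carrier M \<Longrightarrow> f x \<in> carrier N"
    and "x \<in> carrier M \<Longrightarrow> y \<in> carrier M \<Longrightarrow> f (x \<oplus>\<^bsub>M\<^esub> y) = f x \<oplus>\<^bsub>N\<^esub> f y"
    and "a \<in> carrier A \<Longrightarrow> x \<in> carrier M \<Longrightarrow> f (a \<odot>\<^bsub>M\<^esub> x) = a \<odot>\<^bsub>N\<^esub> f x"
  using assms by (auto simp: rmod_hom_def hom_def)

lemma rmod_hom_zero:
  assumes "f \<in> rmod_hom A M N" "abelian_group M" "abelian_group N"
  shows "f \<zero>\<^bsub>M\<^esub> = \<zero>\<^bsub>N\<^esub>"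
proof -
  interpret M: abelian_group M by fact
  interpret N: abelian_group N by fact
  have "f \<zero>\<^bsub>M\<^esub> \<oplus>\<^bsub>N\<^esub> f \<zero>\<^bsub>M\<^esub> = f \<zero>\<^bsub>M\<^esub> \<oplus>\<^bsub>N\<^esub> \<zero>\<^bsub>N\<^esub>"
    using rmod_homD(1,2)[OF assms(1)] by (metis M.zero_closed M.l_zero N.r_zero)
  then show ?thesis
    using rmod_homD(1)[OF assms(1)] by simp
qed

lemma rmod_hom_minus:
  assumes "f \<in> rmod_hom A M N" "abelian_group M" "abelian_group N" "x \<in> carrier M"
  shows "f (\<ominus>\<^bsub>M\<^esub> x) = \<ominus>\<^bsub>N\<^esub> f x"
proof -
  interpret M: abelian_group M by fact
  interpret N: abelian_group N by fact
  have "f (\<ominus>\<^bsub>M\<^esub> x) \<oplus>\<^bsub>N\<^esub> f x = \<zero>\<^bsub>N\<^esub>"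
    using rmod_homD(1,2)[OF assms(1)] rmod_hom_zero[OF assms(1-3)] assms(4)
    by (metis M.a_inv_closed M.l_neg)
  then show ?thesis
    using rmod_homD(1)[OF assms(1)] assms(4) by (simp add: N.minus_equality)
qed

lemma rmod_hom_diff:
  assumes "f \<in> rmod_hom A M N" "abelian_group M" "abelian_group N"
    "x \<in> carrier M" "y \<in> carrier M"
  shows "f (x \<ominus>\<^bsub>M\<^esub> y) = f x \<ominus>\<^bsub>N\<^esub> f y"
  using rmod_hom_minus[OF assms(1-3)] rmod_homD[OF assms(1)] assms(4,5)
    abelian_group.a_inv_closed[OF assms(2)]
  by (simp add: a_minus_def)

lemma rmod_hom_finsum:
  assumes "f \<in> rmod_hom A M N" "abelian_group M" "abelian_group N"
    "finite I" "\<And>i. i \<in> I \<Longrightarrow> g i \<in> carrier M"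
  shows "f (\<Oplus>\<^bsub>M\<^esub>i\<in>I. g i) = (\<Oplus>\<^bsub>N\<^esub>i\<in>I. f (g i))"
proof -
  interpret M: abelian_group M by fact
  interpret N: abelian_group N by fact
  show ?thesis
    using assms(4,5)
  proof (induction I rule: finite_induct)
    case empty
    then show ?case using rmod_hom_zero[OF assms(1-3)] by simp
  next
    case (insert i I)
    then have "g \<in> I \<rightarrow> carrier M" "(\<lambda>i. f (g i)) \<in> I \<rightarrow> carrier N" "g i \<in> carrier M"
      "f (g i) \<in> carrier N"
      using rmod_homD(1)[OF assms(1)] by auto
    then show ?case
      using insert rmod_homD(2)[OF assms(1)] by simp
  qed
qed

lemma rmod_hom_compose:
  assumes "f \<in> rmod_hom A M N" "g \<in> rmod_hom A N Q"
  shows "(\<lambda>x. g (f x)) \<in> rmod_hom A M Q"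
  using rmod_homD[OF assms(1)] rmod_homD[OF assms(2)] by (intro rmod_homI) auto

context right_module
begin

lemma ract_zero: "a \<in> carrier A \<Longrightarrow> a \<odot>\<^bsub>M\<^esub> \<zero>\<^bsub>M\<^esub> = \<zero>\<^bsub>M\<^esub>"
  by (metis M.add.l_cancel_one' M.zero_closed ract_closed ract_distr_module M.l_zero)

lemma zero_ract: "x \<in> carrier M \<Longrightarrow> \<zero>\<^bsub>A\<^esub> \<odot>\<^bsub>M\<^esub> x = \<zero>\<^bsub>M\<^esub>"
  by (metis M.add.l_cancel_one' R.zero_closed ract_closed ract_distr_ring R.l_zero)

lemma ract_minus: "a \<in> carrier A \<Longrightarrow> x \<in> carrier M \<Longrightarrow> a \<odot>\<^bsub>M\<^esub> (\<ominus>\<^bsub>M\<^esub> x) = \<ominus>\<^bsub>M\<^esub> (a \<odot>\<^bsub>M\<^esub> x)"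
  by (metis M.a_inv_closed M.l_neg M.minus_equality ract_closed ract_distr_module ract_zero)

lemma minus_ract: "x \<in> carrier M \<Longrightarrow> (\<ominus>\<^bsub>A\<^esub> \<one>\<^bsub>A\<^esub>) \<odot>\<^bsub>M\<^esub> x = \<ominus>\<^bsub>M\<^esub> x"
  by (metis M.minus_equality R.a_inv_closed R.l_neg R.one_closed ract_closed ract_distr_ring ract_one
      zero_ract)

lemma ract_finsum:
  assumes "finite I" "a \<in> carrier A" "\<And>i. i \<in> I \<Longrightarrow> g i \<in> carrier M"
  shows "a \<odot>\<^bsub>M\<^esub> (\<Oplus>\<^bsub>M\<^esub>i\<in>I. g i) = (\<Oplus>\<^bsub>M\<^esub>i\<in>I. a \<odot>\<^bsub>M\<^esub> g i)"
  using assms(1,3)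
proof (induction I rule: finite_induct)
  case empty
  then show ?case using ract_zero assms(2) by simp
next
  case (insert i I)
  then have "g \<in> I \<rightarrow> carrier M" "(\<lambda>i. a \<odot>\<^bsub>M\<^esub> g i) \<in> I \<rightarrow> carrier M" "g i \<in> carrier M"
    "a \<odot>\<^bsub>M\<^esub> g i \<in> carrier M"
    using ract_closed assms(2) by auto
  then show ?case
    using insert assms(2) ract_distr_module by simp
qed

lemma finsum_ract:
  assumes "finite I" "x \<in> carrier M" "\<And>i. i \<in> I \<Longrightarrow> g i \<in> carrier A"
  shows "(\<Oplus>\<^bsub>A\<^esub>i\<in>I. g i) \<odot>\<^bsub>M\<^esub> x = (\<Oplus>\<^bsub>M\<^esub>i\<in>I. g i \<odot>\<^bsub>M\<^esub> x)"
  using assms(1,3)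
proof (induction I rule: finite_induct)
  case empty
  then show ?case using zero_ract assms(2) by simp
next
  case (insert i I)
  then have "g \<in> I \<rightarrow> carrier A" "(\<lambda>i. g i \<odot>\<^bsub>M\<^esub> x) \<in> I \<rightarrow> carrier M" "g i \<in> carrier A"
    "g i \<odot>\<^bsub>M\<^esub> x \<in> carrier M"
    using ract_closed assms(2) by auto
  then show ?case
    using insert assms(2) ract_distr_ring by simp
qed

text \<open>\<open>submodule\<close> asks for an additive subgroup closed under scalars, so the
  notion fits right modules as well; negatives come from the action of minus one.\<close>

lemma right_submoduleI:
  assumes "H \<subseteq> carrier M" "\<zero>\<^bsub>M\<^esub> \<in> H"
    and "\<And>x y. x \<in> H \<Longrightarrow> y \<in> H \<Longrightarrow> x \<oplus>\<^bsub>M\<^esub> y \<in> H"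
    and "\<And>a x. a \<in> carrier A \<Longrightarrow> x \<in> H \<Longrightarrow> a \<odot>\<^bsub>M\<^esub> x \<in> H"
  shows "submodule H A M"
proof -
  have "\<ominus>\<^bsub>M\<^esub> x \<in> H" if "x \<in> H" for x
    using that assms(1) assms(4)[of "\<ominus>\<^bsub>A\<^esub> \<one>\<^bsub>A\<^esub>" x] minus_ract[of x] by auto
  then show ?thesis
    using assms by (intro submodule.intro subgroup.intro submodule_axioms.intro) (auto simp: a_inv_def)
qed

lemma right_submoduleD:
  assumes "submodule H A M"
  shows "H \<subseteq> carrier M" "\<zero>\<^bsub>M\<^esub> \<in> H"
    and "\<And>x y. x \<in> H \<Longrightarrow> y \<in> H \<Longrightarrow> x \<oplus>\<^bsub>M\<^esub> y \<in> H"
    and "\<And>a x. a \<in> carrier A \<Longrightarrow> x \<in> H \<Longrightarrow> a \<odot>\<^bsub>M\<^esub> x \<in> H"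
proof -
  interpret submodule H A M by fact
  show "H \<subseteq> carrier M" "\<zero>\<^bsub>M\<^esub> \<in> H"
    and "\<And>x y. x \<in> H \<Longrightarrow> y \<in> H \<Longrightarrow> x \<oplus>\<^bsub>M\<^esub> y \<in> H"
    and "\<And>a x. a \<in> carrier A \<Longrightarrow> x \<in> H \<Longrightarrow> a \<odot>\<^bsub>M\<^esub> x \<in> H"
    using subset one_closed m_closed smult_closed by auto
qed

lemma submodule_carrier: "submodule (carrier M) A M"
  by (rule right_submoduleI) (auto simp: ract_closed)

lemma right_module_submodule:
  assumes "submodule H A M"
  shows "right_module A (M\<lparr>carrier := H\<rparr>)"
proof -
  note H = right_submoduleD[OF assms]
  have "\<exists>y\<in>H. y \<oplus>\<^bsub>M\<^esub> x = \<zero>\<^bsub>M\<^esub>" if "x \<in> H" for x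
    using that H(1) H(4)[of "\<ominus>\<^bsub>A\<^esub> \<one>\<^bsub>A\<^esub>" x] minus_ract[of x]
    by (intro bexI[of _ "\<ominus>\<^bsub>M\<^esub> x"]) (auto simp: M.l_neg)
  then have "abelian_group (M\<lparr>carrier := H\<rparr>)"
    using H by (intro abelian_groupI) (auto simp: M.a_ac subset_iff)
  then show ?thesis
    using H
    by (intro right_module.intro right_module_axioms.intro R.ring_axioms)
      (auto simp: ract_distr_ring ract_distr_module ract_assoc ract_one subset_iff)
qed

end

lemma submodule_kernel:
  assumes "right_module A M" "right_module A N" "f \<in> rmod_hom A M N"
  shows "submodule (a_kernel M N f) A M"
proof -
  interpret M: right_module A M by fact
  interpret N: right_module A N by fact
  show ?thesis
    using rmod_homD[OF assms(3)]
      rmod_hom_zero[OF assms(3) M.M.abelian_group_axioms N.M.abelian_group_axioms]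
    by (intro M.right_submoduleI) (auto simp: a_kernel_def' M.ract_closed N.ract_zero)
qed

section \<open>Modules over the incidence algebra\<close>

abbreviation inc :: "('k::field, 'l::{finite,order} \<Rightarrow> 'l \<Rightarrow> 'k) module"
  where "inc \<equiv> incidence_algebra TYPE('k) TYPE('l)"

lemma inc_carrier: "f \<in> carrier inc \<longleftrightarrow> (\<forall>x y. \<not> x \<le> y \<longrightarrow> f x y = 0)"
  and inc_mult: "(f \<otimes>\<^bsub>inc\<^esub> g) x z = (\<Sum>y\<in>UNIV. f x y * g y z)"
  and inc_one: "\<one>\<^bsub>inc\<^esub> x y = (if x = y then 1 else 0)"
  and inc_zero: "\<zero>\<^bsub>inc\<^esub> x y = 0"
  and inc_add: "(f \<oplus>\<^bsub>inc\<^esub> g) x y = f x y + g x y"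
  by (simp_all add: incidence_algebra_def)

lemma inc_basis_closed [simp]: "x \<le> y \<Longrightarrow> incidence_basis x y \<in> carrier inc"
  by (rule incidence_basis_closed)

lemma inc_basis_mult:
  "(incidence_basis x y :: 'l::{finite,order} \<Rightarrow> 'l \<Rightarrow> 'k::field) \<otimes>\<^bsub>inc\<^esub> incidence_basis y z = incidence_basis x z"
  by (simp add: incidence_basis_mult)

text \<open>Convexity makes the truncated action in \<open>support_module\<close> associative;
  finiteness of the set of nonempty components makes the module finite dimensional.\<close>

locale convex_family =
  fixes C :: "nat \<Rightarrow> 'l::{finite,order} \<Rightarrow> 'l set"
  assumes finite_family: "finite {(n, x). C n x \<noteq> {}}"
    and convex: "u \<in> C n x \<Longrightarrow> w \<in> C n x \<Longrightarrow> u \<le> v \<Longrightarrow> v \<le> w \<Longrightarrow> v \<in> C n x"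

text \<open>
  Right modules over the incidence algebra are covariant representations of the poset. The following is the direct
  sum over \<open>(n, x)\<close> of the interval representations with value \<open>K\<close> on \<open>C n x\<close>;
  the number \<open>f n x v\<close> is the coordinate of \<open>f\<close> at the vertex \<open>v\<close>.
\<close>

definition support_module ::
    "(nat \<Rightarrow> 'l \<Rightarrow> 'l set) \<Rightarrow> ('l::{finite,order} \<Rightarrow> 'l \<Rightarrow> 'k::field) fgmod" where
  "support_module C =
     \<lparr>carrier = {f. \<forall>n x v. v \<notin> C n x \<longrightarrow> f n x v = 0},
      mult = (\<lambda>_ _. undefined), one = undefined,
      zero = (\<lambda>_ _ _. 0), add = (\<lambda>f g n x v. f n x v + g n x v),
      smult = (\<lambda>a f n x v. if v \<in> C n x then \<Sum>u\<in>UNIV. f n x u * a u v else 0)\<rparr>"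

lemma sm_carrier: "f \<in> carrier (support_module C) \<longleftrightarrow> (\<forall>n x v. v \<notin> C n x \<longrightarrow> f n x v = 0)"
  and sm_zero: "\<zero>\<^bsub>support_module C\<^esub> = (\<lambda>_ _ _. 0)"
  and sm_add: "(f \<oplus>\<^bsub>support_module C\<^esub> g) = (\<lambda>n x v. f n x v + g n x v)"
  and sm_smult: "(a \<odot>\<^bsub>support_module C\<^esub> f) =
    (\<lambda>n x v. if v \<in> C n x then \<Sum>u\<in>UNIV. f n x u * a u v else 0)"
  by (simp_all add: support_module_def)

lemma sm_basis_smult:
  "(incidence_basis u v \<odot>\<^bsub>support_module C\<^esub> f) n x w = (if w = v \<and> v \<in> C n x then f n x u else 0)"
proof -
  have "(\<Sum>t\<in>UNIV. f n x t * incidence_basis u v t w) = (\<Sum>t\<in>UNIV. if t = u then (if w = v then f n x u else 0) else 0)"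
    by (intro sum.cong) (auto simp: incidence_basis_def)
  then show ?thesis by (auto simp: sm_smult)
qed

context convex_family
begin

lemma right_module_support:
  "right_module inc (support_module C :: ('l \<Rightarrow> 'l \<Rightarrow> 'k::field) fgmod)"
proof -
  let ?M = "support_module C :: ('l \<Rightarrow> 'l \<Rightarrow> 'k) fgmod"
  have neg: "\<exists>g\<in>carrier ?M. g \<oplus>\<^bsub>?M\<^esub> f = \<zero>\<^bsub>?M\<^esub>" if "f \<in> carrier ?M" for f
    using that by (intro bexI[of _ "\<lambda>n x v. - f n x v"]) (auto simp: sm_carrier sm_add sm_zero)
  have ag: "abelian_group ?M"
    by (rule abelian_groupI) (use neg in \<open>auto simp: sm_carrier sm_add sm_zero algebra_simps\<close>)
  have assoc: "(a \<otimes>\<^bsub>inc\<^esub> b) \<odot>\<^bsub>?M\<^esub> f = b \<odot>\<^bsub>?M\<^esub> (a \<odot>\<^bsub>?M\<^esub> f)"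
    if a: "a \<in> carrier inc" and b: "b \<in> carrier inc" and f: "f \<in> carrier ?M" for a b f
  proof (intro ext)
    fix n x v
    show "((a \<otimes>\<^bsub>inc\<^esub> b) \<odot>\<^bsub>?M\<^esub> f) n x v = (b \<odot>\<^bsub>?M\<^esub> (a \<odot>\<^bsub>?M\<^esub> f)) n x v"
    proof (cases "v \<in> C n x")
      case True
      \<comment> \<open>Truncating at the intermediate vertex \<open>u\<close> loses nothing: a
        contribution travels from some \<open>w\<close> in \<open>C n x\<close> through
        \<open>u\<close> to \<open>v\<close> in \<open>C n x\<close>, and convexity puts
        \<open>u\<close> into \<open>C n x\<close>.\<close>
      have inner: "(if u \<in> C n x then \<Sum>w\<in>UNIV. f n x w * a w u else 0) * b u v
          = (\<Sum>w\<in>UNIV. f n x w * a w u * b u v)" for u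
      proof (cases "u \<in> C n x \<or> \<not> u \<le> v")
        case True
        then show ?thesis using b by (auto simp: sum_distrib_right inc_carrier)
      next
        case False
        then have "f n x w * a w u = 0" for w
          using f a convex[OF _ \<open>v \<in> C n x\<close>, of w u] unfolding sm_carrier inc_carrier mult_eq_0_iff by blast
        then have "(\<Sum>w\<in>UNIV. f n x w * a w u * b u v) = 0" by (simp del: mult_eq_0_iff)
        then show ?thesis using False by simp
      qed
      have "((a \<otimes>\<^bsub>inc\<^esub> b) \<odot>\<^bsub>?M\<^esub> f) n x v = (\<Sum>w\<in>UNIV. \<Sum>u\<in>UNIV. f n x w * a w u * b u v)"
        using True by (simp add: sm_smult inc_mult sum_distrib_left mult.assoc)
      also have "\<dots> = (b \<odot>\<^bsub>?M\<^esub> (a \<odot>\<^bsub>?M\<^esub> f)) n x v"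
        using True by (subst sum.swap) (simp add: sm_smult inner)
      finally show ?thesis .
    qed (simp add: sm_smult)
  qed
  have one: "\<one>\<^bsub>inc\<^esub> \<odot>\<^bsub>?M\<^esub> f = f" if "f \<in> carrier ?M" for f
    using that
    by (intro ext) (auto simp: sm_smult sm_carrier inc_one if_distrib[of "\<lambda>x. _ * x"] cong: if_cong)
  have distr: "(a \<oplus>\<^bsub>inc\<^esub> b) \<odot>\<^bsub>?M\<^esub> f = a \<odot>\<^bsub>?M\<^esub> f \<oplus>\<^bsub>?M\<^esub> b \<odot>\<^bsub>?M\<^esub> f"
    "a \<odot>\<^bsub>?M\<^esub> (f \<oplus>\<^bsub>?M\<^esub> g) = a \<odot>\<^bsub>?M\<^esub> f \<oplus>\<^bsub>?M\<^esub> a \<odot>\<^bsub>?M\<^esub> g" for a b f g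
    by (intro ext, simp add: sm_smult sm_add inc_add algebra_simps sum.distrib)+
  have "a \<odot>\<^bsub>?M\<^esub> f \<in> carrier ?M" for a f
    by (simp add: sm_smult sm_carrier)
  then show ?thesis
    using ring_incidence_algebra ag assoc one distr
    by (intro right_module.intro right_module_axioms.intro)
qed

end

sublocale convex_family \<subseteq> right_module inc "support_module C"
  by (rule right_module_support)

lemma finsum_support_submodule:
  fixes C :: "nat \<Rightarrow> 'l::{finite,order} \<Rightarrow> 'l set"
    and g :: "'i \<Rightarrow> nat \<Rightarrow> 'l \<Rightarrow> 'l \<Rightarrow> 'k::field"
  assumes "convex_family C" "submodule U inc (support_module C)" "finite I" "\<And>i. i \<in> I \<Longrightarrow> g i \<in> U"
  shows "(\<Oplus>\<^bsub>(support_module C)\<lparr>carrier := U\<rparr>\<^esub>i\<in>I. g i) = (\<lambda>n x v. \<Sum>i\<in>I. g i n x v)"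
proof -
  interpret convex_family C by fact
  interpret U: right_module inc "(support_module C)\<lparr>carrier := U\<rparr>"
    by (rule right_module_submodule[OF assms(2)])
  show ?thesis
    using assms(3,4)
  proof (induction I rule: finite_induct)
    case empty
    show ?case using U.M.finsum_empty by (simp add: sm_zero)
  next
    case (insert i I)
    then have "g \<in> I \<rightarrow> U" by auto
    then show ?case
      using insert by (simp add: U.M.finsum_insert sm_add)
  qed
qed

lemma finsum_support:
  fixes g :: "'i \<Rightarrow> nat \<Rightarrow> 'l::{finite,order} \<Rightarrow> 'l \<Rightarrow> 'k::field"
  assumes "convex_family C" "finite I" "\<And>i. i \<in> I \<Longrightarrow> g i \<in> carrier (support_module C)"
  shows "(\<Oplus>\<^bsub>support_module C\<^esub>i\<in>I. g i) = (\<lambda>n x v. \<Sum>i\<in>I. g i n x v)"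
proof -
  interpret convex_family C by fact
  have "(support_module C)\<lparr>carrier := carrier (support_module C)\<rparr> = (support_module C :: ('l \<Rightarrow> 'l \<Rightarrow> 'k) fgmod)"
    by simp
  then show ?thesis
    using finsum_support_submodule[OF assms(1) submodule_carrier assms(2), of g] assms(3) by simp
qed

section \<open>The underlying vector spaces and finite generation\<close>

definition vscale :: "'k::field \<Rightarrow> (nat \<Rightarrow> 'l \<Rightarrow> 'l \<Rightarrow> 'k) \<Rightarrow> nat \<Rightarrow> 'l \<Rightarrow> 'l \<Rightarrow> 'k" where
  "vscale c f = (\<lambda>n x v. c * f n x v)"

text \<open>\<open>vector_space\<close> speaks about a whole type, so the scalars act on all
  functions; the carriers of support modules are subspaces.\<close>

lemma vector_space_vscale: "vector_space vscale"
  by unfold_locales (auto simp: vscale_def fun_eq_iff algebra_simps)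

lemma sum_fun_apply3: "(\<Sum>i\<in>I. g i) n x v = (\<Sum>i\<in>I. g i n x v)"
  for g :: "'i \<Rightarrow> 'a \<Rightarrow> 'b \<Rightarrow> 'c \<Rightarrow> 'k::comm_monoid_add"
  by (induction I rule: infinite_finite_induct) auto

text \<open>The field sits in the algebra as the scalar matrices; through them every module over the
  algebra is a vector space, whatever its carrier.\<close>

definition inc_scalar :: "'k::field \<Rightarrow> 'l \<Rightarrow> 'l \<Rightarrow> 'k" where
  "inc_scalar c = (\<lambda>x y. if x = y then c else 0)"

lemma inc_scalar_closed [simp]: "inc_scalar c \<in> carrier inc"
  by (auto simp: inc_carrier inc_scalar_def)

lemma sm_scalar_smult:
  assumes "f \<in> carrier (support_module C)"
  shows "inc_scalar c \<odot>\<^bsub>support_module C\<^esub> f = vscale c f"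
  using assms
  by (intro ext) (auto simp: sm_smult sm_carrier inc_scalar_def vscale_def if_distrib[of "\<lambda>x. _ * x"] mult.commute cong: if_cong)

lemma support_finite_spanning:
  assumes "convex_family C"
  obtains D :: "(nat \<Rightarrow> 'l::{finite,order} \<Rightarrow> 'l \<Rightarrow> 'k::field) set"
  where "finite D" "carrier (support_module C) \<subseteq> module.span vscale D"
proof -
  interpret convex_family C by fact
  interpret V: vector_space "vscale :: 'k \<Rightarrow> (nat \<Rightarrow> 'l \<Rightarrow> 'l \<Rightarrow> 'k) \<Rightarrow> _"
    by (rule vector_space_vscale)
  let ?J = "{(n, x). C n x \<noteq> {}} \<times> (UNIV :: 'l set)"
  define dl :: "(nat \<times> 'l) \<times> 'l \<Rightarrow> nat \<Rightarrow> 'l \<Rightarrow> 'l \<Rightarrow> 'k"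
    where "dl = (\<lambda>((n, x), v). (\<lambda>n' x' v'. if n' = n \<and> x' = x \<and> v' = v then 1 else 0 :: 'k))"
  have fin: "finite ?J" using finite_family by simp
  have "f \<in> V.span (dl ` ?J)" if "f \<in> carrier (support_module C)" for f
  proof -
    have eq: "f = (\<Sum>j\<in>?J. vscale (f (fst (fst j)) (snd (fst j)) (snd j)) (dl j))" (is "_ = sum ?g _")
    proof (intro ext)
      fix n x v
      have "(\<Sum>j\<in>?J. ?g j) n x v = (\<Sum>j\<in>?J. if j = ((n, x), v) then f n x v else 0)"
        unfolding sum_fun_apply3 by (intro sum.cong) (auto simp: dl_def vscale_def split: if_splits)
      also have "\<dots> = f n x v"
        using that fin by (auto simp: sm_carrier)
      finally show "f n x v = (\<Sum>j\<in>?J. ?g j) n x v" by simp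
    qed
    show ?thesis
      by (subst eq) (intro V.span_sum V.span_scale V.span_base imageI)
  qed
  then show ?thesis using that[of "dl ` ?J"] fin by auto
qed

text \<open>A finite basis over the field already generates, since scalars act through
  \<open>inc_scalar\<close>. Submodules are covered because the syzygies below are kernels inside
  support modules.\<close>

lemma fg_support_submodule:
  fixes C :: "nat \<Rightarrow> 'l::{finite,order} \<Rightarrow> 'l set"
  assumes "convex_family C" "submodule U inc (support_module C :: ('l \<Rightarrow> 'l \<Rightarrow> 'k::field) fgmod)"
  shows "fg_module inc ((support_module C :: ('l \<Rightarrow> 'l \<Rightarrow> 'k) fgmod)\<lparr>carrier := U\<rparr>)"
proof -
  interpret convex_family C by fact
  interpret V: vector_space "vscale :: 'k \<Rightarrow> (nat \<Rightarrow> 'l \<Rightarrow> 'l \<Rightarrow> 'k) \<Rightarrow> _"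
    by (rule vector_space_vscale)
  note U = right_submoduleD[OF assms(2)]
  obtain D :: "(nat \<Rightarrow> 'l \<Rightarrow> 'l \<Rightarrow> 'k) set"
    where D: "finite D" "carrier (support_module C) \<subseteq> V.span D"
    using support_finite_spanning[OF assms(1)] by blast
  obtain B where B: "B \<subseteq> U" "V.independent B" "U \<subseteq> V.span B"
    by (rule V.maximal_independent_subset)
  have fin: "finite B"
    using V.independent_span_bound[OF D(1) B(2)] B(1) U(1) D(2) by blast
  have "\<exists>c\<in>B \<rightarrow> carrier inc. f = (\<Oplus>\<^bsub>(support_module C)\<lparr>carrier := U\<rparr>\<^esub>s\<in>B. c s \<odot>\<^bsub>(support_module C)\<lparr>carrier := U\<rparr>\<^esub> s)"
    if "f \<in> U" for f
  proof -
    have "f \<in> range (\<lambda>c. \<Sum>b\<in>B. vscale (c b) b)"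
      using that B(3) unfolding V.span_finite[OF fin] by (rule set_mp[rotated])
    then obtain c where c: "f = (\<Sum>b\<in>B. vscale (c b) b)" by auto
    have "(\<Oplus>\<^bsub>(support_module C)\<lparr>carrier := U\<rparr>\<^esub>s\<in>B. inc_scalar (c s) \<odot>\<^bsub>(support_module C)\<^esub> s)
        = (\<lambda>n x v. \<Sum>s\<in>B. (inc_scalar (c s) \<odot>\<^bsub>(support_module C)\<^esub> s) n x v)"
      using B(1) U(4) by (intro finsum_support_submodule assms fin) auto
    also have "\<dots> = (\<lambda>n x v. \<Sum>s\<in>B. vscale (c s) s n x v)"
      using B(1) U(1) by (intro ext sum.cong refl) (simp add: sm_scalar_smult subset_iff)
    also have "\<dots> = f"
      by (intro ext) (simp add: c sum_fun_apply3)
    finally show ?thesis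
      by (intro bexI[of _ "\<lambda>s. inc_scalar (c s)"]) auto
  qed
  then show ?thesis
    unfolding fg_module_def
    using right_module_submodule[OF assms(2)] fin B(1) by auto
qed

lemma fg_support:
  assumes "convex_family C"
  shows "fg_module inc (support_module C :: ('l::{finite,order} \<Rightarrow> 'l \<Rightarrow> 'k::field) fgmod)"
proof -
  interpret convex_family C by fact
  have "(support_module C)\<lparr>carrier := carrier (support_module C)\<rparr> = (support_module C :: ('l \<Rightarrow> 'l \<Rightarrow> 'k) fgmod)"
    by simp
  then show ?thesis
    using fg_support_submodule[OF assms submodule_carrier] by simp
qed

section \<open>Homomorphisms assembled from maps into the regular module\<close>

lemma inc_m_closed: "a \<in> carrier inc \<Longrightarrow> b \<in> carrier inc \<Longrightarrow> a \<otimes>\<^bsub>inc\<^esub> b \<in> carrier inc"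
  by (rule monoid.m_closed[OF ring.is_monoid[OF ring_incidence_algebra]])

lemma regular_module_simps:
  "carrier (regular_module A) = carrier A" "\<zero>\<^bsub>regular_module A\<^esub> = \<zero>\<^bsub>A\<^esub>"
  "x \<oplus>\<^bsub>regular_module A\<^esub> y = x \<oplus>\<^bsub>A\<^esub> y" "a \<odot>\<^bsub>regular_module A\<^esub> x = x \<otimes>\<^bsub>A\<^esub> a"
  by (simp_all add: regular_module_def)

text \<open>The way to define maps out of projective support modules: coordinates with values in the
  algebra act on chosen elements of the target. Linearity is \<open>ract_assoc\<close>, because the
  algebra acts on the coordinates from the right.\<close>

lemma rmod_hom_combination:
  assumes "right_module A N" "finite I"
    and R: "\<And>i. i \<in> I \<Longrightarrow> R i \<in> rmod_hom A M (regular_module A)"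
    and m: "\<And>i. i \<in> I \<Longrightarrow> m i \<in> carrier N"
  shows "(\<lambda>x. \<Oplus>\<^bsub>N\<^esub>i\<in>I. R i x \<odot>\<^bsub>N\<^esub> m i) \<in> rmod_hom A M N"
proof -
  interpret N: right_module A N by fact
  note R' = rmod_homD[OF R, unfolded regular_module_simps]
  have cl: "(\<lambda>i. R i x \<odot>\<^bsub>N\<^esub> m i) \<in> I \<rightarrow> carrier N" if "x \<in> carrier M" for x
    using R'(1) m that by (auto intro: N.ract_closed)
  show ?thesis
  proof (rule rmod_homI)
    fix x y assume x: "x \<in> carrier M" and y: "y \<in> carrier M"
    have "(\<Oplus>\<^bsub>N\<^esub>i\<in>I. R i (x \<oplus>\<^bsub>M\<^esub> y) \<odot>\<^bsub>N\<^esub> m i) = (\<Oplus>\<^bsub>N\<^esub>i\<in>I. R i x \<odot>\<^bsub>N\<^esub> m i \<oplus>\<^bsub>N\<^esub> R i y \<odot>\<^bsub>N\<^esub> m i)"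
      using cl[OF x] cl[OF y] x y R' m
      by (intro N.M.finsum_cong') (auto simp: N.ract_distr_ring)
    then show "(\<Oplus>\<^bsub>N\<^esub>i\<in>I. R i (x \<oplus>\<^bsub>M\<^esub> y) \<odot>\<^bsub>N\<^esub> m i)
        = (\<Oplus>\<^bsub>N\<^esub>i\<in>I. R i x \<odot>\<^bsub>N\<^esub> m i) \<oplus>\<^bsub>N\<^esub> (\<Oplus>\<^bsub>N\<^esub>i\<in>I. R i y \<odot>\<^bsub>N\<^esub> m i)"
      using N.M.finsum_addf[OF cl[OF x] cl[OF y]] by simp
  next
    fix a x assume a: "a \<in> carrier A" and x: "x \<in> carrier M"
    have "(\<Oplus>\<^bsub>N\<^esub>i\<in>I. R i (a \<odot>\<^bsub>M\<^esub> x) \<odot>\<^bsub>N\<^esub> m i) = (\<Oplus>\<^bsub>N\<^esub>i\<in>I. a \<odot>\<^bsub>N\<^esub> (R i x \<odot>\<^bsub>N\<^esub> m i))"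
      using cl[OF x] a x R' m
      by (intro N.M.finsum_cong') (auto simp: N.ract_assoc intro!: N.ract_closed)
    then show "(\<Oplus>\<^bsub>N\<^esub>i\<in>I. R i (a \<odot>\<^bsub>M\<^esub> x) \<odot>\<^bsub>N\<^esub> m i) = a \<odot>\<^bsub>N\<^esub> (\<Oplus>\<^bsub>N\<^esub>i\<in>I. R i x \<odot>\<^bsub>N\<^esub> m i)"
      using cl[OF x] a assms(2) by (subst N.ract_finsum) auto
  qed (use cl in auto)
qed

section \<open>Projective support modules\<close>

text \<open>Identifies the representation on the up-set of \<open>p\<close> with the right ideal of
  matrices concentrated in row \<open>p\<close>.\<close>

definition inc_row :: "'l \<Rightarrow> ('l \<Rightarrow> 'k::field) \<Rightarrow> 'l \<Rightarrow> 'l \<Rightarrow> 'k" where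
  "inc_row p \<phi> = (\<lambda>u v. if u = p then \<phi> v else 0)"

lemma inc_row_hom:
  fixes C :: "nat \<Rightarrow> 'l::{finite,order} \<Rightarrow> 'l set"
  assumes "C n x = {p..}"
  shows "(\<lambda>f. inc_row p (f n x)) \<in> rmod_hom inc (support_module C :: ('l \<Rightarrow> 'l \<Rightarrow> 'k::field) fgmod) (regular_module inc)"
proof (rule rmod_homI, unfold regular_module_simps)
  fix f assume f: "f \<in> carrier (support_module C :: ('l \<Rightarrow> 'l \<Rightarrow> 'k) fgmod)"
  then show "inc_row p (f n x) \<in> carrier inc"
    using assms by (auto simp: inc_row_def inc_carrier sm_carrier)
  fix a :: "'l \<Rightarrow> 'l \<Rightarrow> 'k" assume a: "a \<in> carrier inc"
  show "inc_row p ((a \<odot>\<^bsub>support_module C\<^esub> f) n x) = inc_row p (f n x) \<otimes>\<^bsub>inc\<^esub> a"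
  proof (intro ext)
    fix u v
    show "inc_row p ((a \<odot>\<^bsub>support_module C\<^esub> f) n x) u v = (inc_row p (f n x) \<otimes>\<^bsub>inc\<^esub> a) u v"
    proof (cases "p \<le> v")
      case True
      then show ?thesis using assms by (simp add: inc_row_def sm_smult inc_mult)
    next
      case False
      have "f n x w * a w v = 0" for w
        using False f a assms by (cases "p \<le> w") (auto simp: sm_carrier inc_carrier)
      then show ?thesis using assms False
        by (simp add: inc_row_def sm_smult inc_mult del: mult_eq_0_iff)
    qed
  qed
qed (auto simp: fun_eq_iff inc_row_def sm_add inc_add)

text \<open>A dual basis expansion: \<open>b j\<close> generates the component \<open>j\<close> from
  the bottom \<open>p j\<close> of its up-set, and the component of \<open>f\<close>, written as a
  row of the algebra, is the element that carries \<open>b j\<close> to it.\<close>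

lemma support_eq_finsum:
  fixes C :: "nat \<Rightarrow> 'l::{finite,order} \<Rightarrow> 'l set"
  defines "J \<equiv> {(n, x). C n x \<noteq> {}}"
  assumes "convex_family C"
    and p: "\<And>n x. C n x \<noteq> {} \<Longrightarrow> C n x = {p (n, x)..}"
    and f: "f \<in> carrier (support_module C :: ('l \<Rightarrow> 'l \<Rightarrow> 'k::field) fgmod)"
    and b: "\<And>j. b j = (\<lambda>n x v. if (n, x) = j \<and> v = p j then 1 else 0)"
  shows "f = (\<Oplus>\<^bsub>support_module C\<^esub>j\<in>J. inc_row (p j) (f (fst j) (snd j)) \<odot>\<^bsub>support_module C\<^esub> b j)"
proof -
  interpret convex_family C by fact
  have fin: "finite J" using finite_family by (simp add: J_def)
  have tm: "(inc_row (p j) (f (fst j) (snd j)) \<odot>\<^bsub>support_module C\<^esub> b j) n x v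
      = (if j = (n, x) then f n x v else 0)" if "j \<in> J" for j n x v
  proof (cases "j = (n, x) \<and> v \<in> C n x")
    case True
    then have "(\<Sum>u\<in>UNIV. b j n x u * inc_row (p j) (f (fst j) (snd j)) u v)
      = (\<Sum>u\<in>UNIV. if u = p j then f n x v else 0)"
      by (intro sum.cong) (auto simp: b inc_row_def)
    then show ?thesis using True by (simp add: sm_smult)
  next
    case False
    then show ?thesis using f by (auto simp: sm_smult sm_carrier b)
  qed
  have "f = (\<lambda>n x v. \<Sum>j\<in>J. if j = (n, x) then f n x v else 0)"
    using f fin by (intro ext) (auto simp: sm_carrier J_def)
  also have "\<dots> = (\<lambda>n x v. \<Sum>j\<in>J. (inc_row (p j) (f (fst j) (snd j)) \<odot>\<^bsub>support_module C\<^esub> b j) n x v)"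
    by (intro ext sum.cong refl) (simp add: tm)
  also have "\<dots> = (\<Oplus>\<^bsub>support_module C\<^esub>j\<in>J. inc_row (p j) (f (fst j) (snd j)) \<odot>\<^bsub>support_module C\<^esub> b j)"
    by (intro finsum_support[symmetric] assms fin) (auto simp: sm_carrier sm_smult)
  finally show ?thesis .
qed

text \<open>It suffices to lift the generators \<open>b j\<close>. Their lifts \<open>m j\<close>
  may be arbitrary preimages, not concentrated at \<open>p j\<close>, because the coefficients
  \<open>R j \<phi>\<close> live in row \<open>p j\<close> and see only the part at
  \<open>p j\<close>.\<close>

lemma projective_support:
  fixes C :: "nat \<Rightarrow> 'l::{finite,order} \<Rightarrow> 'l set"
  assumes "convex_family C" and C: "\<And>n x. C n x = {} \<or> (\<exists>p. C n x = {p..})"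
  shows "projective_module inc (support_module C :: ('l \<Rightarrow> 'l \<Rightarrow> 'k::field) fgmod)"
  unfolding projective_module_def
proof (intro conjI fg_support assms allI impI ballI)
  let ?P = "support_module C :: ('l \<Rightarrow> 'l \<Rightarrow> 'k) fgmod"
  fix M N :: "('l \<Rightarrow> 'l \<Rightarrow> 'k) fgmod" and g f
  assume M: "fg_module inc M" and N: "fg_module inc N" and g: "g \<in> rmod_hom inc M N"
    and f: "f \<in> rmod_hom inc ?P N" and surj: "g ` carrier M = carrier N"
  interpret convex_family C by fact
  interpret M: right_module inc M using M by (simp add: fg_module_def)
  interpret N: right_module inc N using N by (simp add: fg_module_def)
  define J where "J = {(n, x). C n x \<noteq> {}}"
  have fin: "finite J" using finite_family by (simp add: J_def)
  obtain p where p: "\<And>n x. C n x \<noteq> {} \<Longrightarrow> C n x = {p (n, x)..}"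
  proof -
    have "\<forall>j. \<exists>p. C (fst j) (snd j) \<noteq> {} \<longrightarrow> C (fst j) (snd j) = {p..}" using C by blast
    then show ?thesis using that by (metis fst_conv snd_conv)
  qed
  define b :: "nat \<times> 'l \<Rightarrow> nat \<Rightarrow> 'l \<Rightarrow> 'l \<Rightarrow> 'k"
    where "b j = (\<lambda>n x v. if (n, x) = j \<and> v = p j then 1 else 0)" for j
  have CJ: "C (fst j) (snd j) = {p j..}" if "j \<in> J" for j
  proof -
    have "C (fst j) (snd j) \<noteq> {}" using that by (auto simp: J_def)
    from p[OF this] show ?thesis by simp
  qed
  have bP: "b j \<in> carrier ?P" if "j \<in> J" for j
    using CJ[OF that] by (auto simp: b_def sm_carrier)
  have "\<exists>m\<in>carrier M. g m = f (b j)" if "j \<in> J" for j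
    using rmod_homD(1)[OF f bP[OF that]] surj by (metis imageE)
  then obtain m where m: "\<And>j. j \<in> J \<Longrightarrow> m j \<in> carrier M" "\<And>j. j \<in> J \<Longrightarrow> g (m j) = f (b j)"
    by metis
  define R where "R j \<phi> = inc_row (p j) (\<phi> (fst j) (snd j))" for j and \<phi> :: "nat \<Rightarrow> 'l \<Rightarrow> 'l \<Rightarrow> 'k"
  have R: "R j \<in> rmod_hom inc ?P (regular_module inc)" if "j \<in> J" for j
    unfolding R_def[abs_def] by (rule inc_row_hom) (rule CJ[OF that])
  define h where "h \<phi> = (\<Oplus>\<^bsub>M\<^esub>j\<in>J. R j \<phi> \<odot>\<^bsub>M\<^esub> m j)" for \<phi>
  show "\<exists>h\<in>rmod_hom inc ?P M. \<forall>x\<in>carrier ?P. g (h x) = f x"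
  proof (intro bexI ballI)
    show "h \<in> rmod_hom inc ?P M"
      unfolding h_def[abs_def] using M.right_module_axioms fin R m(1) by (rule rmod_hom_combination)
    fix \<phi> assume \<phi>: "\<phi> \<in> carrier ?P"
    have RA: "R j \<phi> \<in> carrier inc" if "j \<in> J" for j
      using rmod_homD(1)[OF R[OF that] \<phi>] by (simp add: regular_module_simps)
    have "g (h \<phi>) = (\<Oplus>\<^bsub>N\<^esub>j\<in>J. g (R j \<phi> \<odot>\<^bsub>M\<^esub> m j))"
      unfolding h_def using RA m(1)
      by (intro rmod_hom_finsum[OF g] M.M.abelian_group_axioms N.M.abelian_group_axioms fin M.ract_closed) auto
    also have "\<dots> = (\<Oplus>\<^bsub>N\<^esub>j\<in>J. f (R j \<phi> \<odot>\<^bsub>?P\<^esub> b j))"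
      using RA m rmod_homD[OF g] rmod_homD[OF f] bP
      by (intro N.M.finsum_cong') (simp_all add: Pi_iff N.ract_closed)
    also have "\<dots> = f (\<Oplus>\<^bsub>?P\<^esub>j\<in>J. R j \<phi> \<odot>\<^bsub>?P\<^esub> b j)"
      using RA bP
      by (intro rmod_hom_finsum[OF f, symmetric] right_module.axioms(2)[OF right_module_support] N.M.abelian_group_axioms fin ract_closed) auto
    also have "(\<Oplus>\<^bsub>?P\<^esub>j\<in>J. R j \<phi> \<odot>\<^bsub>?P\<^esub> b j) = \<phi>"
      unfolding R_def J_def by (rule support_eq_finsum[symmetric, OF assms(1) p \<phi> b_def])
    finally show "g (h \<phi>) = f \<phi>" .
  qed
qed

section \<open>Covers by free modules\<close>

text \<open>The support module of this family is the free module of rank \<open>k\<close>: for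
  \<open>n < k\<close> the value \<open>f n\<close> is a matrix of the algebra, whose row
  \<open>x\<close> lives on the up-set of \<open>x\<close>.\<close>

definition free_family :: "nat \<Rightarrow> nat \<Rightarrow> 'l::{finite,order} \<Rightarrow> 'l set" where
  "free_family k n x = (if n < k then {x..} else {})"

lemma convex_free_family: "convex_family (free_family k)"
proof
  have "{(n, x). free_family k n x \<noteq> {}} \<subseteq> {..<k} \<times> (UNIV :: 'a set)"
    by (auto simp: free_family_def)
  then show "finite {(n, x :: 'a). free_family k n x \<noteq> {}}"
    by (rule finite_subset) auto
qed (auto simp: free_family_def split: if_splits)

lemma component_hom:
  fixes C :: "nat \<Rightarrow> 'l::{finite,order} \<Rightarrow> 'l set"
  assumes "\<And>x. C n x \<subseteq> {x..}" and up: "\<And>x u v. u \<in> C n x \<Longrightarrow> u \<le> v \<Longrightarrow> v \<in> C n x"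
  shows "(\<lambda>f. f n) \<in> rmod_hom inc (support_module C :: ('l \<Rightarrow> 'l \<Rightarrow> 'k::field) fgmod) (regular_module inc)"
proof (rule rmod_homI, unfold regular_module_simps)
  fix f assume f: "f \<in> carrier (support_module C :: ('l \<Rightarrow> 'l \<Rightarrow> 'k) fgmod)"
  then show "f n \<in> carrier inc"
    using assms(1) unfolding inc_carrier sm_carrier by (meson atLeast_iff subsetD)
  fix a :: "'l \<Rightarrow> 'l \<Rightarrow> 'k" assume a: "a \<in> carrier inc"
  have "f n x w * a w v = 0" if "v \<notin> C n x" for x v w
    using f a up[of w x v] that unfolding sm_carrier inc_carrier mult_eq_0_iff by blast
  then show "(a \<odot>\<^bsub>support_module C\<^esub> f) n = f n \<otimes>\<^bsub>inc\<^esub> a"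
    by (intro ext) (auto simp: sm_smult inc_mult simp del: mult_eq_0_iff)
qed (auto simp: fun_eq_iff sm_add inc_add)

text \<open>Gives coordinates to modules about whose elements nothing is known. The extension of
  functionals, the splitting of projectives and the start of the syzygy argument rely on it.\<close>

lemma free_cover:
  fixes M :: "('l::{finite,order} \<Rightarrow> 'l \<Rightarrow> 'k::field, 'm, 'e) module_scheme"
  assumes "fg_module inc M"
  obtains k \<pi> where "\<pi> \<in> rmod_hom inc (support_module (free_family k)) M"
    "\<pi> ` carrier (support_module (free_family k)) = carrier M"
proof -
  interpret M: right_module inc M using assms by (simp add: fg_module_def)
  obtain S where S: "finite S" "S \<subseteq> carrier M"
    and gen: "\<And>x. x \<in> carrier M \<Longrightarrow> \<exists>c \<in> S \<rightarrow> carrier inc. x = (\<Oplus>\<^bsub>M\<^esub>s\<in>S. c s \<odot>\<^bsub>M\<^esub> s)"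
    using assms by (auto simp: fg_module_def)
  obtain k and s :: "nat \<Rightarrow> 'm" where s: "S = s ` {i. i < k}" "inj_on s {i. i < k}"
    using finite_imp_nat_seg_image_inj_on[OF S(1)] by blast
  define \<pi> where "\<pi> \<phi> = (\<Oplus>\<^bsub>M\<^esub>n\<in>{i. i < k}. \<phi> n \<odot>\<^bsub>M\<^esub> s n)" for \<phi>
  have hom: "\<pi> \<in> rmod_hom inc (support_module (free_family k)) M"
    unfolding \<pi>_def[abs_def] using S(2) s(1)
    by (intro rmod_hom_combination M.right_module_axioms component_hom)
      (auto simp: free_family_def split: if_splits)
  have "x \<in> \<pi> ` carrier (support_module (free_family k))" if x: "x \<in> carrier M" for x
  proof -
    obtain c where c: "c \<in> S \<rightarrow> carrier inc" "x = (\<Oplus>\<^bsub>M\<^esub>s\<in>S. c s \<odot>\<^bsub>M\<^esub> s)"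
      using gen[OF x] by blast
    define \<phi> where "\<phi> n = (if n < k then c (s n) else (\<lambda>_ _. 0))" for n
    have "x = (\<Oplus>\<^bsub>M\<^esub>n\<in>{i. i < k}. c (s n) \<odot>\<^bsub>M\<^esub> s n)"
      unfolding c(2) s(1) using c(1) S(2) s
      by (intro M.M.finsum_reindex) (auto intro!: M.ract_closed)
    also have "\<dots> = \<pi> \<phi>"
      unfolding \<pi>_def using c(1) S(2) s(1)
      by (intro M.M.finsum_cong') (auto simp: \<phi>_def Pi_iff intro!: M.ract_closed)
    finally have "x = \<pi> \<phi>" .
    moreover have "\<phi> \<in> carrier (support_module (free_family k))"
      using c(1) s(1) by (auto simp: sm_carrier \<phi>_def free_family_def Pi_iff inc_carrier)
    ultimately show ?thesis by blast
  qed
  then show ?thesis using that[OF hom] rmod_homD(1)[OF hom] by blast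
qed

section \<open>Injective support modules\<close>

lemma finsum_inc:
  fixes g :: "'i \<Rightarrow> 'l::{finite,order} \<Rightarrow> 'l \<Rightarrow> 'k::field"
  assumes "finite I" "\<And>i. i \<in> I \<Longrightarrow> g i \<in> carrier inc"
  shows "(\<Oplus>\<^bsub>inc\<^esub>i\<in>I. g i) u v = (\<Sum>i\<in>I. g i u v)"
proof -
  interpret ring "inc :: ('k, 'l \<Rightarrow> 'l \<Rightarrow> 'k) module" by (rule ring_incidence_algebra)
  show ?thesis
    using assms
  proof (induction I rule: finite_induct)
    case empty
    then show ?case by (simp add: inc_zero)
  next
    case (insert i I)
    then have "g \<in> I \<rightarrow> carrier inc" "g i \<in> carrier inc" by auto
    then show ?case using insert by (simp add: inc_add)
  qed
qed

text \<open>The carrier of \<open>N\<close> does not lie in an ambient vector space type. The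
  functional is therefore pulled back along a free cover, extended there by linear algebra, and
  pushed down again.\<close>

lemma functional_extension:
  fixes N :: "('l::{finite,order} \<Rightarrow> 'l \<Rightarrow> 'k::field, 'm, 'e) module_scheme" and l :: "'m \<Rightarrow> 'k"
  assumes N: "fg_module inc N" and U: "submodule U inc N"
    and add: "\<And>x y. x \<in> U \<Longrightarrow> y \<in> U \<Longrightarrow> l (x \<oplus>\<^bsub>N\<^esub> y) = l x + l y"
    and scale: "\<And>c x. x \<in> U \<Longrightarrow> l (inc_scalar c \<odot>\<^bsub>N\<^esub> x) = c * l x"
  obtains \<Lambda> where "\<And>x. x \<in> U \<Longrightarrow> \<Lambda> x = l x"
    "\<And>x y. x \<in> carrier N \<Longrightarrow> y \<in> carrier N \<Longrightarrow> \<Lambda> (x \<oplus>\<^bsub>N\<^esub> y) = \<Lambda> x + \<Lambda> y"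
    "\<And>c x. x \<in> carrier N \<Longrightarrow> \<Lambda> (inc_scalar c \<odot>\<^bsub>N\<^esub> x) = c * \<Lambda> x"
proof -
  interpret N: right_module inc N using N by (simp add: fg_module_def)
  note U = N.right_submoduleD[OF U]
  obtain k \<pi> where \<pi>: "\<pi> \<in> rmod_hom inc (support_module (free_family k)) N"
    and surj: "\<pi> ` carrier (support_module (free_family k)) = carrier N"
    using free_cover[OF N] .
  let ?F = "support_module (free_family k) :: ('l \<Rightarrow> 'l \<Rightarrow> 'k) fgmod"
  interpret F: convex_family "free_family k :: nat \<Rightarrow> 'l \<Rightarrow> 'l set" by (rule convex_free_family)
  interpret V: vector_space_pair "vscale :: 'k \<Rightarrow> (nat \<Rightarrow> 'l \<Rightarrow> 'l \<Rightarrow> 'k) \<Rightarrow> _" "(*) :: 'k \<Rightarrow> 'k \<Rightarrow> 'k"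
    by (intro vector_space_pair.intro vector_space_vscale) (unfold_locales, auto simp: algebra_simps)
  have plus: "\<phi> \<oplus>\<^bsub>?F\<^esub> \<psi> = \<phi> + \<psi>" for \<phi> \<psi> by (auto simp: sm_add fun_eq_iff)
  have zero: "\<zero>\<^bsub>?F\<^esub> = 0" by (auto simp: sm_zero fun_eq_iff)
  have \<pi>add: "\<phi> + \<psi> \<in> carrier ?F" "\<pi> (\<phi> + \<psi>) = \<pi> \<phi> \<oplus>\<^bsub>N\<^esub> \<pi> \<psi>"
    if "\<phi> \<in> carrier ?F" "\<psi> \<in> carrier ?F" for \<phi> \<psi>
    using rmod_homD(2)[OF \<pi> that] F.M.a_closed[OF that] by (simp_all add: plus)
  have \<pi>sc: "vscale c \<phi> \<in> carrier ?F" "\<pi> (vscale c \<phi>) = inc_scalar c \<odot>\<^bsub>N\<^esub> \<pi> \<phi>"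
    if "\<phi> \<in> carrier ?F" for c \<phi>
    using rmod_homD(3)[OF \<pi> inc_scalar_closed that] F.ract_closed[OF inc_scalar_closed that]
    by (simp_all add: sm_scalar_smult[OF that])
  have \<pi>0: "0 \<in> carrier ?F" "\<pi> 0 = \<zero>\<^bsub>N\<^esub>"
    using rmod_hom_zero[OF \<pi> F.M.abelian_group_axioms N.M.abelian_group_axioms]
    by (simp_all add: zero sm_carrier)
  have l0: "l \<zero>\<^bsub>N\<^esub> = 0"
    using add[OF U(2) U(2)] by (metis N.M.l_zero N.M.zero_closed add_cancel_right_right)
  \<comment> \<open>This preimage of \<open>U\<close> contains the kernel of \<open>\<pi>\<close>,
    so the extension vanishes on that kernel and descends to \<open>N\<close>.\<close>
  define V where "V = {\<phi> \<in> carrier ?F. \<pi> \<phi> \<in> U}"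
  obtain B where B: "B \<subseteq> V" "V.vs1.independent B" "V \<subseteq> V.vs1.span B"
    by (rule V.vs1.maximal_independent_subset)
  obtain g where g: "Vector_Spaces.linear vscale (*) g" "\<forall>\<phi>\<in>B. g \<phi> = l (\<pi> \<phi>)"
    using V.linear_independent_extend[OF B(2)] by meson
  have gadd: "g (\<phi> + \<psi>) = g \<phi> + g \<psi>" and gsc: "g (vscale c \<phi>) = c * g \<phi>" for \<phi> \<psi> c
    using g(1) by (simp_all add: Vector_Spaces.linear_iff)
  have pointwise: "(\<lambda>n x v. \<phi> n x v + \<psi> n x v) = \<phi> + \<psi>" for \<phi> \<psi> :: "nat \<Rightarrow> 'l \<Rightarrow> 'l \<Rightarrow> 'k"
    by (simp add: fun_eq_iff)
  have gV: "g \<phi> = l (\<pi> \<phi>)" if "\<phi> \<in> V" for \<phi>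
  proof -
    have "\<phi> \<in> V \<and> g \<phi> = l (\<pi> \<phi>)"
      using subsetD[OF B(3) that]
    proof (induction \<phi> rule: V.vs1.span_induct_alt)
      case base
      have "g 0 = 0" using gadd[of 0 0] by (metis add_0 add_cancel_right_right)
      moreover have "(\<lambda>_ _ _. 0) = (0 :: nat \<Rightarrow> 'l \<Rightarrow> 'l \<Rightarrow> 'k)" by (simp add: fun_eq_iff)
      ultimately show ?case using \<pi>0 l0 U(2) by (simp add: V_def)
    next
      case (step c b \<phi>)
      then have "b \<in> V" "g b = l (\<pi> b)" using B(1) g(2) by auto
      then show ?case
        using step U(3,4) by (auto simp: V_def \<pi>add \<pi>sc gadd gsc add scale pointwise)
    qed
    then show ?thesis by simp
  qed
  have ker: "g \<phi> = g \<psi>" if "\<phi> \<in> carrier ?F" "\<psi> \<in> carrier ?F" "\<pi> \<phi> = \<pi> \<psi>" for \<phi> \<psi>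
  proof -
    have 1: "\<phi> + vscale (- 1) \<psi> \<in> carrier ?F" using that \<pi>add(1) \<pi>sc(1) by blast
    have "\<pi> (\<psi> + vscale (- 1) \<psi>) = \<zero>\<^bsub>N\<^esub>"
    proof -
      have "\<psi> + vscale (- 1) \<psi> = 0" by (auto simp: vscale_def fun_eq_iff)
      then show ?thesis using \<pi>0(2) by metis
    qed
    then have "\<pi> (\<phi> + vscale (- 1) \<psi>) = \<zero>\<^bsub>N\<^esub>"
      using that \<pi>add(2) \<pi>sc by metis
    then have "g (\<phi> + vscale (- 1) \<psi>) = 0"
      using gV[of "\<phi> + vscale (- 1) \<psi>"] 1 U(2) l0 by (simp add: V_def)
    then have "g \<phi> + (- 1) * g \<psi> = 0" by (simp only: gadd gsc)
    then show ?thesis by simp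
  qed
  have "\<forall>x\<in>carrier N. \<exists>\<phi>\<in>carrier ?F. \<pi> \<phi> = x" by (metis imageE surj)
  then obtain \<sigma> where \<sigma>: "\<And>x. x \<in> carrier N \<Longrightarrow> \<sigma> x \<in> carrier ?F" "\<And>x. x \<in> carrier N \<Longrightarrow> \<pi> (\<sigma> x) = x"
    by metis
  show ?thesis
  proof (rule that[of "\<lambda>x. g (\<sigma> x)"])
    fix x assume x: "x \<in> U"
    then have "x \<in> carrier N" using U(1) by auto
    then show "g (\<sigma> x) = l x"
      using gV[of "\<sigma> x"] \<sigma>[of x] x by (simp add: V_def)
  next
    fix x y assume xy: "x \<in> carrier N" "y \<in> carrier N"
    then show "g (\<sigma> (x \<oplus>\<^bsub>N\<^esub> y)) = g (\<sigma> x) + g (\<sigma> y)"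
      unfolding gadd[symmetric] using \<sigma> \<pi>add by (intro ker) auto
  next
    fix c x assume x: "x \<in> carrier N"
    then show "g (\<sigma> (inc_scalar c \<odot>\<^bsub>N\<^esub> x)) = c * g (\<sigma> x)"
      unfolding gsc[symmetric] using \<sigma> \<pi>sc by (intro ker) (auto simp: N.ract_closed)
  qed
qed

text \<open>The representation on a down-set with top \<open>p\<close> is a vector space dual: a
  homomorphism into it amounts to the functional reading the coordinate at \<open>p\<close>.
  Extending homomorphisms thus reduces to extending functionals, one for each component.\<close>

lemma injective_support:
  fixes C :: "nat \<Rightarrow> 'l::{finite,order} \<Rightarrow> 'l set"
  assumes "convex_family C" and C: "\<And>n x. C n x = {} \<or> (\<exists>p. C n x = {..p})"
  shows "injective_module inc (support_module C :: ('l \<Rightarrow> 'l \<Rightarrow> 'k::field) fgmod)"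
  unfolding injective_module_def
proof (intro conjI fg_support assms allI impI ballI)
  let ?E = "support_module C :: ('l \<Rightarrow> 'l \<Rightarrow> 'k) fgmod"
  let ?e = "incidence_basis :: 'l \<Rightarrow> 'l \<Rightarrow> 'l \<Rightarrow> 'l \<Rightarrow> 'k"
  fix M N :: "('l \<Rightarrow> 'l \<Rightarrow> 'k) fgmod" and g f
  assume M: "fg_module inc M" and N: "fg_module inc N" and g: "g \<in> rmod_hom inc M N"
    and f: "f \<in> rmod_hom inc M ?E" and inj: "inj_on g (carrier M)"
  interpret convex_family C by fact
  interpret M: right_module inc M using M by (simp add: fg_module_def)
  interpret N: right_module inc N using N by (simp add: fg_module_def)
  obtain p where p: "\<And>n x. C n x \<noteq> {} \<Longrightarrow> C n x = {..p n x}"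
  proof -
    have "\<forall>n x. \<exists>p. C n x \<noteq> {} \<longrightarrow> C n x = {..p}" using C by blast
    then show ?thesis using that by metis
  qed
  define U where "U = g ` carrier M"
  have U: "submodule U inc N"
    unfolding U_def
  proof (rule N.right_submoduleI)
    show "\<zero>\<^bsub>N\<^esub> \<in> g ` carrier M"
      using rmod_hom_zero[OF g M.M.abelian_group_axioms N.M.abelian_group_axioms] M.M.zero_closed
      by (metis imageI)
  qed (use rmod_homD[OF g] M.ract_closed M.M.a_closed in \<open>auto, (metis imageI)+\<close>)
  define q where "q = inv_into (carrier M) g"
  have q: "q (g x) = x" if "x \<in> carrier M" for x
    using inj that by (simp add: q_def)
  have ex: "\<exists>\<Lambda>. (\<forall>x\<in>carrier M. \<Lambda> (g x) = f x n y (p n y))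
      \<and> (\<forall>x\<in>carrier N. \<forall>z\<in>carrier N. \<Lambda> (x \<oplus>\<^bsub>N\<^esub> z) = \<Lambda> x + \<Lambda> z)
      \<and> (\<forall>c. \<forall>x\<in>carrier N. \<Lambda> (inc_scalar c \<odot>\<^bsub>N\<^esub> x) = c * \<Lambda> x)" for n y
  proof -
    have add: "f (q (x \<oplus>\<^bsub>N\<^esub> z)) n y (p n y) = f (q x) n y (p n y) + f (q z) n y (p n y)"
      if "x \<in> U" "z \<in> U" for x z
    proof -
      obtain u w where uw: "u \<in> carrier M" "w \<in> carrier M" "x = g u" "z = g w"
        using \<open>x \<in> U\<close> \<open>z \<in> U\<close> unfolding U_def by blast
      have "x \<oplus>\<^bsub>N\<^esub> z = g (u \<oplus>\<^bsub>M\<^esub> w)"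
        using uw rmod_homD(2)[OF g] by simp
      then show ?thesis
        using uw rmod_homD(2)[OF f] by (simp add: q sm_add)
    qed
    have scale: "f (q (inc_scalar c \<odot>\<^bsub>N\<^esub> x)) n y (p n y) = c * f (q x) n y (p n y)"
      if "x \<in> U" for c x
    proof -
      obtain u where u: "u \<in> carrier M" "x = g u"
        using \<open>x \<in> U\<close> unfolding U_def by blast
      have "inc_scalar c \<odot>\<^bsub>N\<^esub> x = g (inc_scalar c \<odot>\<^bsub>M\<^esub> u)"
        using u rmod_homD(3)[OF g] by simp
      then show ?thesis
        using u rmod_homD(1,3)[OF f] by (simp add: q M.ract_closed sm_scalar_smult vscale_def)
    qed
    show ?thesis
    proof (rule functional_extension[OF N U, of "\<lambda>x. f (q x) n y (p n y)"])
      fix \<Lambda> assume "\<And>x. x \<in> U \<Longrightarrow> \<Lambda> x = f (q x) n y (p n y)"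
        "\<And>x z. x \<in> carrier N \<Longrightarrow> z \<in> carrier N \<Longrightarrow> \<Lambda> (x \<oplus>\<^bsub>N\<^esub> z) = \<Lambda> x + \<Lambda> z"
        "\<And>c x. x \<in> carrier N \<Longrightarrow> \<Lambda> (inc_scalar c \<odot>\<^bsub>N\<^esub> x) = c * \<Lambda> x"
      then show ?thesis by (intro exI[of _ \<Lambda>]) (auto simp: U_def q)
    qed (use add scale in auto)
  qed
  obtain \<Lambda> where \<Lambda>: "\<And>n y x. x \<in> carrier M \<Longrightarrow> \<Lambda> n y (g x) = f x n y (p n y)"
      and \<Lambda>add: "\<And>n y x z. x \<in> carrier N \<Longrightarrow> z \<in> carrier N \<Longrightarrow> \<Lambda> n y (x \<oplus>\<^bsub>N\<^esub> z) = \<Lambda> n y x + \<Lambda> n y z"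
      and \<Lambda>sc: "\<And>n y c x. x \<in> carrier N \<Longrightarrow> \<Lambda> n y (inc_scalar c \<odot>\<^bsub>N\<^esub> x) = c * \<Lambda> n y x"
  proof -
    let ?P = "\<lambda>n y \<Lambda>. (\<forall>x\<in>carrier M. \<Lambda> (g x) = f x n y (p n y))
      \<and> (\<forall>x\<in>carrier N. \<forall>z\<in>carrier N. \<Lambda> (x \<oplus>\<^bsub>N\<^esub> z) = \<Lambda> x + \<Lambda> z)
      \<and> (\<forall>c. \<forall>x\<in>carrier N. \<Lambda> (inc_scalar c \<odot>\<^bsub>N\<^esub> x) = c * \<Lambda> x)"
    have "?P n y (SOME \<Lambda>. ?P n y \<Lambda>)" for n y
      by (rule someI_ex[OF ex])
    then show ?thesis using that[of "\<lambda>n y. SOME \<Lambda>. ?P n y \<Lambda>"] by blast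
  qed
  have \<Lambda>0: "\<Lambda> n y \<zero>\<^bsub>N\<^esub> = 0" for n y
    using \<Lambda>add[OF N.M.zero_closed N.M.zero_closed, of n y] by (metis N.M.l_zero N.M.zero_closed add_cancel_right_right)
  have \<Lambda>sum: "\<Lambda> n y (\<Oplus>\<^bsub>N\<^esub>i\<in>I. t i) = (\<Sum>i\<in>I. \<Lambda> n y (t i))"
    if "finite I" "\<And>i. i \<in> I \<Longrightarrow> t i \<in> carrier N" for n y and t and I :: "'l set"
    using that
  proof (induction I rule: finite_induct)
    case empty
    then show ?case by (simp add: \<Lambda>0)
  next
    case (insert i I)
    then have "t \<in> I \<rightarrow> carrier N" "t i \<in> carrier N" by auto
    then show ?case using insert by (simp add: \<Lambda>add)
  qed
  \<comment> \<open>Linearity forces this formula: inside a down-set, the coordinate at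
    \<open>v\<close> equals the coordinate at the top after transport from \<open>v\<close> to the
    top.\<close>
  define h where "h x = (\<lambda>n y v. if v \<in> C n y then \<Lambda> n y (?e v (p n y) \<odot>\<^bsub>N\<^esub> x) else 0)" for x
  have le: "v \<le> p n y" if "v \<in> C n y" for n y v
    using that p[of n y] by auto
  show "\<exists>h\<in>rmod_hom inc N ?E. \<forall>x\<in>carrier M. h (g x) = f x"
  proof (intro bexI ballI)
    fix x assume x: "x \<in> carrier M"
    show "h (g x) = f x"
    proof (intro ext)
      fix n y v
      show "h (g x) n y v = f x n y v"
      proof (cases "v \<in> C n y")
        case True
        then have "?e v (p n y) \<in> carrier inc" using le by simp
        then have "h (g x) n y v = f (?e v (p n y) \<odot>\<^bsub>M\<^esub> x) n y (p n y)"
          using True x rmod_homD(3)[OF g, symmetric] by (simp add: h_def M.ract_closed \<Lambda>)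
        also have "\<dots> = (?e v (p n y) \<odot>\<^bsub>?E\<^esub> f x) n y (p n y)"
          using \<open>?e v (p n y) \<in> carrier inc\<close> x rmod_homD(3)[OF f] by simp
        also have "\<dots> = f x n y v"
          using True p[of n y] unfolding sm_basis_smult by auto
        finally show ?thesis .
      next
        case False
        then show ?thesis using rmod_homD(1)[OF f x] by (simp add: h_def sm_carrier)
      qed
    qed
  next
    show "h \<in> rmod_hom inc N ?E"
    proof (rule rmod_homI)
      fix a x assume a: "a \<in> carrier (inc :: ('k, 'l \<Rightarrow> 'l \<Rightarrow> 'k) module)" and x: "x \<in> carrier N"
      show "h (a \<odot>\<^bsub>N\<^esub> x) = a \<odot>\<^bsub>?E\<^esub> h x"
      proof (intro ext)
        fix n y v
        show "h (a \<odot>\<^bsub>N\<^esub> x) n y v = (a \<odot>\<^bsub>?E\<^esub> h x) n y v"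
        proof (cases "v \<in> C n y")
          case True
          let ?p = "p n y"
          have Cp: "C n y = {..?p}" using True p by blast
          have cl: "?e u ?p \<in> carrier inc" if "u \<in> C n y" for u using that le by simp
          have cl2: "?e u ?p \<otimes>\<^bsub>inc\<^esub> inc_scalar (a u v) \<in> carrier inc" if "u \<in> C n y" for u
            using cl[OF that] by (intro inc_m_closed) auto
          \<comment> \<open>Column \<open>v\<close> of \<open>a\<close>, moved to column
            \<open>?p\<close>, is expanded in matrix units. The down-set \<open>C n y\<close>
            contains \<open>v\<close>, hence all rows where this column can be nonzero.\<close>
          have prod: "a \<otimes>\<^bsub>inc\<^esub> ?e v ?p = (\<Oplus>\<^bsub>inc\<^esub>u\<in>C n y. ?e u ?p \<otimes>\<^bsub>inc\<^esub> inc_scalar (a u v))"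
          proof (intro ext)
            fix s t
            have "(a \<otimes>\<^bsub>inc\<^esub> ?e v ?p) s t = (\<Sum>w\<in>UNIV. if w = v then (if t = ?p then a s v else 0) else 0)"
              unfolding inc_mult by (intro sum.cong) (auto simp: incidence_basis_def)
            also have "\<dots> = (if t = ?p then a s v else 0)" by simp
            also have "\<dots> = (\<Sum>u\<in>C n y. if u = s then (if t = ?p then a s v else 0) else 0)"
            proof (cases "s \<in> C n y")
              case False
              then have "\<not> s \<le> v" using True unfolding Cp by auto
              then show ?thesis using a False by (simp add: inc_carrier)
            qed simp
            also have "\<dots> = (\<Sum>u\<in>C n y. (?e u ?p \<otimes>\<^bsub>inc\<^esub> inc_scalar (a u v)) s t)"
            proof (intro sum.cong refl)
              fix u
              have "(?e u ?p \<otimes>\<^bsub>inc\<^esub> inc_scalar (a u v)) s t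
                  = (\<Sum>w\<in>UNIV. if w = ?p then (if u = s \<and> t = ?p then a s v else 0) else 0)"
                unfolding inc_mult by (intro sum.cong) (auto simp: incidence_basis_def inc_scalar_def)
              then show "(if u = s then (if t = ?p then a s v else 0) else 0)
                  = (?e u ?p \<otimes>\<^bsub>inc\<^esub> inc_scalar (a u v)) s t" by simp
            qed
            also have "\<dots> = (\<Oplus>\<^bsub>inc\<^esub>u\<in>C n y. ?e u ?p \<otimes>\<^bsub>inc\<^esub> inc_scalar (a u v)) s t"
              using cl2 by (intro finsum_inc[symmetric]) auto
            finally show "(a \<otimes>\<^bsub>inc\<^esub> ?e v ?p) s t = (\<Oplus>\<^bsub>inc\<^esub>u\<in>C n y. ?e u ?p \<otimes>\<^bsub>inc\<^esub> inc_scalar (a u v)) s t" .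
          qed
          have "h (a \<odot>\<^bsub>N\<^esub> x) n y v = \<Lambda> n y ((a \<otimes>\<^bsub>inc\<^esub> ?e v ?p) \<odot>\<^bsub>N\<^esub> x)"
            using True a x cl by (simp add: h_def N.ract_assoc)
          also have "\<dots> = \<Lambda> n y (\<Oplus>\<^bsub>N\<^esub>u\<in>C n y. (?e u ?p \<otimes>\<^bsub>inc\<^esub> inc_scalar (a u v)) \<odot>\<^bsub>N\<^esub> x)"
            unfolding prod using cl2 x by (subst N.finsum_ract) auto
          also have "\<dots> = (\<Sum>u\<in>C n y. \<Lambda> n y ((?e u ?p \<otimes>\<^bsub>inc\<^esub> inc_scalar (a u v)) \<odot>\<^bsub>N\<^esub> x))"
            using cl2 x by (intro \<Lambda>sum) (auto intro: N.ract_closed)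
          also have "\<dots> = (\<Sum>u\<in>C n y. h x n y u * a u v)"
            using cl x by (intro sum.cong) (auto simp: N.ract_assoc \<Lambda>sc N.ract_closed h_def)
          also have "\<dots> = (\<Sum>u\<in>UNIV. h x n y u * a u v)"
            by (intro sum.mono_neutral_left) (auto simp: h_def)
          finally show ?thesis using True by (simp add: sm_smult)
        qed (simp add: h_def sm_smult)
      qed
    qed (auto simp: h_def sm_carrier sm_add fun_eq_iff N.ract_distr_module N.ract_closed le \<Lambda>add)
  qed
qed

section \<open>Modules of projective dimension at most one\<close>

lemma abelian_group_diff_zero:
  assumes "abelian_group M" "a \<in> carrier M" "b \<in> carrier M" "a \<ominus>\<^bsub>M\<^esub> b = \<zero>\<^bsub>M\<^esub>"
  shows "a = b"
proof -
  interpret abelian_group M by fact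
  show ?thesis
    using assms(2-) minus_equality[of a "\<ominus>\<^bsub>M\<^esub> b"] by (simp add: a_minus_def)
qed

lemma basis_ract:
  assumes "right_module (inc :: ('k::field, 'l::{finite,order} \<Rightarrow> 'l \<Rightarrow> 'k) module) M"
    "x \<le> y" "y \<le> z" "m \<in> carrier M"
  shows "incidence_basis y z \<odot>\<^bsub>M\<^esub> (incidence_basis x y \<odot>\<^bsub>M\<^esub> m) = incidence_basis x z \<odot>\<^bsub>M\<^esub> m"
proof -
  interpret M: right_module inc M by fact
  show ?thesis
    using assms(2-) M.ract_assoc[of "incidence_basis x y" "incidence_basis y z" m] inc_basis_mult[of x y z]
    by (metis inc_basis_closed)
qed

lemma projective_lift:
  fixes M N :: "'a fgmod"
  assumes "projective_module A P" "fg_module A M" "fg_module A N" "g \<in> rmod_hom A M N"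
    "f \<in> rmod_hom A P N" "g ` carrier M = carrier N"
  shows "\<exists>h\<in>rmod_hom A P M. \<forall>x\<in>carrier P. g (h x) = f x"
  using assms(1)[unfolded projective_module_def, THEN conjunct2] assms(2-) by simp

lemma injective_extend:
  fixes M N :: "'a fgmod"
  assumes "injective_module A E" "fg_module A M" "fg_module A N" "g \<in> rmod_hom A M N"
    "f \<in> rmod_hom A M E" "inj_on g (carrier M)"
  shows "\<exists>h\<in>rmod_hom A N E. \<forall>x\<in>carrier M. h (g x) = f x"
  using assms(1)[unfolded injective_module_def, THEN conjunct2] assms(2-) by simp

text \<open>Presents a projective module as a retract of a free one, so that properties visible in
  coordinates can be checked on \<open>\<sigma> q\<close> and carried back by
  \<open>\<pi>\<close>.\<close>

lemma projective_split:
  fixes Q :: "('l::{finite,order} \<Rightarrow> 'l \<Rightarrow> 'k::field) fgmod"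
  assumes "projective_module inc Q"
  obtains \<sigma> k \<pi> where "\<sigma> \<in> rmod_hom inc Q (support_module (free_family k))"
    "\<pi> \<in> rmod_hom inc (support_module (free_family k)) Q" "\<forall>q\<in>carrier Q. \<pi> (\<sigma> q) = q"
proof -
  have Q: "fg_module inc Q" using assms by (simp add: projective_module_def)
  obtain k \<pi> where \<pi>: "\<pi> \<in> rmod_hom inc (support_module (free_family k)) Q"
    and surj: "\<pi> ` carrier (support_module (free_family k)) = carrier Q"
    using free_cover[OF Q] .
  have "(\<lambda>q. q) \<in> rmod_hom inc Q Q" by (rule rmod_homI) auto
  then have "\<exists>\<sigma>\<in>rmod_hom inc Q (support_module (free_family k)). \<forall>q\<in>carrier Q. \<pi> (\<sigma> q) = q"
    by (rule projective_lift[OF assms fg_support[OF convex_free_family] Q \<pi> _ surj])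
  then show ?thesis using that \<pi> by blast
qed

text \<open>In a free module every component is an up-set, so no coordinate is lost on the way from
  \<open>x\<close> to \<open>z\<close>. The conclusion concerns the part of \<open>a\<close> at
  \<open>x\<close>, since \<open>a\<close> may have parts at other vertices.\<close>

lemma projective_transition_inj:
  fixes Q :: "('l::{finite,order} \<Rightarrow> 'l \<Rightarrow> 'k::field) fgmod"
  assumes Q: "projective_module inc Q" and a: "a \<in> carrier Q" and "x \<le> z"
    and 0: "incidence_basis x z \<odot>\<^bsub>Q\<^esub> a = \<zero>\<^bsub>Q\<^esub>"
  shows "incidence_basis x x \<odot>\<^bsub>Q\<^esub> a = \<zero>\<^bsub>Q\<^esub>"
proof -
  obtain \<sigma> k \<pi> where \<sigma>: "\<sigma> \<in> rmod_hom inc Q (support_module (free_family k))"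
    and \<pi>: "\<pi> \<in> rmod_hom inc (support_module (free_family k)) Q" "\<forall>q\<in>carrier Q. \<pi> (\<sigma> q) = q"
    by (rule projective_split[OF Q])
  interpret Q: right_module inc Q using Q by (simp add: projective_module_def fg_module_def)
  let ?F = "support_module (free_family k) :: ('l \<Rightarrow> 'l \<Rightarrow> 'k) fgmod"
  interpret F: convex_family "free_family k :: nat \<Rightarrow> 'l \<Rightarrow> 'l set" by (rule convex_free_family)
  note ag = Q.M.abelian_group_axioms right_module.axioms(2)[OF F.right_module_support]
  let ?f = "\<sigma> a"
  have f: "?f \<in> carrier ?F" using rmod_homD(1)[OF \<sigma> a] .
  have "incidence_basis x z \<odot>\<^bsub>?F\<^esub> ?f = \<zero>\<^bsub>?F\<^esub>"
    using rmod_homD(3)[OF \<sigma> _ a, of "incidence_basis x z"] \<open>x \<le> z\<close> rmod_hom_zero[OF \<sigma> ag] 0 by simp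
  then have vz: "(incidence_basis x z \<odot>\<^bsub>?F\<^esub> ?f) n u z = 0" for n u
    by (simp add: sm_zero)
  have "z \<notin> free_family k n u \<or> ?f n u x = 0" for n u
    using vz[of n u] by (auto simp: sm_basis_smult)
  moreover have "z \<in> free_family k n u" if "x \<in> free_family k n u" for n u
    using that \<open>x \<le> z\<close> by (auto simp: free_family_def split: if_splits)
  ultimately have "?f n u x = 0" for n u
    using f unfolding sm_carrier by metis
  then have "incidence_basis x x \<odot>\<^bsub>?F\<^esub> ?f = \<zero>\<^bsub>?F\<^esub>"
    by (intro ext) (auto simp: sm_basis_smult sm_zero)
  then have "incidence_basis x x \<odot>\<^bsub>Q\<^esub> \<pi> ?f = \<zero>\<^bsub>Q\<^esub>"
    using rmod_homD(3)[OF \<pi>(1) _ f, of "incidence_basis x x"] rmod_hom_zero[OF \<pi>(1) ag(2,1)] by simp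
  then show ?thesis using bspec[OF \<pi>(2) a] by simp
qed

text \<open>Agreement at the top means that the coordinates of \<open>a\<close> at \<open>x\<close>
  and of \<open>b\<close> at \<open>y\<close> coincide in a free module. A nonzero one belongs to a
  generator below both \<open>x\<close> and \<open>y\<close>, hence below \<open>inf x y\<close>,
  and can be placed there.\<close>

lemma projective_meet_lift:
  fixes Q :: "('l::{finite,lattice} \<Rightarrow> 'l \<Rightarrow> 'k::field) fgmod"
  assumes Q: "projective_module inc Q" and a: "a \<in> carrier Q" and b: "b \<in> carrier Q"
    and t: "\<And>v. v \<le> t"
    and eq: "incidence_basis x t \<odot>\<^bsub>Q\<^esub> a = incidence_basis y t \<odot>\<^bsub>Q\<^esub> b"
  obtains c where "c \<in> carrier Q" "incidence_basis (inf x y) t \<odot>\<^bsub>Q\<^esub> c = incidence_basis x t \<odot>\<^bsub>Q\<^esub> a"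
proof -
  obtain \<sigma> k \<pi> where \<sigma>: "\<sigma> \<in> rmod_hom inc Q (support_module (free_family k))"
    and \<pi>: "\<pi> \<in> rmod_hom inc (support_module (free_family k)) Q" "\<forall>q\<in>carrier Q. \<pi> (\<sigma> q) = q"
    by (rule projective_split[OF Q])
  let ?F = "support_module (free_family k) :: ('l \<Rightarrow> 'l \<Rightarrow> 'k) fgmod"
  have cl: "\<sigma> a \<in> carrier ?F" "\<sigma> b \<in> carrier ?F" using rmod_homD(1)[OF \<sigma>] a b by auto
  have E: "incidence_basis v t \<in> carrier (inc :: ('k, 'l \<Rightarrow> 'l \<Rightarrow> 'k) module)" for v using t by simp
  have "incidence_basis x t \<odot>\<^bsub>?F\<^esub> \<sigma> a = incidence_basis y t \<odot>\<^bsub>?F\<^esub> \<sigma> b"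
    using rmod_homD(3)[OF \<sigma> E] a b eq by metis
  then have at: "(incidence_basis x t \<odot>\<^bsub>?F\<^esub> \<sigma> a) n u t = (incidence_basis y t \<odot>\<^bsub>?F\<^esub> \<sigma> b) n u t" for n u
    by simp
  have ab: "\<sigma> a n u x = \<sigma> b n u y" if "n < k" for n u
    using that t at[of n u] by (simp add: sm_basis_smult free_family_def)
  define c where "c = (\<lambda>n u (v :: 'l). if v = inf x y then \<sigma> a n u x else 0)"
  have c: "c \<in> carrier ?F"
    unfolding sm_carrier
  proof (intro allI impI)
    fix n and u v :: 'l assume v: "v \<notin> free_family k n u"
    have "\<sigma> a n u x = 0" if "v = inf x y"
    proof (cases "n < k")
      case True
      then have "\<not> u \<le> x \<or> \<not> u \<le> y" using v that by (auto simp: free_family_def)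
      then show ?thesis using cl ab[OF True, of u] by (auto simp: sm_carrier free_family_def)
    next
      case False
      then show ?thesis using cl by (auto simp: sm_carrier free_family_def)
    qed
    then show "c n u v = 0" by (simp add: c_def)
  qed
  have "incidence_basis (inf x y) t \<odot>\<^bsub>?F\<^esub> c = incidence_basis x t \<odot>\<^bsub>?F\<^esub> \<sigma> a"
    by (intro ext) (simp add: sm_basis_smult c_def)
  then have "incidence_basis (inf x y) t \<odot>\<^bsub>Q\<^esub> \<pi> c = incidence_basis x t \<odot>\<^bsub>Q\<^esub> a"
    using rmod_homD(3)[OF \<pi>(1) E] c cl(1) bspec[OF \<pi>(2) a] by metis
  then show ?thesis using that rmod_homD(1)[OF \<pi>(1) c] by blast
qed

lemma pdim_le_iff:
  "pdim A M \<le> enat n \<longleftrightarrow> (\<exists>P e d. projective_resolution A M P e d \<and> (\<forall>i>n. carrier (P i) = {\<zero>\<^bsub>P i\<^esub>}))"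
proof
  assume le: "pdim A M \<le> enat n"
  show "\<exists>P e d. projective_resolution A M P e d \<and> (\<forall>i>n. carrier (P i) = {\<zero>\<^bsub>P i\<^esub>})"
  proof (rule ccontr)
    assume no: "\<not> ?thesis"
    have "enat (Suc n) \<le> pdim A M"
      unfolding pdim_def
    proof (rule Inf_greatest, safe)
      fix m P e d assume "projective_resolution A M P e d" "\<forall>i>m. carrier (P i) = {\<zero>\<^bsub>P i\<^esub>}"
      then have "\<not> m \<le> n" using no by (metis order_le_less_trans)
      then show "enat (Suc n) \<le> enat m" by simp
    qed
    then have "enat (Suc n) \<le> enat n" using le order_trans by blast
    then show False by simp
  qed
next
  assume "\<exists>P e d. projective_resolution A M P e d \<and> (\<forall>i>n. carrier (P i) = {\<zero>\<^bsub>P i\<^esub>})"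
  then show "pdim A M \<le> enat n"
    unfolding pdim_def by (intro Inf_lower) blast
qed

lemma finite_lattice_top:
  obtains t :: "'l::{finite,lattice}" where "\<And>v. v \<le> t"
  using Sup_fin.coboundedI[of "UNIV :: 'l set"] by auto

lemma finite_lattice_bot:
  obtains b :: "'l::{finite,lattice}" where "\<And>v. b \<le> v"
  using Inf_fin.coboundedI[of "UNIV :: 'l set"] by auto

text \<open>
  The obstruction lies in the first syzygy, which is projective and hence satisfies the gluing property of
  \<open>projective_meet_lift\<close>.
\<close>

lemma pdim_le_1_separated:
  fixes X :: "('l::{finite,lattice} \<Rightarrow> 'l \<Rightarrow> 'k::field) fgmod"
  assumes pd: "pdim inc X \<le> enat 1" and X: "right_module inc X" and a: "a \<in> carrier X"
    and ax: "incidence_basis (inf x y) x \<odot>\<^bsub>X\<^esub> a = \<zero>\<^bsub>X\<^esub>"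
    and ay: "incidence_basis (inf x y) y \<odot>\<^bsub>X\<^esub> a = \<zero>\<^bsub>X\<^esub>"
  shows "incidence_basis (inf x y) (inf x y) \<odot>\<^bsub>X\<^esub> a = \<zero>\<^bsub>X\<^esub>"
proof -
  let ?w = "inf x y" and ?e = "incidence_basis :: 'l \<Rightarrow> 'l \<Rightarrow> 'l \<Rightarrow> 'l \<Rightarrow> 'k"
  obtain t :: 'l where t: "\<And>v. v \<le> t" by (rule finite_lattice_top) blast
  obtain P e d where res: "projective_resolution inc X P e d"
    and P2: "\<forall>i>1. carrier (P i) = {\<zero>\<^bsub>P i\<^esub>}"
    using pd unfolding pdim_le_iff by blast
  have P: "projective_module inc (P i)" and d: "d i \<in> rmod_hom inc (P (Suc i)) (P i)" for i
    using res by (auto simp: projective_resolution_def)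
  have e: "e \<in> rmod_hom inc (P 0) X" and esurj: "e ` carrier (P 0) = carrier X"
    and ker0: "d 0 ` carrier (P (Suc 0)) = a_kernel (P 0) X e"
    and ker1: "d (Suc 0) ` carrier (P (Suc (Suc 0))) = a_kernel (P (Suc 0)) (P 0) (d 0)"
    using res by (auto simp: projective_resolution_def)
  have rm: "right_module inc (P i)" for i
    using P by (simp add: projective_module_def fg_module_def)
  note ag = right_module.axioms(2)[OF rm]
  interpret X: right_module inc X by fact
  interpret P0: right_module inc "P 0" by (rule rm)
  interpret P1: right_module inc "P (Suc 0)" by (rule rm)
  \<comment> \<open>The resolution has length one, so the term of degree two is zero and exactness
    makes \<open>d 0\<close> injective.\<close>
  have inj: "r = \<zero>\<^bsub>P (Suc 0)\<^esub>" if "r \<in> carrier (P (Suc 0))" "d 0 r = \<zero>\<^bsub>P 0\<^esub>" for r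
  proof -
    have "r \<in> d (Suc 0) ` carrier (P (Suc (Suc 0)))"
      using that unfolding ker1 by (simp add: a_kernel_def')
    then show ?thesis
      using P2 rmod_hom_zero[OF d ag ag, of "Suc 0"] by auto
  qed
  have inj': "r = s" if "r \<in> carrier (P (Suc 0))" "s \<in> carrier (P (Suc 0))" "d 0 r = d 0 s" for r s
  proof -
    have "d 0 (r \<ominus>\<^bsub>P (Suc 0)\<^esub> s) = \<zero>\<^bsub>P 0\<^esub>"
      using rmod_hom_diff[OF d ag ag that(1,2)] that(3) rmod_homD(1)[OF d that(2)]
      by (simp add: P0.M.r_neg a_minus_def)
    then have "r \<ominus>\<^bsub>P (Suc 0)\<^esub> s = \<zero>\<^bsub>P (Suc 0)\<^esub>"
      using inj that(1,2) by blast
    then show ?thesis using that(1,2) abelian_group_diff_zero[OF ag] by blast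
  qed
  have "a \<in> e ` carrier (P 0)" using esurj a by simp
  then obtain q where q: "q \<in> carrier (P 0)" "e q = a" by auto
  have lift: "\<exists>r\<in>carrier (P (Suc 0)). d 0 r = ?e ?w z \<odot>\<^bsub>P 0\<^esub> q"
    if "?w \<le> z" "?e ?w z \<odot>\<^bsub>X\<^esub> a = \<zero>\<^bsub>X\<^esub>" for z
  proof -
    have "?e ?w z \<odot>\<^bsub>P 0\<^esub> q \<in> a_kernel (P 0) X e"
      using that q rmod_homD(3)[OF e _ q(1), of "?e ?w z"] by (simp add: a_kernel_def' P0.ract_closed)
    then show ?thesis unfolding ker0[symmetric] by (metis imageE)
  qed
  obtain r where r: "r \<in> carrier (P (Suc 0))" "d 0 r = ?e ?w x \<odot>\<^bsub>P 0\<^esub> q"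
    using lift[of x] ax by auto
  obtain s where s: "s \<in> carrier (P (Suc 0))" "d 0 s = ?e ?w y \<odot>\<^bsub>P 0\<^esub> q"
    using lift[of y] ay by auto
  have dr: "d 0 (?e x t \<odot>\<^bsub>P (Suc 0)\<^esub> r) = ?e ?w t \<odot>\<^bsub>P 0\<^esub> q"
    using rmod_homD(3)[OF d _ r(1), of "?e x t"] r(2) t basis_ract[OF rm _ t q(1), of ?w x] by simp
  have ds: "d 0 (?e y t \<odot>\<^bsub>P (Suc 0)\<^esub> s) = ?e ?w t \<odot>\<^bsub>P 0\<^esub> q"
    using rmod_homD(3)[OF d _ s(1), of "?e y t"] s(2) t basis_ract[OF rm _ t q(1), of ?w y] by simp
  have rs: "?e x t \<odot>\<^bsub>P (Suc 0)\<^esub> r = ?e y t \<odot>\<^bsub>P (Suc 0)\<^esub> s"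
    by (rule inj') (use r(1) s(1) t dr ds in \<open>simp_all add: P1.ract_closed\<close>)
  \<comment> \<open>At the top \<open>d 0 c\<close> agrees with \<open>q\<close>. Transition maps in
    \<open>P 0\<close> are injective, so they agree already at \<open>inf x y\<close>, and there
    \<open>a\<close> is the image of \<open>d 0 c\<close> under \<open>e\<close>, which is
    zero.\<close>
  obtain c where c: "c \<in> carrier (P (Suc 0))" "?e ?w t \<odot>\<^bsub>P (Suc 0)\<^esub> c = ?e x t \<odot>\<^bsub>P (Suc 0)\<^esub> r"
    by (rule projective_meet_lift[OF P r(1) s(1) t rs])
  have dc: "d 0 c \<in> carrier (P 0)" using rmod_homD(1)[OF d c(1)] .
  have neg: "?e u v \<odot>\<^bsub>P 0\<^esub> (q \<ominus>\<^bsub>P 0\<^esub> d 0 c) = ?e u v \<odot>\<^bsub>P 0\<^esub> q \<ominus>\<^bsub>P 0\<^esub> ?e u v \<odot>\<^bsub>P 0\<^esub> d 0 c" if "u \<le> v" for u v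
    using q(1) dc that by (simp add: a_minus_def P0.ract_distr_module P0.ract_minus)
  have "?e ?w t \<odot>\<^bsub>P 0\<^esub> d 0 c = ?e ?w t \<odot>\<^bsub>P 0\<^esub> q"
    using rmod_homD(3)[OF d _ c(1), of "?e ?w t"] c(2) dr t by simp
  then have "?e ?w t \<odot>\<^bsub>P 0\<^esub> (q \<ominus>\<^bsub>P 0\<^esub> d 0 c) = \<zero>\<^bsub>P 0\<^esub>"
    using neg[OF t] q(1) t by (simp add: P0.M.r_neg a_minus_def P0.ract_closed)
  then have "?e ?w ?w \<odot>\<^bsub>P 0\<^esub> (q \<ominus>\<^bsub>P 0\<^esub> d 0 c) = \<zero>\<^bsub>P 0\<^esub>"
    by (rule projective_transition_inj[OF P _ t, rotated]) (use q(1) dc in auto)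
  then have "?e ?w ?w \<odot>\<^bsub>P 0\<^esub> q \<ominus>\<^bsub>P 0\<^esub> ?e ?w ?w \<odot>\<^bsub>P 0\<^esub> d 0 c = \<zero>\<^bsub>P 0\<^esub>"
    using neg[of ?w ?w] by simp
  then have "?e ?w ?w \<odot>\<^bsub>P 0\<^esub> q = ?e ?w ?w \<odot>\<^bsub>P 0\<^esub> d 0 c"
    by (rule abelian_group_diff_zero[OF ag, rotated 2]) (use q(1) dc in \<open>simp_all add: P0.ract_closed\<close>)
  moreover have "e (d 0 c) = \<zero>\<^bsub>X\<^esub>"
    using ker0 c(1) by (auto simp: a_kernel_def')
  ultimately show ?thesis
    using rmod_homD(3)[OF e _ q(1), of "?e ?w ?w"] rmod_homD(3)[OF e _ dc, of "?e ?w ?w"] q(2)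
    by (simp add: X.ract_zero)
qed

section \<open>Non-distributive lattices\<close>

text \<open>One interval representation, stored in the component \<open>(0, z)\<close>;
  \<open>z\<close> is a storage place and need not belong to \<open>X\<close>.\<close>

definition single_family :: "'l \<Rightarrow> 'l set \<Rightarrow> nat \<Rightarrow> 'l::{finite,order} \<Rightarrow> 'l set" where
  "single_family z X n x = (if n = 0 \<and> x = z then X else {})"

lemma convex_single_family:
  assumes "\<And>u v w. u \<in> X \<Longrightarrow> w \<in> X \<Longrightarrow> u \<le> v \<Longrightarrow> v \<le> w \<Longrightarrow> v \<in> X"
  shows "convex_family (single_family z X)"
proof
  have "{(n, x). single_family z X n x \<noteq> {}} \<subseteq> {(0, z)}"
    by (auto simp: single_family_def split: if_splits)
  then show "finite {(n, x). single_family z X n x \<noteq> {}}"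
    by (rule finite_subset) auto
next
  fix u n x w v
  assume "u \<in> single_family z X n x" "w \<in> single_family z X n x" "u \<le> v" "v \<le> w"
  then show "v \<in> single_family z X n x"
    using assms[of u w v] by (simp add: single_family_def split: if_splits)
qed

lemma inclusion_hom:
  fixes C D :: "nat \<Rightarrow> 'l::{finite,order} \<Rightarrow> 'l set"
  assumes sub: "\<And>n x. C n x \<subseteq> D n x"
    and up: "\<And>n x u v. u \<in> C n x \<Longrightarrow> v \<in> D n x \<Longrightarrow> u \<le> v \<Longrightarrow> v \<in> C n x"
  shows "(\<lambda>f. f) \<in> rmod_hom inc (support_module C :: ('l \<Rightarrow> 'l \<Rightarrow> 'k::field) fgmod) (support_module D)"
proof (rule rmod_homI)
  fix a f assume a: "a \<in> carrier (inc :: ('k, 'l \<Rightarrow> 'l \<Rightarrow> 'k) module)"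
    and f: "f \<in> carrier (support_module C :: ('l \<Rightarrow> 'l \<Rightarrow> 'k) fgmod)"
  show "a \<odot>\<^bsub>support_module C\<^esub> f = a \<odot>\<^bsub>support_module D\<^esub> f"
  proof (intro ext)
    fix n x v
    have "f n x u * a u v = 0" if "v \<in> D n x" "v \<notin> C n x" for u
      using a f up[of u n x v] that unfolding sm_carrier inc_carrier mult_eq_0_iff by metis
    then have "(\<Sum>u\<in>UNIV. f n x u * a u v) = 0" if "v \<in> D n x" "v \<notin> C n x"
      using that by (simp del: mult_eq_0_iff)
    then show "(a \<odot>\<^bsub>support_module C\<^esub> f) n x v = (a \<odot>\<^bsub>support_module D\<^esub> f) n x v"
      using sub[of n x] by (auto simp: sm_smult)
  qed
next
  fix f assume "f \<in> carrier (support_module C :: ('l \<Rightarrow> 'l \<Rightarrow> 'k) fgmod)"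
  then show "f \<in> carrier (support_module D)"
    unfolding sm_carrier using sub by (meson subsetD)
qed (simp add: sm_add)

text \<open>As \<open>m\<close> sits at \<open>y\<close>, only row \<open>y\<close> of
  \<open>b\<close> acts, and its entries strictly above \<open>y\<close> send \<open>m\<close> to
  zero. For nonzero \<open>m\<close> the line through \<open>m\<close> is the simple module at
  \<open>y\<close>.\<close>

lemma socle_ract:
  assumes "right_module (inc :: ('k::field, 'l::{finite,order} \<Rightarrow> 'l \<Rightarrow> 'k) module) M"
    and m: "m \<in> carrier M" "incidence_basis y y \<odot>\<^bsub>M\<^esub> m = m"
    and soc: "\<And>z. y < z \<Longrightarrow> incidence_basis y z \<odot>\<^bsub>M\<^esub> m = \<zero>\<^bsub>M\<^esub>"
    and b: "b \<in> carrier inc"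
  shows "b \<odot>\<^bsub>M\<^esub> m = inc_scalar (b y y) \<odot>\<^bsub>M\<^esub> m"
proof -
  interpret M: right_module inc M by fact
  let ?e = "incidence_basis :: 'l \<Rightarrow> 'l \<Rightarrow> 'l \<Rightarrow> 'l \<Rightarrow> 'k"
  have cl: "?e y z \<otimes>\<^bsub>inc\<^esub> inc_scalar (b y z) \<in> carrier inc" if "z \<in> {y..}" for z
    using that by (intro inc_m_closed) auto
  have "?e y y \<otimes>\<^bsub>inc\<^esub> b = (\<Oplus>\<^bsub>inc\<^esub>z\<in>{y..}. ?e y z \<otimes>\<^bsub>inc\<^esub> inc_scalar (b y z))"
  proof (intro ext)
    fix s t
    have "(?e y y \<otimes>\<^bsub>inc\<^esub> b) s t = (\<Sum>w\<in>UNIV. if w = y then (if s = y then b y t else 0) else 0)"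
      unfolding inc_mult by (intro sum.cong) (auto simp: incidence_basis_def)
    also have "\<dots> = (if s = y then b y t else 0)" by simp
    also have "\<dots> = (\<Sum>z\<in>{y..}. if z = t then (if s = y then b y t else 0) else 0)"
      using b by (auto simp: inc_carrier)
    also have "\<dots> = (\<Sum>z\<in>{y..}. (?e y z \<otimes>\<^bsub>inc\<^esub> inc_scalar (b y z)) s t)"
    proof (intro sum.cong refl)
      fix z
      have "(?e y z \<otimes>\<^bsub>inc\<^esub> inc_scalar (b y z)) s t
          = (\<Sum>w\<in>UNIV. if w = z then (if s = y \<and> z = t then b y t else 0) else 0)"
        unfolding inc_mult by (intro sum.cong) (auto simp: incidence_basis_def inc_scalar_def)
      then show "(if z = t then (if s = y then b y t else 0) else 0)
          = (?e y z \<otimes>\<^bsub>inc\<^esub> inc_scalar (b y z)) s t" by simp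
    qed
    also have "\<dots> = (\<Oplus>\<^bsub>inc\<^esub>z\<in>{y..}. ?e y z \<otimes>\<^bsub>inc\<^esub> inc_scalar (b y z)) s t"
      using cl by (intro finsum_inc[symmetric]) auto
    finally show "(?e y y \<otimes>\<^bsub>inc\<^esub> b) s t = (\<Oplus>\<^bsub>inc\<^esub>z\<in>{y..}. ?e y z \<otimes>\<^bsub>inc\<^esub> inc_scalar (b y z)) s t" .
  qed
  then have "b \<odot>\<^bsub>M\<^esub> m = (\<Oplus>\<^bsub>inc\<^esub>z\<in>{y..}. ?e y z \<otimes>\<^bsub>inc\<^esub> inc_scalar (b y z)) \<odot>\<^bsub>M\<^esub> m"
    using M.ract_assoc[of "?e y y" b m] m b by simp
  also have "\<dots> = (\<Oplus>\<^bsub>M\<^esub>z\<in>{y..}. (?e y z \<otimes>\<^bsub>inc\<^esub> inc_scalar (b y z)) \<odot>\<^bsub>M\<^esub> m)"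
    using cl m(1) by (intro M.finsum_ract) auto
  also have "\<dots> = (\<Oplus>\<^bsub>M\<^esub>z\<in>{y..}. if y = z then inc_scalar (b y z) \<odot>\<^bsub>M\<^esub> m else \<zero>\<^bsub>M\<^esub>)"
  proof (rule M.M.finsum_cong')
    show "(\<lambda>z. if y = z then inc_scalar (b y z) \<odot>\<^bsub>M\<^esub> m else \<zero>\<^bsub>M\<^esub>) \<in> {y..} \<rightarrow> carrier M"
      using m(1) by (simp add: M.ract_closed)
    fix z assume z: "z \<in> {y..}"
    then have "(?e y z \<otimes>\<^bsub>inc\<^esub> inc_scalar (b y z)) \<odot>\<^bsub>M\<^esub> m = inc_scalar (b y z) \<odot>\<^bsub>M\<^esub> (?e y z \<odot>\<^bsub>M\<^esub> m)"
      using M.ract_assoc[of "?e y z" "inc_scalar (b y z)" m] m(1) by simp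
    then show "(?e y z \<otimes>\<^bsub>inc\<^esub> inc_scalar (b y z)) \<odot>\<^bsub>M\<^esub> m = (if y = z then inc_scalar (b y z) \<odot>\<^bsub>M\<^esub> m else \<zero>\<^bsub>M\<^esub>)"
      using z m(2) soc[of z] by (auto simp: M.ract_zero)
  qed simp
  also have "\<dots> = inc_scalar (b y y) \<odot>\<^bsub>M\<^esub> m"
    using M.M.finsum_singleton[of y "{y..}" "\<lambda>z. inc_scalar (b y z) \<odot>\<^bsub>M\<^esub> m"] m(1)
    by (simp add: M.ract_closed)
  finally show ?thesis .
qed

definition vertex_vec :: "'l \<Rightarrow> 'l \<Rightarrow> nat \<Rightarrow> 'l \<Rightarrow> 'l \<Rightarrow> 'k::field" where
  "vertex_vec z v = (\<lambda>n x u. if n = 0 \<and> x = z \<and> u = v then 1 else 0)"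

lemma vertex_vec_closed: "v \<in> X \<Longrightarrow> vertex_vec z v \<in> carrier (support_module (single_family z X))"
  by (auto simp: vertex_vec_def sm_carrier single_family_def)

lemma basis_vertex_vec:
  "incidence_basis u v \<odot>\<^bsub>support_module (single_family z X)\<^esub> vertex_vec z u
    = (if v \<in> X then vertex_vec z v else (\<lambda>_ _ _. 0))"
  by (intro ext) (auto simp: sm_basis_smult vertex_vec_def single_family_def)

lemma inc_scalar_one: "inc_scalar 1 = \<one>\<^bsub>inc\<^esub>"
  by (intro ext) (simp add: inc_scalar_def inc_one)

lemma not_2_GorensteinI:
  fixes x y x1 x2 :: "'l::{finite,lattice}"
  assumes xy: "\<not> x \<le> y" and above: "\<And>z. y < z \<Longrightarrow> x \<le> z"
    and w: "inf x1 x2 \<le> y" and x12: "\<not> x1 \<le> y" "\<not> x2 \<le> y"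
  shows "\<not> n_Gorenstein 2 (inc :: ('k::field, 'l \<Rightarrow> 'l \<Rightarrow> 'k) module)"
proof
  let ?A = "inc :: ('k, 'l \<Rightarrow> 'l \<Rightarrow> 'k) module"
  let ?e = "incidence_basis :: 'l \<Rightarrow> 'l \<Rightarrow> 'l \<Rightarrow> 'l \<Rightarrow> 'k"
  assume "n_Gorenstein 2 ?A"
  then obtain I \<epsilon> d where res: "minimal_injective_coresolution ?A (regular_module ?A) I \<epsilon> d"
    and pd: "\<forall>i<2. pdim ?A (I i) \<le> enat i"
    unfolding n_Gorenstein_def by blast
  have pd1: "pdim ?A (I (Suc 0)) \<le> enat 1" using pd by simp
  have inj: "injective_module ?A (I i)" and d: "d i \<in> rmod_hom ?A (I i) (I (Suc i))" for i
    using res by (simp_all add: minimal_injective_coresolution_def)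
  have \<epsilon>: "\<epsilon> \<in> rmod_hom ?A (regular_module ?A) (I 0)" and \<epsilon>inj: "inj_on \<epsilon> (carrier ?A)"
    and ker: "\<epsilon> ` carrier ?A = a_kernel (I 0) (I (Suc 0)) (d 0)"
    using res by (simp_all add: minimal_injective_coresolution_def regular_module_simps)
  have rm: "right_module ?A (I i)" for i
    using inj by (simp add: injective_module_def fg_module_def)
  interpret I0: right_module ?A "I 0" by (rule rm)
  interpret I1: right_module ?A "I (Suc 0)" by (rule rm)
  obtain b :: 'l where b: "\<And>v. b \<le> v" by (rule finite_lattice_bot) blast
  obtain t :: 'l where t: "\<And>v. v \<le> t" by (rule finite_lattice_top) blast
  let ?Px = "support_module (single_family x {x..}) :: ('l \<Rightarrow> 'l \<Rightarrow> 'k) fgmod"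
  let ?P0 = "support_module (single_family x UNIV) :: ('l \<Rightarrow> 'l \<Rightarrow> 'k) fgmod"
  have cPx: "convex_family (single_family x {x..})" and cP0: "convex_family (single_family x (UNIV :: 'l set))"
    by (rule convex_single_family, simp)+
  have "(\<lambda>f. inc_row x (f 0 x)) \<in> rmod_hom ?A ?Px (regular_module ?A)"
    by (rule inc_row_hom) (simp add: single_family_def)
  then have \<phi>: "(\<lambda>f. \<epsilon> (inc_row x (f 0 x))) \<in> rmod_hom ?A ?Px (I 0)"
    using \<epsilon> by (rule rmod_hom_compose)
  have incl: "(\<lambda>f. f) \<in> rmod_hom ?A ?Px ?P0"
    by (rule inclusion_hom) (auto simp: single_family_def split: if_splits)
  obtain h where h: "h \<in> rmod_hom ?A ?P0 (I 0)"
    and h\<phi>: "\<forall>f\<in>carrier ?Px. h f = \<epsilon> (inc_row x (f 0 x))"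
    using injective_extend[OF inj fg_support[OF cPx] fg_support[OF cP0] incl \<phi>] by auto
  \<comment> \<open>\<open>q\<close> continues the generator of \<open>P x\<close> down to the
    bottom \<open>b\<close>: for \<open>z\<close> above \<open>x\<close> its transport is the image
    under \<open>\<epsilon>\<close> of the matrix unit at \<open>(x, z)\<close>.\<close>
  define q where "q = h (vertex_vec x b)"
  have q: "q \<in> carrier (I 0)"
    unfolding q_def by (rule rmod_homD(1)[OF h]) (rule vertex_vec_closed, simp)
  have row: "inc_row x (vertex_vec x z 0 x) = ?e x z" for z
    by (intro ext) (auto simp: inc_row_def vertex_vec_def incidence_basis_def)
  have qz: "?e b z \<odot>\<^bsub>I 0\<^esub> q = \<epsilon> (?e x z)" if "x \<le> z" for z
  proof -
    have "?e b z \<odot>\<^bsub>I 0\<^esub> q = h (?e b z \<odot>\<^bsub>?P0\<^esub> vertex_vec x b)"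
      unfolding q_def using b by (intro rmod_homD(3)[OF h, symmetric] vertex_vec_closed) auto
    also have "\<dots> = h (vertex_vec x z)" by (simp add: basis_vertex_vec)
    also have "\<dots> = \<epsilon> (?e x z)"
      using bspec[OF h\<phi> vertex_vec_closed[of z "{x..}" x]] that by (simp add: row)
    finally show ?thesis .
  qed
  \<comment> \<open>At \<open>y\<close> the transport of \<open>q\<close> is still outside the image
    of \<open>\<epsilon>\<close>, but each transition to a larger vertex moves it inside. Hence
    \<open>d 0\<close> makes a socle vector of it.\<close>
  define v where "v = d 0 (?e b y \<odot>\<^bsub>I 0\<^esub> q)"
  have bq: "?e b z \<odot>\<^bsub>I 0\<^esub> q \<in> carrier (I 0)" for z
    using q b by (simp add: I0.ract_closed)
  have v: "v \<in> carrier (I (Suc 0))"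
    unfolding v_def by (rule rmod_homD(1)[OF d bq])
  have yv: "?e y z \<odot>\<^bsub>I (Suc 0)\<^esub> v = d 0 (?e b z \<odot>\<^bsub>I 0\<^esub> q)" if "y \<le> z" for z
    unfolding v_def using that b rmod_homD(3)[OF d _ bq, of "?e y z" y] basis_ract[OF rm b that q] by simp
  have vyy: "?e y y \<odot>\<^bsub>I (Suc 0)\<^esub> v = v"
    using yv[of y] by (simp add: v_def)
  have soc: "?e y z \<odot>\<^bsub>I (Suc 0)\<^esub> v = \<zero>\<^bsub>I (Suc 0)\<^esub>" if "y < z" for z
  proof -
    have xz: "x \<le> z" using above that .
    then have "\<epsilon> (?e x z) \<in> a_kernel (I 0) (I (Suc 0)) (d 0)"
      unfolding ker[symmetric] by (intro imageI) simp
    then show ?thesis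
      using yv[of z] that qz[OF xz] by (simp add: a_kernel_def')
  qed
  \<comment> \<open>If the vector at \<open>y\<close> were \<open>\<epsilon> \<alpha>\<close>,
    moving on to the top would turn \<open>\<alpha>\<close> times the unit \<open>(y, t)\<close>
    into the unit \<open>(x, t)\<close>. The entry at \<open>(x, t)\<close> gives
    \<open>\<alpha> x y = 1\<close>, although \<open>x\<close> is not below
    \<open>y\<close>.\<close>
  have v0: "v \<noteq> \<zero>\<^bsub>I (Suc 0)\<^esub>"
  proof
    assume "v = \<zero>\<^bsub>I (Suc 0)\<^esub>"
    then have "?e b y \<odot>\<^bsub>I 0\<^esub> q \<in> \<epsilon> ` carrier ?A"
      unfolding ker using bq by (simp add: a_kernel_def' v_def)
    then obtain \<alpha> where \<alpha>: "\<alpha> \<in> carrier ?A" "?e b y \<odot>\<^bsub>I 0\<^esub> q = \<epsilon> \<alpha>" by auto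
    have "\<epsilon> (\<alpha> \<otimes>\<^bsub>?A\<^esub> ?e y t) = ?e y t \<odot>\<^bsub>I 0\<^esub> \<epsilon> \<alpha>"
      using rmod_homD(3)[OF \<epsilon>, of "?e y t" \<alpha>] \<alpha>(1) t by (simp add: regular_module_simps)
    also have "\<dots> = \<epsilon> (?e x t)"
      unfolding \<alpha>(2)[symmetric] basis_ract[OF rm b t q] by (rule qz[OF t])
    finally have "\<alpha> \<otimes>\<^bsub>?A\<^esub> ?e y t = ?e x t"
      using \<alpha>(1) t by (intro inj_onD[OF \<epsilon>inj]) (simp_all add: inc_m_closed)
    then have "(\<alpha> \<otimes>\<^bsub>?A\<^esub> ?e y t) x t = 1" by (simp add: incidence_basis_def)
    moreover have "(\<alpha> \<otimes>\<^bsub>?A\<^esub> ?e y t) x t = (\<Sum>u\<in>UNIV. if u = y then \<alpha> x y else 0)"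
      unfolding inc_mult by (intro sum.cong) (auto simp: incidence_basis_def)
    ultimately show False using \<alpha>(1) xy by (simp add: inc_carrier)
  qed
  let ?S = "support_module (single_family x {y}) :: ('l \<Rightarrow> 'l \<Rightarrow> 'k) fgmod"
  let ?J = "support_module (single_family x {..y}) :: ('l \<Rightarrow> 'l \<Rightarrow> 'k) fgmod"
  have cS: "convex_family (single_family x {y})" and cJ: "convex_family (single_family x {..y})"
    by (rule convex_single_family, force)+
  have inclS: "(\<lambda>f. f) \<in> rmod_hom ?A ?S ?J"
    by (rule inclusion_hom) (auto simp: single_family_def split: if_splits)
  \<comment> \<open>The simple module at \<open>y\<close> goes to the line through \<open>v\<close>.
    Injectivity then extends the map to the whole down-set of \<open>y\<close>, which supplies
    vectors below \<open>v\<close>.\<close>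
  have \<psi>: "(\<lambda>f. inc_scalar (f 0 x y) \<odot>\<^bsub>I (Suc 0)\<^esub> v) \<in> rmod_hom ?A ?S (I (Suc 0))"
  proof (rule rmod_homI)
    fix f g :: "nat \<Rightarrow> 'l \<Rightarrow> 'l \<Rightarrow> 'k"
    have "inc_scalar ((f \<oplus>\<^bsub>?S\<^esub> g) 0 x y) = inc_scalar (f 0 x y) \<oplus>\<^bsub>?A\<^esub> inc_scalar (g 0 x y)"
      by (intro ext) (simp add: sm_add inc_scalar_def inc_add)
    then show "inc_scalar ((f \<oplus>\<^bsub>?S\<^esub> g) 0 x y) \<odot>\<^bsub>I (Suc 0)\<^esub> v
        = inc_scalar (f 0 x y) \<odot>\<^bsub>I (Suc 0)\<^esub> v \<oplus>\<^bsub>I (Suc 0)\<^esub> inc_scalar (g 0 x y) \<odot>\<^bsub>I (Suc 0)\<^esub> v"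
      using v by (simp add: I1.ract_distr_ring)
  next
    fix a f assume a: "a \<in> carrier ?A" and f: "f \<in> carrier ?S"
    have "(\<Sum>u\<in>UNIV. f 0 x u * a u y) = (\<Sum>u\<in>UNIV. if u = y then f 0 x y * a y y else 0)"
      using f by (intro sum.cong) (auto simp: sm_carrier single_family_def)
    then have fy: "(a \<odot>\<^bsub>?S\<^esub> f) 0 x y = f 0 x y * a y y"
      by (simp add: sm_smult single_family_def)
    let ?c = "inc_scalar (f 0 x y) \<otimes>\<^bsub>?A\<^esub> a"
    have c: "?c \<in> carrier ?A" using a by (simp add: inc_m_closed)
    have cy: "?c y y = f 0 x y * a y y"
    proof -
      have "?c y y = (\<Sum>u\<in>UNIV. if u = y then f 0 x y * a y y else 0)"
        unfolding inc_mult by (intro sum.cong) (auto simp: inc_scalar_def)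
      then show ?thesis by simp
    qed
    have "a \<odot>\<^bsub>I (Suc 0)\<^esub> (inc_scalar (f 0 x y) \<odot>\<^bsub>I (Suc 0)\<^esub> v) = ?c \<odot>\<^bsub>I (Suc 0)\<^esub> v"
      using a v by (simp add: I1.ract_assoc)
    also have "\<dots> = inc_scalar (?c y y) \<odot>\<^bsub>I (Suc 0)\<^esub> v"
      by (rule socle_ract[OF rm v vyy soc c])
    finally show "inc_scalar ((a \<odot>\<^bsub>?S\<^esub> f) 0 x y) \<odot>\<^bsub>I (Suc 0)\<^esub> v
        = a \<odot>\<^bsub>I (Suc 0)\<^esub> (inc_scalar (f 0 x y) \<odot>\<^bsub>I (Suc 0)\<^esub> v)"
      unfolding fy cy by simp
  qed (use v in \<open>simp add: I1.ract_closed\<close>)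
  obtain k where k: "k \<in> rmod_hom ?A ?J (I (Suc 0))"
    and k\<psi>: "\<forall>f\<in>carrier ?S. k f = inc_scalar (f 0 x y) \<odot>\<^bsub>I (Suc 0)\<^esub> v"
    using injective_extend[OF inj fg_support[OF cS] fg_support[OF cJ] inclS \<psi>] by auto
  let ?w = "inf x1 x2"
  have g: "vertex_vec x ?w \<in> carrier ?J" using w by (intro vertex_vec_closed) simp
  \<comment> \<open>\<open>u\<close> is a predecessor of \<open>v\<close> at the meet: its transport
    to \<open>y\<close> is \<open>v\<close>, whereas \<open>x1\<close> and \<open>x2\<close> lie
    outside the down-set of \<open>y\<close>, so it dies there.\<close>
  define u where "u = k (vertex_vec x ?w)"
  have u: "u \<in> carrier (I (Suc 0))" unfolding u_def by (rule rmod_homD(1)[OF k g])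
  have eu: "?e ?w z \<odot>\<^bsub>I (Suc 0)\<^esub> u = k (if z \<le> y then vertex_vec x z else \<zero>\<^bsub>?J\<^esub>)" if "?w \<le> z" for z
    unfolding u_def using rmod_homD(3)[OF k _ g, of "?e ?w z"] that
    by (auto simp: basis_vertex_vec sm_zero split: if_splits)
  have k0: "k \<zero>\<^bsub>?J\<^esub> = \<zero>\<^bsub>I (Suc 0)\<^esub>"
    by (rule rmod_hom_zero[OF k]) (intro right_module.axioms(2)[OF convex_family.right_module_support[OF cJ]] I1.M.abelian_group_axioms)+
  have "?e ?w ?w \<odot>\<^bsub>I (Suc 0)\<^esub> u = \<zero>\<^bsub>I (Suc 0)\<^esub>"
    using eu[of x1] eu[of x2] x12 k0 by (intro pdim_le_1_separated[OF pd1 rm u]) simp_all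
  then have "?e ?w y \<odot>\<^bsub>I (Suc 0)\<^esub> u = \<zero>\<^bsub>I (Suc 0)\<^esub>"
    using basis_ract[OF rm _ w u, of ?w] w by (simp add: I1.ract_zero)
  moreover have "?e ?w y \<odot>\<^bsub>I (Suc 0)\<^esub> u = v"
    using eu[OF w] bspec[OF k\<psi> vertex_vec_closed[of y "{y}" x]] v
    by (simp add: vertex_vec_def inc_scalar_one I1.ract_one)
  ultimately show False using v0 by simp
qed

text \<open>
  Choose \<open>y\<close> maximal above \<open>(a \<sqinter> b) \<squnion> (a \<sqinter> c)\<close> but not above \<open>a \<sqinter> (b \<squnion> c)\<close>. If \<open>y\<close> were meet prime, it would lie
  above \<open>b\<close> and \<open>c\<close>.
\<close>

lemma not_distributive_not_2_Gorenstein: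
  assumes "\<not> class.distrib_lattice (inf :: 'l::{finite,lattice} \<Rightarrow> 'l \<Rightarrow> 'l) (\<le>) (<) sup"
  shows "\<not> n_Gorenstein 2 (inc :: ('k::field, 'l \<Rightarrow> 'l \<Rightarrow> 'k) module)"
proof -
  obtain a b c :: 'l where ne: "inf a (sup b c) \<noteq> sup (inf a b) (inf a c)"
  proof -
    have "\<exists>a b c :: 'l. inf a (sup b c) \<noteq> sup (inf a b) (inf a c)"
    proof (rule ccontr)
      assume "\<not> ?thesis"
      then have D: "\<And>a b c :: 'l. inf a (sup b c) = sup (inf a b) (inf a c)" by blast
      have "class.distrib_lattice (inf :: 'l \<Rightarrow> 'l \<Rightarrow> 'l) (\<le>) (<) sup"
        by unfold_locales (rule distrib_imp1[OF D])
      then show False using assms by contradiction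
    qed
    then show ?thesis using that by blast
  qed
  define x where "x = inf a (sup b c)"
  let ?s = "sup (inf a b) (inf a c)"
  have "?s \<le> x" unfolding x_def by (intro le_infI le_supI) (auto intro: le_infI1 le_infI2 le_supI1 le_supI2)
  then have "\<not> x \<le> ?s" using ne antisym unfolding x_def by metis
  define T where "T = {y. ?s \<le> y \<and> \<not> x \<le> y}"
  have "?s \<in> T" using \<open>\<not> x \<le> ?s\<close> by (simp add: T_def)
  then have "T \<noteq> {}" by blast
  from finite_has_maximal[OF _ this] obtain y where y: "y \<in> T" and max: "\<forall>z\<in>T. y \<le> z \<longrightarrow> y = z"
    by auto
  have Ty: "?s \<le> y" "\<not> x \<le> y" using y by (simp_all add: T_def)
  have above: "x \<le> z" if "y < z" for z
  proof (rule ccontr)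
    assume "\<not> x \<le> z"
    then have "z \<in> T"
      using order_trans[OF Ty(1) less_imp_le[OF that]] by (simp add: T_def)
    then show False using max that by auto
  qed
  have sy: "inf a b \<le> y" "inf a c \<le> y" using Ty(1) by auto
  have a: "\<not> a \<le> y" using Ty(2) le_infI1[of a y] by (auto simp: x_def)
  have "\<not> sup b c \<le> y" using Ty(2) le_infI2[of "sup b c" y] by (auto simp: x_def)
  then have "\<not> b \<le> y \<or> \<not> c \<le> y" by auto
  then show ?thesis
    using not_2_GorensteinI[OF Ty(2) above sy(1) a] not_2_GorensteinI[OF Ty(2) above sy(2) a] by blast
qed

section \<open>Finite global dimension\<close>

lemma projective_zero_module:
  fixes M :: "('l::{finite,order} \<Rightarrow> 'l \<Rightarrow> 'k::field) fgmod"
  assumes "fg_module inc M" "carrier M = {\<zero>\<^bsub>M\<^esub>}"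
  shows "projective_module inc M"
  unfolding projective_module_def
proof (intro conjI assms allI impI ballI)
  fix X Y :: "('l \<Rightarrow> 'l \<Rightarrow> 'k) fgmod" and g f
  assume X: "fg_module inc X" and Y: "fg_module inc Y" and g: "g \<in> rmod_hom inc X Y"
    and f: "f \<in> rmod_hom inc M Y"
  interpret X: right_module inc X using X by (simp add: fg_module_def)
  interpret Y: right_module inc Y using Y by (simp add: fg_module_def)
  interpret M: right_module inc M using assms(1) by (simp add: fg_module_def)
  have "(\<lambda>_. \<zero>\<^bsub>X\<^esub>) \<in> rmod_hom inc M X"
    by (rule rmod_homI) (simp_all add: X.ract_zero)
  moreover have "g \<zero>\<^bsub>X\<^esub> = f x" if "x \<in> carrier M" for x
    using that assms(2) rmod_hom_zero[OF g X.M.abelian_group_axioms Y.M.abelian_group_axioms]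
      rmod_hom_zero[OF f M.M.abelian_group_axioms Y.M.abelian_group_axioms] by simp
  ultimately show "\<exists>h\<in>rmod_hom inc M X. \<forall>x\<in>carrier M. g (h x) = f x"
    by (intro bexI[of _ "\<lambda>_. \<zero>\<^bsub>X\<^esub>"] ballI)
qed

lemma pdim_projective:
  fixes M :: "('l::{finite,order} \<Rightarrow> 'l \<Rightarrow> 'k::field) fgmod"
  assumes "projective_module inc M"
  shows "pdim inc M \<le> enat 0"
proof -
  interpret M: right_module inc M using assms by (simp add: projective_module_def fg_module_def)
  let ?Z = "support_module (\<lambda>_ _. {}) :: ('l \<Rightarrow> 'l \<Rightarrow> 'k) fgmod"
  have Z: "convex_family (\<lambda>_ _. {} :: 'l set)" by unfold_locales auto
  interpret Z: right_module inc ?Z using convex_family.right_module_support[OF Z] .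
  have cZ: "carrier ?Z = {\<zero>\<^bsub>?Z\<^esub>}" by (auto simp: sm_carrier sm_zero fun_eq_iff)
  define P where "P = case_nat M (\<lambda>_. ?Z)"
  define d :: "nat \<Rightarrow> (nat \<Rightarrow> 'l \<Rightarrow> 'l \<Rightarrow> 'k) \<Rightarrow> nat \<Rightarrow> 'l \<Rightarrow> 'l \<Rightarrow> 'k"
    where "d = case_nat (\<lambda>_. \<zero>\<^bsub>M\<^esub>) (\<lambda>_ _. \<zero>\<^bsub>?Z\<^esub>)"
  have P: "P 0 = M" "P (Suc i) = ?Z" and d: "d 0 = (\<lambda>_. \<zero>\<^bsub>M\<^esub>)" "d (Suc i) = (\<lambda>_. \<zero>\<^bsub>?Z\<^esub>)" for i
    by (simp_all add: P_def d_def)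
  have pz: "projective_module inc ?Z"
    by (rule projective_support[OF Z]) simp
  have dh: "d i \<in> rmod_hom inc (P (Suc i)) (P i)" for i
    by (cases i; rule rmod_homI) (simp_all add: P d M.ract_zero Z.ract_zero)
  have "projective_resolution inc M P (\<lambda>x. x) d"
    unfolding projective_resolution_def
  proof (intro conjI allI dh)
    show "projective_module inc (P i)" for i
      by (cases i) (simp_all add: P assms pz)
    show "(\<lambda>x. x) \<in> rmod_hom inc (P 0) M"
      by (rule rmod_homI) (simp_all add: P)
    have "d i \<zero>\<^bsub>?Z\<^esub> = \<zero>\<^bsub>P i\<^esub>" for i
      by (cases i) (simp_all add: P d)
    then show "d (Suc i) ` carrier (P (Suc (Suc i))) = a_kernel (P (Suc i)) (P i) (d i)" for i
      by (auto simp: P(2) d(2) a_kernel_def' cZ)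
  qed (auto simp: P d a_kernel_def' cZ)
  moreover have "\<forall>i>0. carrier (P i) = {\<zero>\<^bsub>P i\<^esub>}"
    using cZ by (auto simp: P_def split: nat.splits)
  ultimately show ?thesis unfolding pdim_le_iff by blast
qed

lemma pdim_syzygy:
  fixes M P :: "'a fgmod"
  assumes P: "projective_module A P" and e: "e \<in> rmod_hom A P M" and surj: "e ` carrier P = carrier M"
    and K: "pdim A (P\<lparr>carrier := a_kernel P M e\<rparr>) \<le> enat n"
  shows "pdim A M \<le> enat (Suc n)"
proof -
  let ?K = "P\<lparr>carrier := a_kernel P M e\<rparr>"
  obtain Q \<epsilon> d where res: "projective_resolution A ?K Q \<epsilon> d" and z: "\<forall>i>n. carrier (Q i) = {\<zero>\<^bsub>Q i\<^esub>}"
    using K unfolding pdim_le_iff by blast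
  have Q: "projective_module A (Q i)" and \<epsilon>: "\<epsilon> \<in> rmod_hom A (Q 0) ?K" "\<epsilon> ` carrier (Q 0) = a_kernel P M e"
    and d: "d i \<in> rmod_hom A (Q (Suc i)) (Q i)"
    and ker0: "d 0 ` carrier (Q (Suc 0)) = a_kernel (Q 0) ?K \<epsilon>"
    and ker: "d (Suc i) ` carrier (Q (Suc (Suc i))) = a_kernel (Q (Suc i)) (Q i) (d i)" for i
    using res by (auto simp: projective_resolution_def)
  have \<epsilon>P: "\<epsilon> \<in> rmod_hom A (Q 0) P"
    using rmod_homD[OF \<epsilon>(1)] by (intro rmod_homI) (auto simp: a_kernel_def')
  define Q' where "Q' = case_nat P Q"
  define d' where "d' = case_nat \<epsilon> d"
  have Q': "Q' 0 = P" "Q' (Suc i) = Q i" and d': "d' 0 = \<epsilon>" "d' (Suc i) = d i" for i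
    by (simp_all add: Q'_def d'_def)
  have "projective_resolution A M Q' e d'"
    unfolding projective_resolution_def
  proof (intro conjI allI)
    show "projective_module A (Q' i)" for i
      using P Q by (cases i) (simp_all add: Q')
    show "d' i \<in> rmod_hom A (Q' (Suc i)) (Q' i)" for i
      using \<epsilon>P d by (cases i) (simp_all add: Q' d')
    show "d' (Suc i) ` carrier (Q' (Suc (Suc i))) = a_kernel (Q' (Suc i)) (Q' i) (d' i)" for i
      using ker0 ker by (cases i) (simp_all add: Q' d' a_kernel_def')
  qed (simp_all add: Q' d' e surj \<epsilon>(2))
  moreover have "carrier (Q' i) = {\<zero>\<^bsub>Q' i\<^esub>}" if "i > Suc n" for i
    using that z by (cases i) (simp_all add: Q')
  ultimately show ?thesis unfolding pdim_le_iff by blast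
qed

text \<open>A sum of indecomposable projectives with an explicit set of generators, so that a single
  generator can be deleted. The free module of rank \<open>k\<close> is the case where
  \<open>J\<close> is the product of \<open>{..<k}\<close> and \<open>UNIV\<close>.\<close>

definition index_family :: "(nat \<times> 'l) set \<Rightarrow> nat \<Rightarrow> 'l::{finite,order} \<Rightarrow> 'l set" where
  "index_family J n x = (if (n, x) \<in> J then {x..} else {})"

lemma convex_index_family:
  assumes "finite J"
  shows "convex_family (index_family J)"
proof
  have "{(n, x). index_family J n x \<noteq> {}} \<subseteq> J" by (auto simp: index_family_def split: if_splits)
  then show "finite {(n, x). index_family J n x \<noteq> {}}" using assms by (rule finite_subset)
next
  fix u n x w v
  assume "u \<in> index_family J n x" "w \<in> index_family J n x" "u \<le> v" "v \<le> w"
  then show "v \<in> index_family J n x" by (auto simp: index_family_def split: if_splits)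
qed

text \<open>Subtracting a multiple of the relation \<open>\<psi>\<close> eliminates the component \<open>(n0, z)\<close>.\<close>

lemma drop_generator:
  fixes M :: "('l::{finite,order} \<Rightarrow> 'l \<Rightarrow> 'k::field) fgmod"
  assumes M: "right_module inc M" and "finite J"
    and \<pi>: "\<pi> \<in> rmod_hom inc (support_module (index_family J)) M"
    and surj: "\<pi> ` carrier (support_module (index_family J)) = carrier M"
    and \<psi>: "\<psi> \<in> carrier (support_module (index_family J))" "\<pi> \<psi> = \<zero>\<^bsub>M\<^esub>"
    and conc: "\<And>n x v. v \<noteq> z \<Longrightarrow> \<psi> n x v = 0" and nz: "\<psi> n0 z z \<noteq> 0"
  shows "\<pi> \<in> rmod_hom inc (support_module (index_family (J - {(n0, z)}))) M"
    and "\<pi> ` carrier (support_module (index_family (J - {(n0, z)}))) = carrier M"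
proof -
  interpret M: right_module inc M by fact
  let ?F = "support_module (index_family J) :: ('l \<Rightarrow> 'l \<Rightarrow> 'k) fgmod"
  let ?J' = "J - {(n0, z)}"
  let ?F' = "support_module (index_family ?J') :: ('l \<Rightarrow> 'l \<Rightarrow> 'k) fgmod"
  interpret F: right_module inc ?F
    using convex_family.right_module_support[OF convex_index_family[OF \<open>finite J\<close>]] .
  have "(\<lambda>f. f) \<in> rmod_hom inc ?F' ?F"
    by (rule inclusion_hom) (auto simp: index_family_def split: if_splits)
  from rmod_hom_compose[OF this \<pi>] show hom: "\<pi> \<in> rmod_hom inc ?F' M" .
  have "m \<in> \<pi> ` carrier ?F'" if m: "m \<in> carrier M" for m
  proof -
    have "m \<in> \<pi> ` carrier ?F" using surj m by simp
    then obtain \<phi> where \<phi>: "\<phi> \<in> carrier ?F" "\<pi> \<phi> = m" by auto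
    have J0: "(n0, z) \<in> J"
      using \<psi>(1) nz by (auto simp: sm_carrier index_family_def split: if_splits)
    \<comment> \<open>Only row \<open>z\<close> matters, because \<open>\<psi>\<close> lives at
      \<open>z\<close>. The entries are chosen so that adding the multiple of \<open>\<psi>\<close>
      cancels the component \<open>(n0, z)\<close> of \<open>\<phi>\<close>, a change that
      \<open>\<pi>\<close> does not see.\<close>
    define a where "a = inc_row z (\<lambda>v. - (\<phi> n0 z v / \<psi> n0 z z))"
    have a: "a \<in> carrier (inc :: ('k, 'l \<Rightarrow> 'l \<Rightarrow> 'k) module)"
      using \<phi>(1) J0 by (auto simp: a_def inc_carrier inc_row_def sm_carrier index_family_def)
    have a\<psi>: "(a \<odot>\<^bsub>?F\<^esub> \<psi>) n x v = - (\<psi> n x z * \<phi> n0 z v / \<psi> n0 z z)" if "v \<in> index_family J n x" for n x v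
    proof -
      have "(a \<odot>\<^bsub>?F\<^esub> \<psi>) n x v = (\<Sum>u\<in>UNIV. if u = z then - (\<psi> n x z * \<phi> n0 z v / \<psi> n0 z z) else 0)"
        unfolding sm_smult if_P[OF that] by (intro sum.cong) (auto simp: a_def inc_row_def)
      then show ?thesis by simp
    qed
    let ?\<phi>' = "\<phi> \<oplus>\<^bsub>?F\<^esub> a \<odot>\<^bsub>?F\<^esub> \<psi>"
    have cl: "?\<phi>' \<in> carrier ?F" using \<phi>(1) a \<psi>(1) by (simp add: F.ract_closed)
    have van: "?\<phi>' n0 z v = 0" for v
    proof (cases "v \<in> index_family J n0 z")
      case True
      then show ?thesis using nz by (simp add: sm_add a\<psi>)
    next
      case False
      then show ?thesis using cl by (simp add: sm_carrier)
    qed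
    have "?\<phi>' n x v = 0" if "v \<notin> index_family ?J' n x" for n x v
    proof (cases "(n, x) = (n0, z)")
      case True
      then show ?thesis using van by simp
    next
      case False
      then have "v \<notin> index_family J n x" using that by (auto simp: index_family_def)
      then show ?thesis using cl unfolding sm_carrier by blast
    qed
    then have "?\<phi>' \<in> carrier ?F'" by (simp add: sm_carrier)
    moreover have "\<pi> ?\<phi>' = m"
      using rmod_homD(2)[OF \<pi> \<phi>(1) F.ract_closed[OF a \<psi>(1)]] rmod_homD(3)[OF \<pi> a \<psi>(1)] \<phi>(2) \<psi>(2) m
      by (simp add: M.ract_zero a)
    ultimately show ?thesis by (metis imageI)
  qed
  then show "\<pi> ` carrier ?F' = carrier M"
    using rmod_homD(1)[OF hom] by auto
qed

section \<open>Syzygies with shrinking support\<close>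

lemma vanishing_module:
  fixes M :: "('l::{finite,order} \<Rightarrow> 'l \<Rightarrow> 'k::field, 'm, 'e) module_scheme"
  assumes M: "right_module inc M" and m: "m \<in> carrier M"
    and 0: "\<And>x. incidence_basis x x \<odot>\<^bsub>M\<^esub> m = \<zero>\<^bsub>M\<^esub>"
  shows "m = \<zero>\<^bsub>M\<^esub>"
proof -
  interpret M: right_module inc M by fact
  let ?e = "incidence_basis :: 'l \<Rightarrow> 'l \<Rightarrow> 'l \<Rightarrow> 'l \<Rightarrow> 'k"
  have "\<one>\<^bsub>inc\<^esub> = (\<Oplus>\<^bsub>inc\<^esub>x\<in>UNIV. ?e x x)"
  proof (intro ext)
    fix u v
    have "(\<Sum>x\<in>UNIV. ?e x x u v) = (\<Sum>x\<in>UNIV. if x = u then (if u = v then 1 else 0) else 0)"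
      by (intro sum.cong) (auto simp: incidence_basis_def)
    then have "(\<Oplus>\<^bsub>inc\<^esub>x\<in>UNIV. ?e x x) u v = (if u = v then 1 else 0)"
      using finsum_inc[of UNIV "\<lambda>x. ?e x x" u v] by simp
    then show "\<one>\<^bsub>inc\<^esub> u v = (\<Oplus>\<^bsub>inc\<^esub>x\<in>UNIV. ?e x x) u v"
      by (simp add: inc_one)
  qed
  then have "m = (\<Oplus>\<^bsub>inc\<^esub>x\<in>UNIV. ?e x x) \<odot>\<^bsub>M\<^esub> m"
    using M.ract_one[OF m] by simp
  also have "\<dots> = (\<Oplus>\<^bsub>M\<^esub>x\<in>UNIV. ?e x x \<odot>\<^bsub>M\<^esub> m)"
    using m by (intro M.finsum_ract) auto
  also have "\<dots> = \<zero>\<^bsub>M\<^esub>" by (simp add: 0)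
  finally show ?thesis .
qed

text \<open>
  For a cover of \<open>M\<close> with the least number of generators, the kernel vanishes at a minimal element of \<open>U\<close>,
  so the support shrinks with each syzygy.
\<close>

lemma pdim_le_card_support:
  fixes M :: "('l::{finite,order} \<Rightarrow> 'l \<Rightarrow> 'k::field) fgmod"
  assumes "fg_module inc M" and "\<And>x y. x \<in> U \<Longrightarrow> x \<le> y \<Longrightarrow> y \<in> U"
    and "\<And>x m. x \<notin> U \<Longrightarrow> m \<in> carrier M \<Longrightarrow> incidence_basis x x \<odot>\<^bsub>M\<^esub> m = \<zero>\<^bsub>M\<^esub>"
  shows "pdim inc M \<le> enat (card U)"
  using assms
proof (induction "card U" arbitrary: U M)
  case 0
  have M: "right_module inc M" using "0.prems"(1) by (simp add: fg_module_def)
  interpret M: right_module inc M by fact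
  have "U = {}" using "0.hyps" by simp
  then have "m = \<zero>\<^bsub>M\<^esub>" if "m \<in> carrier M" for m
    by (intro vanishing_module[OF M that] "0.prems"(3)) (simp_all add: that)
  moreover have "\<zero>\<^bsub>M\<^esub> \<in> carrier M" by simp
  ultimately have "carrier M = {\<zero>\<^bsub>M\<^esub>}" by blast
  then show ?case
    using pdim_projective[OF projective_zero_module[OF "0.prems"(1)]] "0.hyps" by simp
next
  case (Suc c U M)
  let ?e = "incidence_basis :: 'l \<Rightarrow> 'l \<Rightarrow> 'l \<Rightarrow> 'l \<Rightarrow> 'k"
  have M: "right_module inc M" using Suc.prems(1) by (simp add: fg_module_def)
  interpret M: right_module inc M by fact
  have "U \<noteq> {}" using Suc.hyps(2) by auto
  then obtain x0 where x0: "x0 \<in> U" and min: "\<forall>x\<in>U. x \<le> x0 \<longrightarrow> x0 = x"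
    using finite_has_minimal[OF finite] by blast
  \<comment> \<open>A cover with the fewest generators takes the place of a projective
    cover.\<close>
  define good where "good J \<longleftrightarrow> finite J \<and> (\<exists>\<pi>\<in>rmod_hom inc (support_module (index_family J)) M.
      \<pi> ` carrier (support_module (index_family J)) = carrier M)" for J
  obtain k \<pi>0 where \<pi>0: "\<pi>0 \<in> rmod_hom inc (support_module (free_family k)) M"
    "\<pi>0 ` carrier (support_module (free_family k)) = carrier M"
    using free_cover[OF Suc.prems(1)] .
  have "index_family ({..<k} \<times> UNIV) = (free_family k :: nat \<Rightarrow> 'l \<Rightarrow> 'l set)"
    by (intro ext) (simp add: index_family_def free_family_def)
  then have "good ({..<k} \<times> UNIV)"
    using \<pi>0 by (auto simp: good_def)
  then obtain J where J: "good J" and least: "\<And>J'. good J' \<Longrightarrow> card J \<le> card J'"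
    using ex_has_least_nat[of good _ card] by blast
  have fin: "finite J" using J by (simp add: good_def)
  let ?F = "support_module (index_family J) :: ('l \<Rightarrow> 'l \<Rightarrow> 'k) fgmod"
  obtain \<pi> where \<pi>: "\<pi> \<in> rmod_hom inc ?F M" and surj: "\<pi> ` carrier ?F = carrier M"
    using J by (auto simp: good_def)
  have conv: "convex_family (index_family J)" by (rule convex_index_family[OF fin])
  interpret F: right_module inc ?F by (rule convex_family.right_module_support[OF conv])
  have no_relation: "\<psi> n z z = 0"
    if "\<psi> \<in> carrier ?F" "\<pi> \<psi> = \<zero>\<^bsub>M\<^esub>" "\<And>n x v. v \<noteq> z \<Longrightarrow> \<psi> n x v = 0" for \<psi> n z
  proof (rule ccontr)
    assume nz: "\<psi> n z z \<noteq> 0"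
    then have "(n, z) \<in> J"
      using that(1) by (auto simp: sm_carrier index_family_def split: if_splits)
    moreover have "good (J - {(n, z)})"
      unfolding good_def using drop_generator[OF M fin \<pi> surj that nz] fin by blast
    ultimately show False
      using least[of "J - {(n, z)}"] card_Diff1_less[OF fin] by fastforce
  qed
  \<comment> \<open>A generator at a vertex outside \<open>U\<close> is sent to zero, so it would
    itself be a relation with coefficient one.\<close>
  have JU: "x \<in> U" if "(n, x) \<in> J" for n x
  proof (rule ccontr)
    assume x: "x \<notin> U"
    define b :: "nat \<Rightarrow> 'l \<Rightarrow> 'l \<Rightarrow> 'k" where "b = (\<lambda>n' x' v. if n' = n \<and> x' = x \<and> v = x then 1 else 0)"
    have b: "b \<in> carrier ?F" using that by (auto simp: b_def sm_carrier index_family_def)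
    have "?e x x \<odot>\<^bsub>?F\<^esub> b = b"
      using that by (intro ext) (auto simp: sm_basis_smult b_def index_family_def)
    then have "\<pi> b = ?e x x \<odot>\<^bsub>M\<^esub> \<pi> b"
      using rmod_homD(3)[OF \<pi> _ b, of "?e x x"] by simp
    also have "\<dots> = \<zero>\<^bsub>M\<^esub>"
      using Suc.prems(3)[OF x] rmod_homD(1)[OF \<pi> b] by simp
    finally have "\<pi> b = \<zero>\<^bsub>M\<^esub>" .
    from no_relation[OF b this, of x n] have "b n x x = 0"
      by (simp add: b_def)
    then show False by (simp add: b_def)
  qed
  define K where "K = ?F\<lparr>carrier := a_kernel ?F M \<pi>\<rparr>"
  have fgK: "fg_module inc K"
    unfolding K_def by (rule fg_support_submodule[OF conv submodule_kernel[OF F.right_module_axioms M \<pi>]])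
  have "pdim inc K \<le> enat (card (U - {x0}))"
  proof (rule Suc.hyps(1))
    show "c = card (U - {x0})" using Suc.hyps(2) x0 by simp
    show "y \<in> U - {x0}" if "x \<in> U - {x0}" "x \<le> y" for x y
      using that Suc.prems(2)[of x y] min by auto
    fix z \<phi> assume z: "z \<notin> U - {x0}" and "\<phi> \<in> carrier K"
    then have \<phi>: "\<phi> \<in> carrier ?F" "\<pi> \<phi> = \<zero>\<^bsub>M\<^esub>" by (simp_all add: K_def a_kernel_def')
    let ?\<psi> = "?e z z \<odot>\<^bsub>?F\<^esub> \<phi>"
    have \<psi>: "?\<psi> \<in> carrier ?F" "\<pi> ?\<psi> = \<zero>\<^bsub>M\<^esub>"
      using \<phi> rmod_homD(3)[OF \<pi> _ \<phi>(1), of "?e z z"] by (simp_all add: F.ract_closed M.ract_zero)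
    have conc: "?\<psi> n x v = 0" if "v \<noteq> z" for n x v using that by (simp add: sm_basis_smult)
    \<comment> \<open>Outside the up-closed set \<open>U\<close> no generator lies below
      \<open>z\<close>. At \<open>z = x0\<close> minimality leaves only generators placed at
      \<open>x0\<close> itself, and their coefficients vanish by \<open>no_relation\<close>.\<close>
    have "?\<psi> n x v = 0" for n x v
    proof (rule ccontr)
      assume nz: "?\<psi> n x v \<noteq> 0"
      then have v: "v = z" using conc by blast
      then have "(n, x) \<in> J" "x \<le> z"
        using nz \<psi>(1) by (auto simp: sm_carrier index_family_def split: if_splits)
      then have "x \<in> U" "z \<in> U" using JU Suc.prems(2) by blast+
      then have "z = x0" using z by simp
      then have "x = z" using min \<open>x \<in> U\<close> \<open>x \<le> z\<close> by auto
      moreover have "?\<psi> n z z = 0" by (rule no_relation[OF \<psi> conc])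
      ultimately show False using nz v by simp
    qed
    then have "?\<psi> = \<zero>\<^bsub>?F\<^esub>" by (simp add: sm_zero fun_eq_iff)
    then show "?e z z \<odot>\<^bsub>K\<^esub> \<phi> = \<zero>\<^bsub>K\<^esub>" by (simp add: K_def)
  qed (simp_all add: fgK)
  then have "pdim inc M \<le> enat (Suc (card (U - {x0})))"
    unfolding K_def
    by (intro pdim_syzygy[OF projective_support[OF conv] \<pi> surj]) (auto simp: index_family_def)
  then show ?case
    by (simp only: card_Suc_Diff1[OF finite x0])
qed

lemma gldim_incidence_algebra_finite:
  "gldim (inc :: ('k::field, 'l::{finite,order} \<Rightarrow> 'l \<Rightarrow> 'k) module) < \<infinity>"
proof -
  have "gldim (inc :: ('k, 'l \<Rightarrow> 'l \<Rightarrow> 'k) module) \<le> enat (card (UNIV :: 'l set))"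
    unfolding gldim_def
  proof (rule Sup_least, safe)
    fix M :: "('l \<Rightarrow> 'l \<Rightarrow> 'k) fgmod" assume "fg_module inc M"
    then show "pdim inc M \<le> enat (card (UNIV :: 'l set))"
      by (rule pdim_le_card_support) auto
  qed
  then show ?thesis by (rule order_le_less_trans) simp
qed

section \<open>The Koszul complex of a finite set\<close>

text \<open>Serves two purposes: it orders a finite type, which fixes the signs of the Koszul
  complex, and it codes sets and pairs of sets as component numbers.\<close>

definition enc :: "'a::finite \<Rightarrow> nat" where
  "enc = (SOME f. inj f)"

lemma inj_enc: "inj (enc :: 'a::finite \<Rightarrow> nat)"
proof -
  have "\<exists>f :: 'a \<Rightarrow> nat. inj f" using finite_imp_inj_to_nat_seg[OF finite[of UNIV]] by blast
  then show ?thesis unfolding enc_def by (rule someI_ex)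
qed

lemma enc_eq [simp]: "enc a = enc b \<longleftrightarrow> a = b"
  using inj_enc by (rule inj_eq)

text \<open>The simplicial sign: the parity of the number of elements of \<open>T\<close> that
  precede \<open>t\<close> in the order given by \<open>enc\<close>.\<close>

definition ksgn :: "'a::finite \<Rightarrow> 'a set \<Rightarrow> 'k::field" where
  "ksgn t T = (- 1) ^ card {s \<in> T. enc s < enc t}"

lemma ksgn_sq [simp]: "ksgn t T * ksgn t T = 1"
  by (simp add: ksgn_def flip: power_mult_distrib)

lemma ksgn_singleton [simp]: "ksgn t {t} = 1"
proof -
  have *: "{s \<in> {t}. enc s < enc t} = {}" by auto
  show ?thesis unfolding ksgn_def * by simp
qed

lemma ksgn_remove:
  assumes "s \<in> T"
  shows "ksgn t (T - {s}) = (if enc s < enc t then - ksgn t T else (ksgn t T :: 'k::field))"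
proof -
  have *: "{r \<in> T - {s}. enc r < enc t} = {r \<in> T. enc r < enc t} - {s}" by auto
  show ?thesis
  proof (cases "enc s < enc t")
    case True
    then have "card {r \<in> T. enc r < enc t} = Suc (card ({r \<in> T. enc r < enc t} - {s}))"
      using assms by (intro card.remove) auto
    then show ?thesis using True unfolding ksgn_def * by simp
  next
    case False
    then have "{r \<in> T - {s}. enc r < enc t} = {r \<in> T. enc r < enc t}" by auto
    then show ?thesis using False by (simp only: ksgn_def if_False)
  qed
qed

text \<open>Removing the smaller of two elements shifts the position of the larger one, but not
  conversely; so exactly one sign changes. This form serves for the square of \<open>kd\<close>, the
  following variant for the homotopy.\<close>

lemma ksgn_anticommute:
  assumes "s \<in> T" "t \<in> T" "s \<noteq> t"
  shows "ksgn t T * ksgn s (T - {t}) = - (ksgn s T * ksgn t (T - {s}) :: 'k::field)"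
proof -
  have "enc s \<noteq> enc t" using assms(3) by simp
  then show ?thesis
    using assms by (auto simp: ksgn_remove mult.commute)
qed

lemma ksgn_anticommute':
  assumes "s \<in> T" "t \<in> T" "s \<noteq> t"
  shows "ksgn t (T - {s}) * ksgn s (T - {t}) = - (ksgn s T * ksgn t T :: 'k::field)"
proof -
  have "enc s \<noteq> enc t" using assms(3) by simp
  then show ?thesis
    using assms by (auto simp: ksgn_remove mult.commute)
qed

text \<open>The coboundary of the full simplex on the type, on cochains of all degrees at once and
  with the empty face included.\<close>

definition kd :: "('a::finite set \<Rightarrow> 'k::field) \<Rightarrow> 'a set \<Rightarrow> 'k" where
  "kd \<phi> T = (\<Sum>t\<in>T. ksgn t T * \<phi> (T - {t}))"

text \<open>The cone contraction of the simplex towards its vertex \<open>s\<close>.\<close>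

definition kh :: "'a::finite \<Rightarrow> ('a set \<Rightarrow> 'k::field) \<Rightarrow> 'a set \<Rightarrow> 'k" where
  "kh s \<phi> T = (if s \<in> T then 0 else ksgn s (insert s T) * \<phi> (insert s T))"

lemma kd_kd: "kd (kd \<phi>) T = (0 :: 'k::field)"
proof -
  define c where "c t s = ksgn t T * (ksgn s (T - {t}) * \<phi> (T - {t} - {s}))" for t s
  have anti: "c t s = - c s t" if "s \<in> T" "t \<in> T" "s \<noteq> t" for s t
  proof -
    have "T - {t} - {s} = T - {s} - {t}" by auto
    then show ?thesis
      using ksgn_anticommute[OF that, where 'k = 'k] by (simp add: c_def flip: mult.assoc)
  qed
  \<comment> \<open>Antisymmetry alone would only show that twice the sum is zero, which is void in
    characteristic two. Hence each unordered pair is taken once, in the order given by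
    \<open>enc\<close>.\<close>
  let ?X = "\<Sum>t\<in>T. \<Sum>s\<in>T. if enc s < enc t then c t s else 0"
  have "kd (kd \<phi>) T = (\<Sum>t\<in>T. \<Sum>s\<in>T - {t}. c t s)"
    by (simp add: kd_def c_def sum_distrib_left)
  also have "\<dots> = (\<Sum>t\<in>T. \<Sum>s\<in>T. (if enc s < enc t then c t s else 0) + (if enc t < enc s then c t s else 0))"
  proof (rule sum.cong[OF refl])
    fix t
    have "(\<Sum>s\<in>T - {t}. c t s) = (\<Sum>s\<in>T. if s = t then 0 else c t s)"
      by (intro sum.mono_neutral_cong_left) auto
    also have "\<dots> = (\<Sum>s\<in>T. (if enc s < enc t then c t s else 0) + (if enc t < enc s then c t s else 0))"
    proof (intro sum.cong refl)
      fix s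
      show "(if s = t then 0 else c t s) = (if enc s < enc t then c t s else 0) + (if enc t < enc s then c t s else 0)"
        using enc_eq[of s t] by (cases "enc s" "enc t" rule: linorder_cases) auto
    qed
    finally show "(\<Sum>s\<in>T - {t}. c t s) = (\<Sum>s\<in>T. (if enc s < enc t then c t s else 0) + (if enc t < enc s then c t s else 0))" .
  qed
  also have "\<dots> = ?X + (\<Sum>t\<in>T. \<Sum>s\<in>T. if enc t < enc s then c t s else 0)"
    by (simp add: sum.distrib)
  also have "(\<Sum>t\<in>T. \<Sum>s\<in>T. if enc t < enc s then c t s else 0) = (\<Sum>t\<in>T. \<Sum>s\<in>T. if enc s < enc t then c s t else 0)"
    by (rule sum.swap)
  also have "\<dots> = (\<Sum>t\<in>T. \<Sum>s\<in>T. - (if enc s < enc t then c t s else 0))"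
  proof (intro sum.cong refl)
    fix t s assume "t \<in> T" "s \<in> T"
    then show "(if enc s < enc t then c s t else 0) = - (if enc s < enc t then c t s else 0)"
      using anti[of t s] by (cases "s = t") auto
  qed
  also have "\<dots> = - ?X" by (simp add: sum_negf)
  finally show ?thesis by simp
qed

text \<open>The homotopy between the identity and zero, behind the exactness of both Koszul
  complexes. At \<open>T\<close> it involves \<open>kd \<phi>\<close> only on
  \<open>insert s T\<close>, so the cocycle condition is needed at that one set.\<close>

lemma kd_kh: "kd (kh s \<phi>) T + kh s (kd \<phi>) T = (\<phi> T :: 'k::field)"
proof (cases "s \<in> T")
  case True
  then have ins: "insert s (T - {s}) = T" by auto
  have "kd (kh s \<phi>) T = (\<Sum>t\<in>T. if t = s then \<phi> T else 0)"
    unfolding kd_def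
  proof (intro sum.cong refl)
    fix t assume "t \<in> T"
    show "ksgn t T * kh s \<phi> (T - {t}) = (if t = s then \<phi> T else 0)"
      using True by (auto simp: kh_def insert_absorb simp flip: mult.assoc)
  qed
  then show ?thesis using True by (simp add: kh_def)
next
  case False
  let ?S = "insert s T"
  have rem: "?S - {s} = T" using False by auto
  have "kh s (kd \<phi>) T = ksgn s ?S * (ksgn s ?S * \<phi> T + (\<Sum>t\<in>T. ksgn t ?S * \<phi> (?S - {t})))"
    using False by (simp add: kh_def kd_def rem)
  also have "\<dots> = \<phi> T + (\<Sum>t\<in>T. ksgn s ?S * ksgn t ?S * \<phi> (?S - {t}))"
    by (simp add: distrib_left sum_distrib_left flip: mult.assoc)
  finally have 1: "kh s (kd \<phi>) T = \<phi> T + (\<Sum>t\<in>T. ksgn s ?S * ksgn t ?S * \<phi> (?S - {t}))" .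
  have "kd (kh s \<phi>) T = (\<Sum>t\<in>T. - (ksgn s ?S * ksgn t ?S * \<phi> (?S - {t})))"
    unfolding kd_def
  proof (intro sum.cong refl)
    fix t assume t: "t \<in> T"
    then have "s \<noteq> t" and ins: "insert s (T - {t}) = ?S - {t}" using False by auto
    then have "ksgn t (?S - {s}) * ksgn s (?S - {t}) = - (ksgn s ?S * ksgn t ?S :: 'k)"
      using t by (intro ksgn_anticommute') auto
    then show "ksgn t T * kh s \<phi> (T - {t}) = - (ksgn s ?S * ksgn t ?S * \<phi> (?S - {t}))"
      using False unfolding kh_def ins rem by (simp flip: mult.assoc)
  qed
  then show ?thesis by (simp add: 1 sum_negf)
qed

section \<open>Support modules with coded components\<close>

text \<open>
  Components of support modules are numbered; \<open>coded P\<close> transports a family indexed by an arbitrary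
  finite type along \<open>enc\<close>.
\<close>

definition coded :: "('a::finite \<Rightarrow> 'l \<Rightarrow> 'l \<Rightarrow> bool) \<Rightarrow> nat \<Rightarrow> 'l \<Rightarrow> 'l set" where
  "coded P n x = {v. \<exists>T. n = enc T \<and> P T x v}"

text \<open>Numbers that code nothing get the value zero, as membership in a support module over
  \<open>coded P\<close> demands.\<close>

definition on_code :: "('a::finite \<Rightarrow> 'l \<Rightarrow> 'l \<Rightarrow> 'k::field) \<Rightarrow> nat \<Rightarrow> 'l \<Rightarrow> 'l \<Rightarrow> 'k" where
  "on_code F n = (if n \<in> range (enc :: 'a \<Rightarrow> nat) then F (inv_into UNIV enc n) else (\<lambda>_ _. 0))"

lemma coded_enc [simp]: "v \<in> coded P (enc T) x \<longleftrightarrow> P T x v"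
  by (auto simp: coded_def)

lemma on_code_enc [simp]: "on_code F (enc T) = F T"
  by (simp add: on_code_def inv_f_f[OF inj_enc])

lemma coded_carrier:
  "f \<in> carrier (support_module (coded P)) \<longleftrightarrow>
    (\<forall>T x v. \<not> P T x v \<longrightarrow> f (enc T) x v = 0) \<and> (\<forall>n. n \<notin> range (enc :: 'a \<Rightarrow> nat) \<longrightarrow> f n = (\<lambda>_ _. 0))"
  for P :: "'a::finite \<Rightarrow> 'l::{finite,order} \<Rightarrow> 'l \<Rightarrow> bool"
  unfolding sm_carrier
proof (intro iffI conjI allI impI)
  fix n x v assume "(\<forall>T x v. \<not> P T x v \<longrightarrow> f (enc T) x v = 0) \<and> (\<forall>n. n \<notin> range (enc :: 'a \<Rightarrow> nat) \<longrightarrow> f n = (\<lambda>_ _. 0))"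
    and "v \<notin> coded P n x"
  then show "f n x v = 0" by (cases "n \<in> range (enc :: 'a \<Rightarrow> nat)") auto
next
  fix n assume f: "\<forall>n x v. v \<notin> coded P n x \<longrightarrow> f n x v = 0" and n: "n \<notin> range (enc :: 'a \<Rightarrow> nat)"
  have "v \<notin> coded P n x" for x v using n by (auto simp: coded_def)
  then show "f n = (\<lambda>_ _. 0)" using f by (intro ext) simp
qed simp

lemma coded_eqI:
  fixes P :: "'a::finite \<Rightarrow> 'l::{finite,order} \<Rightarrow> 'l \<Rightarrow> bool"
  assumes "f \<in> carrier (support_module (coded P))" "g \<in> carrier (support_module (coded P))"
    and "\<And>T x v. P T x v \<Longrightarrow> f (enc T) x v = g (enc T) x v"
  shows "f = g"
proof (intro ext)
  fix n x v
  show "f n x v = g n x v"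
  proof (cases "v \<in> coded P n x")
    case True
    then show ?thesis using assms(3) by (auto simp: coded_def)
  next
    case False
    then show ?thesis using assms(1,2) by (simp add: sm_carrier)
  qed
qed

lemma on_code_closed:
  assumes "\<And>T x v. \<not> P T x v \<Longrightarrow> F T x v = 0"
  shows "on_code F \<in> carrier (support_module (coded P))"
  using assms by (auto simp: coded_carrier on_code_def inv_f_f[OF inj_enc])

lemma convex_coded:
  fixes P :: "'a::finite \<Rightarrow> 'l::{finite,order} \<Rightarrow> 'l \<Rightarrow> bool"
  assumes "\<And>T x u v w. P T x u \<Longrightarrow> P T x w \<Longrightarrow> u \<le> v \<Longrightarrow> v \<le> w \<Longrightarrow> P T x v"
  shows "convex_family (coded P)"
proof
  have "{(n, x). coded P n x \<noteq> {}} \<subseteq> range (enc :: 'a \<Rightarrow> nat) \<times> UNIV" by (auto simp: coded_def)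
  then show "finite {(n, x). coded P n x \<noteq> {}}" by (rule finite_subset) simp
next
  fix u n x w v assume u: "u \<in> coded P n x" and w: "w \<in> coded P n x" and "u \<le> v" "v \<le> w"
  from u obtain T where T: "n = enc T" "P T x u" by (auto simp: coded_def)
  then show "v \<in> coded P n x"
    using w assms[OF T(2) _ \<open>u \<le> v\<close> \<open>v \<le> w\<close>] by simp
qed

lemma coded_cases:
  fixes P :: "'a::finite \<Rightarrow> 'l \<Rightarrow> 'l \<Rightarrow> bool"
  assumes "\<And>T x. R {v. P T x v}" "R {}"
  shows "R (coded P n x)"
proof (cases "n \<in> range (enc :: 'a \<Rightarrow> nat)")
  case True
  then obtain T :: 'a where "n = enc T" by auto
  then have "coded P n x = {v. P T x v}" by auto
  then show ?thesis using assms(1) by simp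
next
  case False
  then have "coded P n x = {}" by (auto simp: coded_def)
  then show ?thesis using assms(2) by simp
qed

text \<open>The common source of differentials and augmentations. Both hypotheses consider a
  transition from \<open>u\<close> to \<open>v\<close> with the source component alive at
  \<open>u\<close> and the target alive at \<open>v\<close>: naturality then requires the source to
  be alive at \<open>v\<close> and the target at \<open>u\<close>.\<close>

lemma coded_hom:
  fixes P :: "'a::finite \<Rightarrow> 'l::{finite,order} \<Rightarrow> 'l \<Rightarrow> bool" and Q :: "'b::finite \<Rightarrow> 'l \<Rightarrow> 'l \<Rightarrow> bool"
    and c :: "'b \<Rightarrow> 'i \<Rightarrow> 'k::field"
  assumes PP: "\<And>T i x u v. Q T x v \<Longrightarrow> i \<in> N T \<Longrightarrow> u \<le> v \<Longrightarrow> P (s T i) x u \<Longrightarrow> P (s T i) x v"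
    and PQ: "\<And>T i x u v. Q T x v \<Longrightarrow> i \<in> N T \<Longrightarrow> u \<le> v \<Longrightarrow> P (s T i) x u \<Longrightarrow> Q T x u"
  shows "(\<lambda>f. on_code (\<lambda>T x v. if Q T x v then \<Sum>i\<in>N T. c T i * f (enc (s T i)) x v else 0))
    \<in> rmod_hom inc (support_module (coded P)) (support_module (coded Q))"
proof (rule rmod_homI)
  let ?H = "\<lambda>f. on_code (\<lambda>T x v. if Q T x v then \<Sum>i\<in>N T. c T i * f (enc (s T i)) x v else 0)"
  show H: "?H f \<in> carrier (support_module (coded Q))" for f
    by (rule on_code_closed) simp
  show "?H (f \<oplus>\<^bsub>support_module (coded P)\<^esub> g) = ?H f \<oplus>\<^bsub>support_module (coded Q)\<^esub> ?H g" for f g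
    by (intro ext) (simp add: sm_add on_code_def distrib_left sum.distrib)
  fix a f assume a: "a \<in> carrier (inc :: ('k, 'l \<Rightarrow> 'l \<Rightarrow> 'k) module)"
    and f: "f \<in> carrier (support_module (coded P) :: ('l \<Rightarrow> 'l \<Rightarrow> 'k) fgmod)"
  show "?H (a \<odot>\<^bsub>support_module (coded P)\<^esub> f) = a \<odot>\<^bsub>support_module (coded Q)\<^esub> ?H f"
  proof (rule coded_eqI[OF H])
    show "a \<odot>\<^bsub>support_module (coded Q)\<^esub> ?H f \<in> carrier (support_module (coded Q))"
      by (simp add: sm_carrier sm_smult)
    fix T x v assume Q: "Q T x v"
    have L: "(a \<odot>\<^bsub>support_module (coded P)\<^esub> f) (enc (s T i)) x v = (\<Sum>u\<in>UNIV. f (enc (s T i)) x u * a u v)"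
      if i: "i \<in> N T" for i
    proof (cases "P (s T i) x v")
      case True
      then show ?thesis by (simp add: sm_smult)
    next
      case False
      have "f (enc (s T i)) x u * a u v = 0" for u
      proof (cases "u \<le> v \<and> P (s T i) x u")
        case True
        then show ?thesis using PP[OF Q i, of u] False by blast
      next
        case False
        then show ?thesis using a f by (auto simp: inc_carrier coded_carrier)
      qed
      then show ?thesis using False by (simp add: sm_smult del: mult_eq_0_iff)
    qed
    have R: "?H f (enc T) x u * a u v = (\<Sum>i\<in>N T. c T i * (f (enc (s T i)) x u * a u v))" for u
    proof (cases "Q T x u \<or> \<not> u \<le> v")
      case True
      then show ?thesis using a by (auto simp: inc_carrier sum_distrib_right mult.assoc)
    next
      case False
      have "f (enc (s T i)) x u = 0" if "i \<in> N T" for i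
        using f PQ[OF Q that, of u] False by (auto simp: coded_carrier)
      then show ?thesis using False by simp
    qed
    have "?H (a \<odot>\<^bsub>support_module (coded P)\<^esub> f) (enc T) x v
        = (\<Sum>i\<in>N T. \<Sum>u\<in>UNIV. c T i * (f (enc (s T i)) x u * a u v))"
      using Q by (simp add: L sum_distrib_left)
    also have "\<dots> = (\<Sum>u\<in>UNIV. ?H f (enc T) x u * a u v)"
      unfolding R by (rule sum.swap)
    also have "\<dots> = (a \<odot>\<^bsub>support_module (coded Q)\<^esub> ?H f) (enc T) x v"
      unfolding sm_smult using Q by (simp only: coded_enc if_True)
    finally show "?H (a \<odot>\<^bsub>support_module (coded P)\<^esub> f) (enc T) x v = (a \<odot>\<^bsub>support_module (coded Q)\<^esub> ?H f) (enc T) x v" .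
  qed
qed

text \<open>Cut a vector of \<open>V\<close> down to a maximal vertex \<open>v\<close> of the
  support of \<open>V\<close>: each transition out of \<open>v\<close> leaves that support and gives
  zero. So only components with nothing above \<open>v\<close> contribute.\<close>

lemma socle_element:
  fixes C :: "nat \<Rightarrow> 'l::{finite,order} \<Rightarrow> 'l set"
  assumes "convex_family C" and V: "submodule V inc (support_module C :: ('l \<Rightarrow> 'l \<Rightarrow> 'k::field) fgmod)"
    and nz: "V \<noteq> {\<zero>\<^bsub>support_module C\<^esub>}"
  obtains g v where "g \<in> V" "g \<noteq> \<zero>\<^bsub>support_module C\<^esub>"
    "\<forall>n x u. u \<noteq> v \<longrightarrow> g n x u = 0" "\<forall>n x z. v < z \<longrightarrow> z \<in> C n x \<longrightarrow> g n x v = 0"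
proof -
  interpret right_module inc "support_module C :: ('l \<Rightarrow> 'l \<Rightarrow> 'k) fgmod"
    by (rule convex_family.right_module_support[OF assms(1)])
  note V' = right_submoduleD[OF V]
  let ?e = "incidence_basis :: 'l \<Rightarrow> 'l \<Rightarrow> 'l \<Rightarrow> 'l \<Rightarrow> 'k"
  define W where "W = {v. \<exists>f\<in>V. \<exists>n x. f n x v \<noteq> 0}"
  have "\<exists>f\<in>V. f \<noteq> \<zero>\<^bsub>support_module C\<^esub>" using nz V'(2) by blast
  then have "W \<noteq> {}" by (auto simp: W_def sm_zero fun_eq_iff)
  from finite_has_maximal[OF finite this] obtain v where v: "v \<in> W" and max: "\<forall>z\<in>W. v \<le> z \<longrightarrow> v = z"
    by auto
  obtain f n x where f: "f \<in> V" "f n x v \<noteq> 0" using v by (auto simp: W_def)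
  have fC: "f \<in> carrier (support_module C)" using f(1) V'(1) by auto
  define g where "g = ?e v v \<odot>\<^bsub>support_module C\<^esub> f"
  have g: "g m y u = (if u = v then f m y v else 0)" for m y u
    using fC by (auto simp: g_def sm_basis_smult sm_carrier)
  have gV: "g \<in> V" unfolding g_def using f(1) by (intro V'(4)) auto
  have "g n x v \<noteq> 0" using f(2) by (simp add: g)
  then have "g \<noteq> \<zero>\<^bsub>support_module C\<^esub>" by (auto simp: sm_zero)
  moreover have "g m y v = 0" if "v < z" "z \<in> C m y" for m y z
  proof (rule ccontr)
    assume "g m y v \<noteq> 0"
    moreover have "(?e v z \<odot>\<^bsub>support_module C\<^esub> g) m y z = g m y v"
      using that(2) by (simp add: sm_basis_smult)
    moreover have "?e v z \<odot>\<^bsub>support_module C\<^esub> g \<in> V"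
      using gV that(1) by (intro V'(4)) (auto simp: less_imp_le)
    ultimately have "z \<in> W" unfolding W_def by (metis (mono_tags, lifting) mem_Collect_eq)
    then show False using max that(1) by auto
  qed
  ultimately show ?thesis using that[of g v] gV g by auto
qed

section \<open>The Koszul coresolution of the regular module\<close>

text \<open>The quotient of the constant representation by \<open>P x\<close> lives on the elements
  not above \<open>x\<close>; these vertices carry its socle and therefore index the term of degree
  one.\<close>

definition max_not_above :: "'l::{finite,lattice} \<Rightarrow> 'l set" where
  "max_not_above x = {y. \<not> x \<le> y \<and> (\<forall>z. y < z \<longrightarrow> x \<le> z)}"

lemma max_not_above_exists:
  assumes "\<not> x \<le> v"
  obtains y where "y \<in> max_not_above x" "v \<le> y"
proof -
  define T where "T = {y. v \<le> y \<and> \<not> x \<le> y}"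
  have "v \<in> T" using assms by (simp add: T_def)
  then have "T \<noteq> {}" by blast
  from finite_has_maximal[OF finite this] obtain y where y: "y \<in> T" and max: "\<forall>z\<in>T. y \<le> z \<longrightarrow> y = z"
    by auto
  have "x \<le> z" if "y < z" for z
  proof (rule ccontr)
    assume "\<not> x \<le> z"
    then have "z \<in> T" using y that order.strict_implies_order[OF that] order.trans[of v y z] by (simp add: T_def)
    then show False using max that by auto
  qed
  then show ?thesis using that[of y] y by (simp add: T_def max_not_above_def)
qed

section \<open>Meet primes, principal down-sets and principal up-sets\<close>

lemma max_not_above_antichain:
  assumes "y \<in> max_not_above x" "z \<in> max_not_above x" "y \<le> z"
  shows "y = z"
proof (rule ccontr)
  assume "y \<noteq> z"
  then have "y < z" using assms(3) by simp
  then show False using assms(1,2) by (auto simp: max_not_above_def)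
qed

text \<open>Joining \<open>y\<close> with an element not below it goes strictly above
  \<open>y\<close>, hence reaches \<open>x\<close>. By distributivity the meet of two such joins is
  \<open>y\<close> itself, which does not lie above \<open>x\<close>.\<close>

lemma max_not_above_prime:
  fixes x y :: "'l::{finite,lattice}"
  assumes "class.distrib_lattice (inf :: 'l \<Rightarrow> 'l \<Rightarrow> 'l) (\<le>) (<) sup"
    and y: "y \<in> max_not_above x" and ab: "inf a b \<le> y"
  shows "a \<le> y \<or> b \<le> y"
proof (rule ccontr)
  assume "\<not> ?thesis"
  moreover have "y < sup y c" if "\<not> c \<le> y" for c
    using that by (metis less_le sup.cobounded1 sup.cobounded2)
  ultimately have "x \<le> inf (sup y a) (sup y b)" using y by (simp add: max_not_above_def)
  also have "\<dots> = sup y (inf a b)"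
    by (rule distrib_lattice.sup_inf_distrib1[OF assms(1), symmetric])
  also have "\<dots> = y" using ab by (simp add: sup.absorb1)
  finally show False using y by (simp add: max_not_above_def)
qed

text \<open>Induction with binary primality. The meet of \<open>T\<close> enters through its lower
  bounds, so that the empty set is included; there \<open>top\<close> gives the
  contradiction.\<close>

lemma lower_bounds_prime:
  fixes t0 :: "'l::{finite,lattice}"
  assumes prime: "\<And>a b. inf a b \<le> t0 \<Longrightarrow> a \<le> t0 \<or> b \<le> t0" and top: "\<exists>w. \<not> w \<le> t0"
    and "\<And>w. (\<forall>t\<in>T. w \<le> t) \<Longrightarrow> w \<le> t0"
  shows "\<exists>t\<in>T. t \<le> t0"
  using finite[of T] assms(3)
proof (induction T rule: finite_induct)
  case empty
  then show ?case using top by auto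
next
  case (insert a T)
  show ?case
  proof (cases "a \<le> t0")
    case False
    have "w \<le> t0" if "\<forall>t\<in>T. w \<le> t" for w
    proof -
      have "\<forall>t\<in>insert a T. inf a w \<le> t" using that by (auto intro: le_infI2)
      then have "inf a w \<le> t0" by (rule insert.prems)
      then show ?thesis using prime False by blast
    qed
    then show ?thesis using insert.IH by blast
  qed simp
qed

lemma lower_bounds_principal:
  obtains p :: "'l::{finite,lattice}" where "{v. \<forall>t\<in>T. v \<le> t} = {..p}"
proof -
  have "\<exists>p :: 'l. {v. \<forall>t\<in>T. v \<le> t} = {..p}"
    using finite[of T]
  proof (induction T rule: finite_induct)
    case empty
    obtain t :: 'l where "\<And>v. v \<le> t" by (rule finite_lattice_top) blast
    then have "{v :: 'l. \<forall>t\<in>{}. v \<le> t} = {..t}" by auto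
    then show ?case by (rule exI)
  next
    case (insert a T)
    then obtain p where p: "{v. \<forall>t\<in>T. v \<le> t} = {..p}" by auto
    have "{v. \<forall>t\<in>insert a T. v \<le> t} = {v. v \<le> a} \<inter> {v. \<forall>t\<in>T. v \<le> t}" by auto
    also have "\<dots> = {..inf a p}" unfolding p by auto
    finally show ?case by (rule exI)
  qed
  then show ?thesis using that by blast
qed

text \<open>Primality says that the complement of the down-set is closed under binary meets, so a
  minimal element of it is the least one.\<close>

lemma prime_complement_principal:
  fixes t :: "'l::{finite,lattice}"
  assumes prime: "\<And>a b. inf a b \<le> t \<Longrightarrow> a \<le> t \<or> b \<le> t" and ne: "\<not> w \<le> t"
  obtains p where "{v. \<not> v \<le> t} = {p..}"
proof -
  have "{v. \<not> v \<le> t} \<noteq> {}" using ne by auto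
  from finite_has_minimal[OF finite this] obtain p where p: "p \<in> {v. \<not> v \<le> t}"
    and min: "\<forall>z\<in>{v. \<not> v \<le> t}. z \<le> p \<longrightarrow> p = z"
    by auto
  have "p \<le> v" if "\<not> v \<le> t" for v
  proof -
    have "inf p v \<in> {v. \<not> v \<le> t}" using prime[of p v] p that by auto
    then have "p = inf p v" using min by auto
    then show ?thesis by (metis inf.cobounded2)
  qed
  moreover have "\<not> v \<le> t" if "p \<le> v" for v
    using p that order.trans by auto
  ultimately have "{v. \<not> v \<le> t} = {p..}" by auto
  then show ?thesis by (rule that)
qed

text \<open>Principal up-sets intersect in the principal up-set of the join. This is what makes the
  terms of the second Koszul complex projective.\<close>

lemma avoiding_principal:
  fixes T :: "'l::{finite,lattice} set"
  assumes "class.distrib_lattice (inf :: 'l \<Rightarrow> 'l \<Rightarrow> 'l) (\<le>) (<) sup" "T \<subseteq> max_not_above x"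
  shows "\<exists>p. {v. \<forall>t\<in>T. \<not> v \<le> t} = {p..}"
  using finite[of T] assms(2)
proof (induction T rule: finite_induct)
  case empty
  obtain b :: 'l where "\<And>v. b \<le> v" by (rule finite_lattice_bot) blast
  then have "{v :: 'l. \<forall>t\<in>{}. \<not> v \<le> t} = {b..}" by auto
  then show ?case by (rule exI)
next
  case (insert a T)
  then have "T \<subseteq> max_not_above x" by simp
  then obtain p where p: "{v. \<forall>t\<in>T. \<not> v \<le> t} = {p..}" using insert.IH by auto
  have a: "a \<in> max_not_above x" using insert.prems by simp
  then have "\<not> x \<le> a" by (simp add: max_not_above_def)
  then obtain q where q: "{v. \<not> v \<le> a} = {q..}"
    using prime_complement_principal[OF max_not_above_prime[OF assms(1) a]] by metis
  have "{v. \<forall>t\<in>insert a T. \<not> v \<le> t} = {v. \<not> v \<le> a} \<inter> {v. \<forall>t\<in>T. \<not> v \<le> t}" by auto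
  also have "\<dots> = {sup q p..}" unfolding p q by auto
  finally show ?case by (rule exI)
qed

text \<open>
  The term of degree \<open>i\<close> is the sum, over all \<open>x\<close> and all \<open>T\<close> consisting of \<open>i\<close> elements of
  \<open>max_not_above x\<close>, of the indecomposable injectives at the meet of \<open>T\<close>.
\<close>

definition inj_supp :: "nat \<Rightarrow> 'l::{finite,lattice} set \<Rightarrow> 'l \<Rightarrow> 'l \<Rightarrow> bool" where
  "inj_supp i T x v \<longleftrightarrow> T \<subseteq> max_not_above x \<and> card T = i \<and> (\<forall>t\<in>T. v \<le> t)"

definition inj_term :: "nat \<Rightarrow> ('l::{finite,lattice} \<Rightarrow> 'l \<Rightarrow> 'k::field) fgmod" where
  "inj_term i = support_module (coded (inj_supp i))"

definition inj_diff :: "nat \<Rightarrow> (nat \<Rightarrow> 'l::{finite,lattice} \<Rightarrow> 'l \<Rightarrow> 'k::field) \<Rightarrow> nat \<Rightarrow> 'l \<Rightarrow> 'l \<Rightarrow> 'k" where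
  "inj_diff i f = on_code (\<lambda>T x v. if inj_supp (Suc i) T x v then \<Sum>t\<in>T. ksgn t T * f (enc (T - {t})) x v else 0)"

text \<open>The component of the empty set is the constant representation; row by row the map is the
  inclusion of \<open>P x\<close> into it.\<close>

definition inj_coaug :: "('l \<Rightarrow> 'l \<Rightarrow> 'k::field) \<Rightarrow> nat \<Rightarrow> 'l::{finite,lattice} \<Rightarrow> 'l \<Rightarrow> 'k" where
  "inj_coaug a = on_code (\<lambda>T x v. if T = ({} :: 'l set) then a x v else 0)"

lemma inj_supp_down: "inj_supp i T x w \<Longrightarrow> v \<le> w \<Longrightarrow> inj_supp i T x v"
  unfolding inj_supp_def using order.trans by blast

lemma inj_supp_remove: "inj_supp (Suc i) T x v \<Longrightarrow> t \<in> T \<Longrightarrow> inj_supp i (T - {t}) x v"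
  by (auto simp: inj_supp_def)

lemma convex_inj_supp: "convex_family (coded (inj_supp i))"
  by (rule convex_coded) (rule inj_supp_down)

lemma inj_diff_enc:
  assumes "inj_supp (Suc i) T x v"
  shows "inj_diff i f (enc T) x v = kd (\<lambda>T. f (enc T) x v) T"
  using assms by (simp add: inj_diff_def kd_def)

lemma inj_diff_closed: "inj_diff i f \<in> carrier (inj_term (Suc i))"
  unfolding inj_diff_def inj_term_def by (rule on_code_closed) simp

lemma injective_inj_term: "injective_module inc (inj_term i :: ('l::{finite,lattice} \<Rightarrow> 'l \<Rightarrow> 'k::field) fgmod)"
  unfolding inj_term_def
proof (rule injective_support[OF convex_inj_supp])
  fix n x
  show "coded (inj_supp i) n x = {} \<or> (\<exists>p. coded (inj_supp i) n x = {..p :: 'l})"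
  proof (rule coded_cases)
    fix T :: "'l set" and x
    obtain p where "{v. \<forall>t\<in>T. v \<le> t} = {..p}" by (rule lower_bounds_principal)
    then have "{v. inj_supp i T x v} = (if T \<subseteq> max_not_above x \<and> card T = i then {..p} else {})"
      by (auto simp: inj_supp_def)
    then show "{v. inj_supp i T x v} = {} \<or> (\<exists>p. {v. inj_supp i T x v} = {..p})" by auto
  qed simp
qed

lemma inj_diff_hom: "inj_diff i \<in> rmod_hom inc (inj_term i) (inj_term (Suc i))"
  unfolding inj_term_def inj_diff_def[abs_def]
  by (rule coded_hom) (auto intro: inj_supp_down inj_supp_remove)

lemma inj_coaug_hom:
  "inj_coaug \<in> rmod_hom inc (regular_module inc) (inj_term 0 :: ('l::{finite,lattice} \<Rightarrow> 'l \<Rightarrow> 'k::field) fgmod)"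
proof (rule rmod_homI)
  have supp0: "inj_supp 0 T x v \<longleftrightarrow> T = {}" for T :: "'l set" and x v
    by (auto simp: inj_supp_def)
  show cl: "inj_coaug a \<in> carrier (inj_term 0 :: ('l \<Rightarrow> 'l \<Rightarrow> 'k) fgmod)" for a :: "'l \<Rightarrow> 'l \<Rightarrow> 'k"
    unfolding inj_coaug_def inj_term_def by (rule on_code_closed) (simp add: supp0)
  fix a b :: "'l \<Rightarrow> 'l \<Rightarrow> 'k"
  show "inj_coaug (a \<oplus>\<^bsub>regular_module inc\<^esub> b) = inj_coaug a \<oplus>\<^bsub>inj_term 0\<^esub> inj_coaug b"
    by (intro ext) (simp add: inj_coaug_def inj_term_def on_code_def sm_add regular_module_simps inc_add)
  have "inj_coaug (a \<odot>\<^bsub>regular_module inc\<^esub> b) = a \<odot>\<^bsub>support_module (coded (inj_supp 0))\<^esub> inj_coaug b"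
  proof (rule coded_eqI)
    show "inj_coaug (a \<odot>\<^bsub>regular_module inc\<^esub> b) \<in> carrier (support_module (coded (inj_supp 0)))"
      using cl by (simp add: inj_term_def)
    show "a \<odot>\<^bsub>support_module (coded (inj_supp 0))\<^esub> inj_coaug b \<in> carrier (support_module (coded (inj_supp 0)))"
      by (simp add: sm_carrier sm_smult)
    fix T :: "'l set" and x v assume "inj_supp 0 T x v"
    then show "inj_coaug (a \<odot>\<^bsub>regular_module inc\<^esub> b) (enc T) x v
        = (a \<odot>\<^bsub>support_module (coded (inj_supp 0))\<^esub> inj_coaug b) (enc T) x v"
      by (simp add: inj_coaug_def sm_smult supp0 regular_module_simps inc_mult)
  qed
  then show "inj_coaug (a \<odot>\<^bsub>regular_module inc\<^esub> b) = a \<odot>\<^bsub>inj_term 0\<^esub> inj_coaug b"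
    by (simp add: inj_term_def)
qed

section \<open>Exactness and minimality of the coresolution\<close>

lemma inj_term_zero: "\<zero>\<^bsub>inj_term i\<^esub> = (\<lambda>_ _ _. 0)"
  by (simp add: inj_term_def sm_zero)

text \<open>The first differential restricts row \<open>x\<close> to the down-sets of the elements
  of \<open>max_not_above x\<close>. Together they cover everything not above \<open>x\<close>, so
  the kernel consists of the rows supported on the up-set of \<open>x\<close>.\<close>

lemma inj_coaug_exact:
  "inj_coaug ` carrier inc
    = a_kernel (inj_term 0 :: ('l::{finite,lattice} \<Rightarrow> 'l \<Rightarrow> 'k::field) fgmod) (inj_term (Suc 0)) (inj_diff 0)"
proof (intro equalityI subsetI)
  fix f :: "nat \<Rightarrow> 'l \<Rightarrow> 'l \<Rightarrow> 'k" assume "f \<in> inj_coaug ` carrier inc"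
  then obtain a where a: "a \<in> carrier inc" "f = inj_coaug a" by auto
  have "inj_diff 0 f = (\<lambda>_ _ _. 0)"
  proof (rule coded_eqI)
    show "inj_diff 0 f \<in> carrier (support_module (coded (inj_supp (Suc 0))))"
      using inj_diff_closed by (simp add: inj_term_def)
    show "(\<lambda>_ _ _. 0) \<in> carrier (support_module (coded (inj_supp (Suc 0))))"
      by (simp add: sm_carrier)
    fix T :: "'l set" and x v assume supp: "inj_supp (Suc 0) T x v"
    then obtain t where t: "T = {t}" by (auto simp: inj_supp_def card_Suc_eq)
    have "\<not> x \<le> v" using supp order.trans[of x v t] by (auto simp: t inj_supp_def max_not_above_def)
    then have "a x v = 0" using a(1) by (simp add: inc_carrier)
    then show "inj_diff 0 f (enc T) x v = 0"
      using inj_diff_enc[OF supp, of f] by (simp add: t kd_def a(2) inj_coaug_def)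
  qed
  then show "f \<in> a_kernel (inj_term 0) (inj_term (Suc 0)) (inj_diff 0)"
    using rmod_homD(1)[OF inj_coaug_hom, of a] a by (simp add: a_kernel_def' inj_term_zero regular_module_simps)
next
  fix f :: "nat \<Rightarrow> 'l \<Rightarrow> 'l \<Rightarrow> 'k" assume "f \<in> a_kernel (inj_term 0) (inj_term (Suc 0)) (inj_diff 0)"
  then have f: "f \<in> carrier (support_module (coded (inj_supp 0)))" and df: "inj_diff 0 f = (\<lambda>_ _ _. 0)"
    by (simp_all add: a_kernel_def' inj_term_def sm_zero)
  define a where "a = f (enc ({} :: 'l set))"
  have "a x v = 0" if "\<not> x \<le> v" for x v
  proof -
    obtain y where y: "y \<in> max_not_above x" "v \<le> y" using max_not_above_exists[OF \<open>\<not> x \<le> v\<close>] .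
    then have supp: "inj_supp (Suc 0) {y} x v" by (simp add: inj_supp_def)
    show ?thesis
      using inj_diff_enc[OF supp, of f] by (simp add: kd_def df a_def)
  qed
  then have "a \<in> carrier inc" by (simp add: inc_carrier)
  moreover have "f = inj_coaug a"
  proof (rule coded_eqI[OF f])
    show "inj_coaug a \<in> carrier (support_module (coded (inj_supp 0)))"
      using rmod_homD(1)[OF inj_coaug_hom, of a] \<open>a \<in> carrier inc\<close> by (simp add: inj_term_def regular_module_simps)
    fix T :: "'l set" and x v assume "inj_supp 0 T x v"
    then have "T = {}" by (simp add: inj_supp_def)
    then show "f (enc T) x v = inj_coaug a (enc T) x v" by (simp add: inj_coaug_def a_def)
  qed
  ultimately show "f \<in> inj_coaug ` carrier inc" by (metis imageI)
qed

text \<open>At a fixed pair \<open>x\<close>, \<open>v\<close> this is the complex of the simplex on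
  the elements of \<open>max_not_above x\<close> above \<open>v\<close>, contracted towards one of
  its vertices. The choices at different \<open>v\<close> need not fit together, as only an element
  \<open>g\<close> is sought, not a homomorphism.\<close>

lemma inj_diff_exact:
  "inj_diff i ` carrier (inj_term i :: ('l::{finite,lattice} \<Rightarrow> 'l \<Rightarrow> 'k::field) fgmod)
    = a_kernel (inj_term (Suc i)) (inj_term (Suc (Suc i))) (inj_diff (Suc i))"
proof (intro equalityI subsetI)
  fix f :: "nat \<Rightarrow> 'l \<Rightarrow> 'l \<Rightarrow> 'k" assume "f \<in> inj_diff i ` carrier (inj_term i)"
  then obtain g where f: "f = inj_diff i g" by auto
  have "inj_diff (Suc i) f = (\<lambda>_ _ _. 0)"
  proof (rule coded_eqI)
    show "inj_diff (Suc i) f \<in> carrier (support_module (coded (inj_supp (Suc (Suc i)))))"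
      using inj_diff_closed by (simp add: inj_term_def)
    show "(\<lambda>_ _ _. 0) \<in> carrier (support_module (coded (inj_supp (Suc (Suc i)))))"
      by (simp add: sm_carrier)
    fix T :: "'l set" and x v assume supp: "inj_supp (Suc (Suc i)) T x v"
    have "inj_diff (Suc i) f (enc T) x v = kd (kd (\<lambda>T. g (enc T) x v)) T"
      unfolding inj_diff_enc[OF supp] kd_def[of _ T]
      by (intro sum.cong refl) (simp add: f inj_diff_enc[OF inj_supp_remove[OF supp]])
    then show "inj_diff (Suc i) f (enc T) x v = 0" by (simp add: kd_kd)
  qed
  then show "f \<in> a_kernel (inj_term (Suc i)) (inj_term (Suc (Suc i))) (inj_diff (Suc i))"
    using inj_diff_closed[of i g] by (simp add: a_kernel_def' inj_term_zero f)
next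
  fix f :: "nat \<Rightarrow> 'l \<Rightarrow> 'l \<Rightarrow> 'k"
  assume "f \<in> a_kernel (inj_term (Suc i)) (inj_term (Suc (Suc i))) (inj_diff (Suc i))"
  then have f: "f \<in> carrier (support_module (coded (inj_supp (Suc i))))"
    and df: "inj_diff (Suc i) f = (\<lambda>_ _ _. 0)"
    by (simp_all add: a_kernel_def' inj_term_def sm_zero)
  define s where "s x v = (SOME s. s \<in> max_not_above x \<and> v \<le> s)" for x v :: 'l
  define g where "g = on_code (\<lambda>T x v. if inj_supp i T x v then kh (s x v) (\<lambda>T. f (enc T) x v) T else 0)"
  have g: "g \<in> carrier (support_module (coded (inj_supp i)))"
    unfolding g_def by (rule on_code_closed) simp
  have "inj_diff i g = f"
  proof (rule coded_eqI[OF _ f])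
    show "inj_diff i g \<in> carrier (support_module (coded (inj_supp (Suc i))))"
      using inj_diff_closed by (simp add: inj_term_def)
    fix T :: "'l set" and x v assume supp: "inj_supp (Suc i) T x v"
    let ?\<phi> = "\<lambda>T. f (enc T) x v"
    obtain t where "t \<in> T" using supp by (auto simp: inj_supp_def card_Suc_eq)
    then have "\<exists>s. s \<in> max_not_above x \<and> v \<le> s" using supp by (auto simp: inj_supp_def)
    then have s: "s x v \<in> max_not_above x \<and> v \<le> s x v" unfolding s_def by (rule someI_ex)
    \<comment> \<open>As \<open>s x v\<close> lies above \<open>v\<close>, the enlarged set still
      supports \<open>v\<close>, and there the cocycle condition applies.\<close>
    have "kd ?\<phi> (insert (s x v) T) = 0" if "s x v \<notin> T"
    proof -
      have supp': "inj_supp (Suc (Suc i)) (insert (s x v) T) x v"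
        using supp s that by (simp add: inj_supp_def)
      show ?thesis using inj_diff_enc[OF supp', of f] by (simp add: df)
    qed
    then have "kh (s x v) (kd ?\<phi>) T = 0" by (simp add: kh_def)
    moreover have "inj_diff i g (enc T) x v = kd (kh (s x v) ?\<phi>) T"
      unfolding inj_diff_enc[OF supp] kd_def[of _ T]
      by (intro sum.cong refl) (simp add: g_def inj_supp_remove[OF supp])
    ultimately show "inj_diff i g (enc T) x v = f (enc T) x v"
      using kd_kh[of "s x v" ?\<phi> T] by simp
  qed
  then show "f \<in> inj_diff i ` carrier (inj_term i)"
    using g by (metis imageI inj_term_def)
qed

lemma inj_term_right_module: "right_module inc (inj_term i :: ('l::{finite,lattice} \<Rightarrow> 'l \<Rightarrow> 'k::field) fgmod)"
  unfolding inj_term_def by (rule convex_family.right_module_support[OF convex_inj_supp])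

text \<open>
  A vector in the socle lives, in the component of \<open>T\<close>, at the meet of \<open>T\<close>. Its differential would involve
  some \<open>t\<close> above the meet of \<open>T\<close> but not in \<open>T\<close>, which is impossible for a prime \<open>t\<close>.
\<close>

lemma inj_kernel_essential:
  assumes D: "class.distrib_lattice (inf :: 'l::{finite,lattice} \<Rightarrow> 'l \<Rightarrow> 'l) (\<le>) (<) sup"
  shows "essential_in inc (a_kernel (inj_term i) (inj_term (Suc i)) (inj_diff i))
    (inj_term i :: ('l \<Rightarrow> 'l \<Rightarrow> 'k::field) fgmod)"
  unfolding essential_in_def
proof (intro conjI allI impI)
  let ?K = "a_kernel (inj_term i :: ('l \<Rightarrow> 'l \<Rightarrow> 'k) fgmod) (inj_term (Suc i)) (inj_diff i)"
  show "submodule ?K inc (inj_term i)"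
    by (rule submodule_kernel[OF inj_term_right_module inj_term_right_module inj_diff_hom])
  fix V assume V: "submodule V inc (inj_term i :: ('l \<Rightarrow> 'l \<Rightarrow> 'k) fgmod)" "V \<noteq> {\<zero>\<^bsub>inj_term i\<^esub>}"
  obtain g v where gV: "g \<in> V" and g0: "g \<noteq> \<zero>\<^bsub>inj_term i\<^esub>"
    and conc: "\<forall>n x u. u \<noteq> v \<longrightarrow> g n x u = 0"
    and soc: "\<forall>n x z. v < z \<longrightarrow> z \<in> coded (inj_supp i) n x \<longrightarrow> g n x v = 0"
    using V unfolding inj_term_def by (rule socle_element[OF convex_inj_supp])
  have "V \<subseteq> carrier (inj_term i)"
    by (rule right_module.right_submoduleD(1)[OF inj_term_right_module V(1)])
  then have g: "g \<in> carrier (inj_term i)" using gV by blast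
  have "inj_diff i g = (\<lambda>_ _ _. 0)"
  proof (rule coded_eqI)
    show "inj_diff i g \<in> carrier (support_module (coded (inj_supp (Suc i))))"
      using inj_diff_closed by (simp add: inj_term_def)
    show "(\<lambda>_ _ _. 0) \<in> carrier (support_module (coded (inj_supp (Suc i))))"
      by (simp add: sm_carrier)
    fix T :: "'l set" and x u assume supp: "inj_supp (Suc i) T x u"
    have "g (enc (T - {t})) x u = 0" if t: "t \<in> T" for t
    proof (rule ccontr)
      assume nz: "g (enc (T - {t})) x u \<noteq> 0"
      then have u: "u = v" using conc by blast
      have suppt: "inj_supp i (T - {t}) x v" using inj_supp_remove[OF supp t] u by simp
      \<comment> \<open>\<open>p\<close> is the meet of \<open>T - {t}\<close>, the top of the
        down-set carried by this component; the socle condition forces \<open>v = p\<close>.\<close>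
      obtain p where p: "{w. \<forall>s\<in>T - {t}. w \<le> s} = {..p}" by (rule lower_bounds_principal)
      have "v \<in> {w. \<forall>s\<in>T - {t}. w \<le> s}" using suppt by (simp add: inj_supp_def)
      then have "v \<le> p" unfolding p by simp
      have "p \<in> {w. \<forall>s\<in>T - {t}. w \<le> s}" unfolding p by simp
      then have "inj_supp i (T - {t}) x p" using suppt by (simp add: inj_supp_def)
      then have "\<not> v < p" using soc nz u by (auto dest: spec[of _ "enc (T - {t})"])
      then have "v = p" using \<open>v \<le> p\<close> by simp
      have tY: "t \<in> max_not_above x" "v \<le> t" using supp t u by (auto simp: inj_supp_def)
      have "w \<le> t" if "\<forall>s\<in>T - {t}. w \<le> s" for w
      proof -
        have "w \<in> {..p}" unfolding p[symmetric] using that by simp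
        then show ?thesis using \<open>v = p\<close> tY(2) by (simp add: order.trans[of w p t])
      qed
      moreover have "\<exists>w. \<not> w \<le> t" using tY(1) by (auto simp: max_not_above_def)
      ultimately have "\<exists>s\<in>T - {t}. s \<le> t"
        using max_not_above_prime[OF D tY(1)] by (intro lower_bounds_prime) auto
      then obtain r where r: "r \<in> T - {t}" "r \<le> t" by auto
      then have "r \<in> max_not_above x" using supp by (auto simp: inj_supp_def)
      then show False using max_not_above_antichain[OF _ tY(1) r(2)] r(1) by simp
    qed
    then show "inj_diff i g (enc T) x u = 0"
      by (simp add: inj_diff_enc[OF supp] kd_def)
  qed
  then have "g \<in> ?K" using g by (simp add: a_kernel_def' inj_term_zero)
  then show "?K \<inter> V \<noteq> {\<zero>\<^bsub>inj_term i\<^esub>}" using gV g0 by blast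
qed

lemma minimal_injective_coresolution_incidence:
  assumes "class.distrib_lattice (inf :: 'l::{finite,lattice} \<Rightarrow> 'l \<Rightarrow> 'l) (\<le>) (<) sup"
  shows "minimal_injective_coresolution (inc :: ('k::field, 'l \<Rightarrow> 'l \<Rightarrow> 'k) module) (regular_module inc)
    inj_term inj_coaug inj_diff"
  unfolding minimal_injective_coresolution_def
proof (intro conjI allI injective_inj_term inj_coaug_hom inj_diff_hom inj_diff_exact)
  show "inj_on inj_coaug (carrier (regular_module (inc :: ('k, 'l \<Rightarrow> 'l \<Rightarrow> 'k) module)))"
  proof (rule inj_onI)
    fix a b :: "'l \<Rightarrow> 'l \<Rightarrow> 'k" assume "inj_coaug a = inj_coaug b"
    then have "inj_coaug a (enc ({} :: 'l set)) = inj_coaug b (enc ({} :: 'l set))" by simp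
    then show "a = b" by (simp add: inj_coaug_def)
  qed
  show "inj_coaug ` carrier (regular_module inc)
      = a_kernel (inj_term 0) (inj_term (Suc 0) :: ('l \<Rightarrow> 'l \<Rightarrow> 'k) fgmod) (inj_diff 0)"
    unfolding regular_module_simps by (rule inj_coaug_exact)
  \<comment> \<open>By exactness every image in the coresolution is the kernel of the next
    differential, so the statement about kernels settles minimality in all degrees.\<close>
  show "essential_in inc (inj_coaug ` carrier (regular_module inc)) (inj_term 0 :: ('l \<Rightarrow> 'l \<Rightarrow> 'k) fgmod)"
    unfolding regular_module_simps inj_coaug_exact by (rule inj_kernel_essential[OF assms])
  show "essential_in inc (inj_diff i ` carrier (inj_term i)) (inj_term (Suc i) :: ('l \<Rightarrow> 'l \<Rightarrow> 'k) fgmod)" for i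
    unfolding inj_diff_exact by (rule inj_kernel_essential[OF assms])
qed

section \<open>The Koszul resolution of the injective terms\<close>

text \<open>
  The second index set \<open>U\<close> is the complement in \<open>S\<close> of the set that carries the homological degree, so
  that the differential is again the map \<open>kd\<close>.
\<close>

definition proj_supp :: "nat \<Rightarrow> nat \<Rightarrow> 'l::{finite,lattice} set \<times> 'l set \<Rightarrow> 'l \<Rightarrow> 'l \<Rightarrow> bool" where
  "proj_supp i j = (\<lambda>(S, U) x v. U \<subseteq> S \<and> S \<subseteq> max_not_above x \<and> card S = i \<and> card (S - U) = j \<and>
     (\<forall>t\<in>S - U. \<not> v \<le> t))"

definition proj_term :: "nat \<Rightarrow> nat \<Rightarrow> ('l::{finite,lattice} \<Rightarrow> 'l \<Rightarrow> 'k::field) fgmod" where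
  "proj_term i j = support_module (coded (proj_supp i j))"

definition proj_diff :: "nat \<Rightarrow> nat \<Rightarrow> (nat \<Rightarrow> 'l::{finite,lattice} \<Rightarrow> 'l \<Rightarrow> 'k::field) \<Rightarrow> nat \<Rightarrow> 'l \<Rightarrow> 'l \<Rightarrow> 'k" where
  "proj_diff i j f = on_code (\<lambda>T x v. if proj_supp i j T x v
     then \<Sum>u\<in>snd T. ksgn u (snd T) * f (enc (fst T, snd T - {u})) x v else 0)"

text \<open>The component \<open>(S, S)\<close> has homological degree zero and is a constant
  representation, restricted here to the common lower bounds of \<open>S\<close>. The sum with one
  term gives the map the shape that \<open>coded_hom\<close> expects.\<close>

definition proj_aug :: "nat \<Rightarrow> (nat \<Rightarrow> 'l::{finite,lattice} \<Rightarrow> 'l \<Rightarrow> 'k::field) \<Rightarrow> nat \<Rightarrow> 'l \<Rightarrow> 'l \<Rightarrow> 'k" where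
  "proj_aug i f = on_code (\<lambda>S x v. if inj_supp i S x v then \<Sum>_\<in>{()}. 1 * f (enc (S, S)) x v else 0)"

lemma proj_supp_up: "proj_supp i j T x u \<Longrightarrow> u \<le> v \<Longrightarrow> proj_supp i j T x v"
  by (cases T) (auto simp: proj_supp_def dest: order.trans)

lemma convex_proj_supp: "convex_family (coded (proj_supp i j))"
  by (rule convex_coded) (rule proj_supp_up)

lemma card_diff_remove:
  fixes S :: "'a::finite set"
  assumes "U \<subseteq> S" "u \<in> U"
  shows "card (S - (U - {u})) = Suc (card (S - U))"
proof -
  have "S - (U - {u}) = insert u (S - U)" using assms by auto
  then show ?thesis using assms by simp
qed

lemma projective_proj_term:
  assumes "class.distrib_lattice (inf :: 'l::{finite,lattice} \<Rightarrow> 'l \<Rightarrow> 'l) (\<le>) (<) sup"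
  shows "projective_module inc (proj_term i j :: ('l \<Rightarrow> 'l \<Rightarrow> 'k::field) fgmod)"
  unfolding proj_term_def
proof (rule projective_support[OF convex_proj_supp])
  fix n x
  show "coded (proj_supp i j) n x = {} \<or> (\<exists>p. coded (proj_supp i j) n x = {p :: 'l..})"
  proof (rule coded_cases)
    fix T :: "'l set \<times> 'l set" and x
    obtain S U where T: "T = (S, U)" by (cases T)
    let ?c = "U \<subseteq> S \<and> S \<subseteq> max_not_above x \<and> card S = i \<and> card (S - U) = j"
    show "{v. proj_supp i j T x v} = {} \<or> (\<exists>p. {v. proj_supp i j T x v} = {p..})"
    proof (cases ?c)
      case True
      then have "S - U \<subseteq> max_not_above x" by auto
      from avoiding_principal[OF assms this] obtain p where p: "{v. \<forall>t\<in>S - U. \<not> v \<le> t} = {p..}" ..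
      have "{v. proj_supp i j T x v} = {v. \<forall>t\<in>S - U. \<not> v \<le> t}" using True by (simp add: proj_supp_def T)
      then show ?thesis using p by auto
    next
      case False
      then show ?thesis by (auto simp: proj_supp_def T)
    qed
  qed simp
qed

lemma proj_diff_hom: "proj_diff i j \<in> rmod_hom inc (proj_term i (Suc j)) (proj_term i j)"
  unfolding proj_term_def proj_diff_def[abs_def]
proof (rule coded_hom)
  fix T :: "'a set \<times> 'a set" and u x v w
  assume Q: "proj_supp i j T x v" and "u \<in> snd T" and "w \<le> v"
    and P: "proj_supp i (Suc j) (fst T, snd T - {u}) x w"
  show "proj_supp i (Suc j) (fst T, snd T - {u}) x v"
    using P \<open>w \<le> v\<close> by (rule proj_supp_up)
  show "proj_supp i j T x w"
    using P Q by (auto simp: proj_supp_def split: prod.splits)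
qed

lemma proj_aug_hom: "proj_aug i \<in> rmod_hom inc (proj_term i 0) (inj_term i)"
  unfolding proj_term_def inj_term_def proj_aug_def[abs_def]
  by (rule coded_hom) (auto intro: proj_supp_up inj_supp_down)

lemma proj_diff_closed: "proj_diff i j f \<in> carrier (proj_term i j)"
  unfolding proj_diff_def proj_term_def by (rule on_code_closed) simp

section \<open>Exactness of the projective resolution\<close>

lemma proj_term_vanish:
  assumes "f \<in> carrier (proj_term i j)" "t \<in> S - U" "v \<le> t"
  shows "f (enc (S, U)) x v = 0"
proof -
  have "\<not> proj_supp i j (S, U) x v" using assms(2,3) by (auto simp: proj_supp_def)
  then show ?thesis
    using assms(1) unfolding proj_term_def coded_carrier by simp
qed

text \<open>The formula persists where the component is dead: some \<open>t\<close> in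
  \<open>S - U\<close> lies above \<open>v\<close>, the same \<open>t\<close> survives in
  \<open>S - (U - {u})\<close>, and so all summands vanish.\<close>

lemma proj_diff_enc:
  assumes f: "f \<in> carrier (proj_term i (Suc j))"
    and SU: "U \<subseteq> S" "S \<subseteq> max_not_above x" "card S = i" "card (S - U) = j"
  shows "proj_diff i j f (enc (S, U)) x v = kd (\<lambda>U. f (enc (S, U)) x v) U"
proof (cases "proj_supp i j (S, U) x v")
  case True
  then show ?thesis by (simp add: proj_diff_def kd_def)
next
  case False
  then obtain t where t: "t \<in> S - U" "v \<le> t" using SU by (auto simp: proj_supp_def)
  have "f (enc (S, U - {u})) x v = 0" for u
    using t by (intro proj_term_vanish[OF f, of t]) auto
  then show ?thesis using False by (simp add: proj_diff_def kd_def)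
qed

lemma proj_aug_enc:
  "inj_supp i S x v \<Longrightarrow> proj_aug i f (enc S) x v = f (enc (S, S)) x v"
  by (simp add: proj_aug_def)

text \<open>The core of exactness in every degree. If some \<open>s\<close> in \<open>S\<close> is
  not above \<open>v\<close>, the complex at \<open>v\<close> contracts towards \<open>s\<close>,
  and \<open>cycle\<close> removes the other half of the homotopy. If all of \<open>S\<close> lies
  above \<open>v\<close>, only degree zero is alive and \<open>aug\<close> makes \<open>f\<close>
  vanish.\<close>

lemma proj_diff_lift:
  fixes f :: "nat \<Rightarrow> 'l::{finite,lattice} \<Rightarrow> 'l \<Rightarrow> 'k::field"
  assumes f: "f \<in> carrier (proj_term i j)"
    and cycle: "\<And>S U x v s. U \<subseteq> S \<Longrightarrow> S \<subseteq> max_not_above x \<Longrightarrow> card S = i \<Longrightarrow> card (S - U) = j \<Longrightarrow> s \<in> S - U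
      \<Longrightarrow> kd (\<lambda>U. f (enc (S, U)) x v) (insert s U) = 0"
    and aug: "\<And>S U x v. proj_supp i j (S, U) x v \<Longrightarrow> \<forall>s\<in>S. v \<le> s \<Longrightarrow> f (enc (S, U)) x v = 0"
  shows "f \<in> proj_diff i j ` carrier (proj_term i (Suc j))"
proof -
  define s where "s S v = (SOME s. s \<in> S \<and> \<not> v \<le> s)" for S and v :: 'l
  define g where "g = on_code (\<lambda>T x v. if proj_supp i (Suc j) T x v
      then kh (s (fst T) v) (\<lambda>U. f (enc (fst T, U)) x v) (snd T) else 0)"
  have g: "g \<in> carrier (proj_term i (Suc j))"
    unfolding g_def proj_term_def by (rule on_code_closed) simp
  have "proj_diff i j g = f"
  proof (rule coded_eqI)
    show "proj_diff i j g \<in> carrier (support_module (coded (proj_supp i j)))"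
      using proj_diff_closed by (simp add: proj_term_def)
    show "f \<in> carrier (support_module (coded (proj_supp i j)))"
      using f by (simp add: proj_term_def)
    fix T :: "'l set \<times> 'l set" and x v assume suppT: "proj_supp i j T x v"
    obtain S U where T: "T = (S, U)" by (cases T)
    have supp: "proj_supp i j (S, U) x v" using suppT by (simp add: T)
    then have SU: "U \<subseteq> S" "S \<subseteq> max_not_above x" "card S = i" "card (S - U) = j" by (simp_all add: proj_supp_def)
    let ?\<phi> = "\<lambda>U. f (enc (S, U)) x v"
    have "proj_diff i j g (enc (S, U)) x v = ?\<phi> U"
    proof (cases "\<exists>s. s \<in> S \<and> \<not> v \<le> s")
      case True
      then have s: "s S v \<in> S \<and> \<not> v \<le> s S v" unfolding s_def by (rule someI_ex)
      \<comment> \<open>The truncation in \<open>g\<close> changes nothing: if some \<open>t\<close>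
        outside \<open>U - {u}\<close> lies above \<open>v\<close>, it differs from
        \<open>s S v\<close>, so the value of \<open>f\<close> used by \<open>kh\<close> is zero as
        well.\<close>
      have gkh: "g (enc (S, U - {u})) x v = kh (s S v) ?\<phi> (U - {u})" if u: "u \<in> U" for u
      proof (cases "proj_supp i (Suc j) (S, U - {u}) x v")
        case True
        then show ?thesis by (simp add: g_def)
      next
        case False
        moreover have "U - {u} \<subseteq> S" using SU(1) by auto
        ultimately obtain t where t: "t \<in> S - (U - {u})" "v \<le> t"
          using SU card_diff_remove[OF SU(1) u] by (auto simp: proj_supp_def)
        then have "t \<in> S - insert (s S v) (U - {u})" using s by auto
        then have "?\<phi> (insert (s S v) (U - {u})) = 0"
          by (rule proj_term_vanish[OF f _ t(2)])
        then show ?thesis using False by (simp add: g_def kh_def)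
      qed
      have "proj_diff i j g (enc (S, U)) x v = kd (kh (s S v) ?\<phi>) U"
        unfolding proj_diff_enc[OF g SU] kd_def[of _ U] by (intro sum.cong refl) (simp add: gkh)
      moreover have "kh (s S v) (kd ?\<phi>) U = 0"
        using cycle[OF SU, of "s S v" v] s by (simp add: kh_def)
      ultimately show ?thesis using kd_kh[of "s S v" ?\<phi> U] by simp
    next
      case False
      then have "\<forall>s\<in>S. v \<le> s" by blast
      moreover have "g (enc (S, U - {u})) x v = 0" if u: "u \<in> U" for u
      proof -
        have "u \<in> S - (U - {u})" "v \<le> u" using u SU(1) False by auto
        then have "\<not> proj_supp i (Suc j) (S, U - {u}) x v" by (auto simp: proj_supp_def)
        then show ?thesis by (simp add: g_def)
      qed
      ultimately show ?thesis
        using aug[OF supp] by (simp add: proj_diff_enc[OF g SU] kd_def)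
    qed
    then show "proj_diff i j g (enc T) x v = f (enc T) x v" by (simp add: T)
  qed
  then show ?thesis using g by (metis imageI)
qed

lemma proj_diff_exact:
  "proj_diff i (Suc j) ` carrier (proj_term i (Suc (Suc j)) :: ('l::{finite,lattice} \<Rightarrow> 'l \<Rightarrow> 'k::field) fgmod)
    = a_kernel (proj_term i (Suc j)) (proj_term i j) (proj_diff i j)"
proof (intro equalityI subsetI)
  fix f :: "nat \<Rightarrow> 'l \<Rightarrow> 'l \<Rightarrow> 'k" assume "f \<in> proj_diff i (Suc j) ` carrier (proj_term i (Suc (Suc j)))"
  then obtain g where f: "f = proj_diff i (Suc j) g" and g: "g \<in> carrier (proj_term i (Suc (Suc j)))" by auto
  have fc: "f \<in> carrier (proj_term i (Suc j))" unfolding f by (rule proj_diff_closed)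
  have "proj_diff i j f = (\<lambda>_ _ _. 0)"
  proof (rule coded_eqI)
    show "proj_diff i j f \<in> carrier (support_module (coded (proj_supp i j)))"
      using proj_diff_closed by (simp add: proj_term_def)
    show "(\<lambda>_ _ _. 0) \<in> carrier (support_module (coded (proj_supp i j)))"
      by (simp add: sm_carrier)
    fix T :: "'l set \<times> 'l set" and x v assume supp: "proj_supp i j T x v"
    obtain S U where T: "T = (S, U)" by (cases T)
    have SU: "U \<subseteq> S" "S \<subseteq> max_not_above x" "card S = i" "card (S - U) = j"
      using supp by (simp_all add: proj_supp_def T)
    have "f (enc (S, U - {u})) x v = kd (\<lambda>U. g (enc (S, U)) x v) (U - {u})" if u: "u \<in> U" for u
      unfolding f using SU card_diff_remove[OF SU(1) u] by (intro proj_diff_enc[OF g]) auto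
    then have "proj_diff i j f (enc (S, U)) x v = kd (kd (\<lambda>U. g (enc (S, U)) x v)) U"
      unfolding proj_diff_enc[OF fc SU] kd_def[of _ U] by (intro sum.cong refl) simp
    then show "proj_diff i j f (enc T) x v = 0" by (simp add: kd_kd T)
  qed
  then show "f \<in> a_kernel (proj_term i (Suc j)) (proj_term i j) (proj_diff i j)"
    using fc by (simp add: a_kernel_def' proj_term_def sm_zero)
next
  fix f :: "nat \<Rightarrow> 'l \<Rightarrow> 'l \<Rightarrow> 'k"
  assume "f \<in> a_kernel (proj_term i (Suc j)) (proj_term i j) (proj_diff i j)"
  then have f: "f \<in> carrier (proj_term i (Suc j))" and df: "proj_diff i j f = (\<lambda>_ _ _. 0)"
    by (simp_all add: a_kernel_def' proj_term_def sm_zero)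
  show "f \<in> proj_diff i (Suc j) ` carrier (proj_term i (Suc (Suc j)))"
  proof (rule proj_diff_lift[OF f])
    fix S U :: "'l set" and x v s
    assume SU: "U \<subseteq> S" "S \<subseteq> max_not_above x" "card S = i" "card (S - U) = Suc j" "s \<in> S - U"
    have "S - insert s U = (S - U) - {s}" by auto
    then have "card (S - insert s U) = j" using SU(4,5) by simp
    then show "kd (\<lambda>U. f (enc (S, U)) x v) (insert s U) = 0"
      using proj_diff_enc[OF f, of "insert s U" S x v] SU df by simp
  next
    fix S U :: "'l set" and x v
    assume supp: "proj_supp i (Suc j) (S, U) x v" and "\<forall>s\<in>S. v \<le> s"
    \<comment> \<open>In positive degree a live component contains an element not above
      \<open>v\<close>, so \<open>aug\<close> has nothing to check.\<close>
    moreover have "S - U \<noteq> {}" using supp by (auto simp: proj_supp_def)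
    ultimately show "f (enc (S, U)) x v = 0" by (auto simp: proj_supp_def)
  qed
qed

lemma proj_aug_exact:
  "proj_diff i 0 ` carrier (proj_term i (Suc 0) :: ('l::{finite,lattice} \<Rightarrow> 'l \<Rightarrow> 'k::field) fgmod)
    = a_kernel (proj_term i 0) (inj_term i) (proj_aug i)"
proof (intro equalityI subsetI)
  fix f :: "nat \<Rightarrow> 'l \<Rightarrow> 'l \<Rightarrow> 'k" assume "f \<in> proj_diff i 0 ` carrier (proj_term i (Suc 0))"
  then obtain g where f: "f = proj_diff i 0 g" and g: "g \<in> carrier (proj_term i (Suc 0))" by auto
  have fc: "f \<in> carrier (proj_term i 0)" unfolding f by (rule proj_diff_closed)
  have "proj_aug i f = (\<lambda>_ _ _. 0)"
  proof (rule coded_eqI)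
    show "proj_aug i f \<in> carrier (support_module (coded (inj_supp i)))"
      using rmod_homD(1)[OF proj_aug_hom fc] by (simp add: inj_term_def)
    show "(\<lambda>_ _ _. 0) \<in> carrier (support_module (coded (inj_supp i)))"
      by (simp add: sm_carrier)
    fix S :: "'l set" and x v assume supp: "inj_supp i S x v"
    have "g (enc (S, S - {u})) x v = 0" if "u \<in> S" for u
      using that supp by (intro proj_term_vanish[OF g, of u]) (auto simp: inj_supp_def)
    then have "kd (\<lambda>U. g (enc (S, U)) x v) S = 0" by (simp add: kd_def)
    then show "proj_aug i f (enc S) x v = 0"
      using supp proj_diff_enc[OF g, of S S x v] by (simp add: proj_aug_enc f inj_supp_def)
  qed
  then show "f \<in> a_kernel (proj_term i 0) (inj_term i) (proj_aug i)"
    using fc by (simp add: a_kernel_def' inj_term_zero)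
next
  fix f :: "nat \<Rightarrow> 'l \<Rightarrow> 'l \<Rightarrow> 'k"
  assume "f \<in> a_kernel (proj_term i 0) (inj_term i) (proj_aug i)"
  then have f: "f \<in> carrier (proj_term i 0)" and df: "proj_aug i f = (\<lambda>_ _ _. 0)"
    by (simp_all add: a_kernel_def' inj_term_zero)
  show "f \<in> proj_diff i 0 ` carrier (proj_term i (Suc 0))"
  \<comment> \<open>In degree zero \<open>S - U\<close> is empty, which makes \<open>cycle\<close>
    vacuous; the content is in \<open>aug\<close>, supplied by the kernel of the
    augmentation.\<close>
  proof (rule proj_diff_lift[OF f])
    fix S U :: "'l set" and x v
    assume supp: "proj_supp i 0 (S, U) x v" and v: "\<forall>s\<in>S. v \<le> s"
    then have "U = S" by (auto simp: proj_supp_def)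
    moreover have "inj_supp i S x v" using supp v by (simp add: proj_supp_def inj_supp_def)
    ultimately show "f (enc (S, U)) x v = 0" using proj_aug_enc[of i S x v f] by (simp add: df)
  qed (simp add: card_eq_0_iff)
qed

lemma proj_aug_surj:
  "proj_aug i ` carrier (proj_term i 0) = carrier (inj_term i :: ('l::{finite,lattice} \<Rightarrow> 'l \<Rightarrow> 'k::field) fgmod)"
proof (intro equalityI subsetI)
  fix g :: "nat \<Rightarrow> 'l \<Rightarrow> 'l \<Rightarrow> 'k" assume g: "g \<in> carrier (inj_term i)"
  define f where "f = on_code (\<lambda>T x v. if fst T = snd T \<and> inj_supp i (fst T) x v then g (enc (fst T)) x v else 0)"
  have f: "f \<in> carrier (proj_term i 0)"
    unfolding f_def proj_term_def by (rule on_code_closed) (auto simp: proj_supp_def inj_supp_def)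
  have "proj_aug i f = g"
  proof (rule coded_eqI)
    show "proj_aug i f \<in> carrier (support_module (coded (inj_supp i)))"
      using rmod_homD(1)[OF proj_aug_hom f] by (simp add: inj_term_def)
    show "g \<in> carrier (support_module (coded (inj_supp i)))" using g by (simp add: inj_term_def)
  qed (simp add: proj_aug_enc f_def)
  then show "g \<in> proj_aug i ` carrier (proj_term i 0)" using f by (metis imageI)
qed (use rmod_homD(1)[OF proj_aug_hom] in auto)

lemma pdim_inj_term:
  assumes "class.distrib_lattice (inf :: 'l::{finite,lattice} \<Rightarrow> 'l \<Rightarrow> 'l) (\<le>) (<) sup"
  shows "pdim inc (inj_term i :: ('l \<Rightarrow> 'l \<Rightarrow> 'k::field) fgmod) \<le> enat i"
proof -
  have "projective_resolution inc (inj_term i :: ('l \<Rightarrow> 'l \<Rightarrow> 'k) fgmod) (proj_term i) (proj_aug i) (proj_diff i)"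
    unfolding projective_resolution_def
    by (intro conjI allI projective_proj_term assms proj_aug_hom proj_diff_hom proj_aug_surj
        proj_aug_exact proj_diff_exact)
  moreover have "carrier (proj_term i j) = {\<zero>\<^bsub>proj_term i j :: ('l \<Rightarrow> 'l \<Rightarrow> 'k) fgmod\<^esub>}" if "j > i" for j
  proof -
    have "\<not> proj_supp i j T x v" for T :: "'l set \<times> 'l set" and x v
      using that card_mono[OF finite, of "fst T - snd T" "fst T"] by (auto simp: proj_supp_def split: prod.splits)
    then have "coded (proj_supp i j) n x = ({} :: 'l set)" for n x by (simp add: coded_def)
    then show ?thesis by (auto simp: proj_term_def sm_carrier sm_zero fun_eq_iff)
  qed
  ultimately show ?thesis unfolding pdim_le_iff by blast
qed

lemma distributive_Auslander_regular:
  assumes "class.distrib_lattice (inf :: 'l::{finite,lattice} \<Rightarrow> 'l \<Rightarrow> 'l) (\<le>) (<) sup"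
  shows "Auslander_regular (inc :: ('k::field, 'l \<Rightarrow> 'l \<Rightarrow> 'k) module)"
  unfolding Auslander_regular_def n_Gorenstein_def
  using minimal_injective_coresolution_incidence[OF assms, where 'k = 'k] pdim_inj_term[OF assms, where 'k = 'k]
    gldim_incidence_algebra_finite[where 'k = 'k and 'l = 'l] by blast

theorem theorem5p4:
  assumes "CARD('l::{finite,lattice}) \<ge> 2"
  shows "(\<not> class.distrib_lattice (inf_class.inf :: 'l \<Rightarrow> 'l \<Rightarrow> 'l) (\<le>) (<) sup_class.sup \<longrightarrow>
            \<not> n_Gorenstein 2 (incidence_algebra TYPE('k::field) TYPE('l)))
       \<and> (class.distrib_lattice (inf_class.inf :: 'l \<Rightarrow> 'l \<Rightarrow> 'l) (\<le>) (<) sup_class.sup \<longleftrightarrow>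
            Auslander_regular (incidence_algebra TYPE('k) TYPE('l)))"
proof -
  have "n_Gorenstein 2 (inc :: ('k, 'l \<Rightarrow> 'l \<Rightarrow> 'k) module)"
    if "Auslander_regular (inc :: ('k, 'l \<Rightarrow> 'l \<Rightarrow> 'k) module)"
    using that by (simp add: Auslander_regular_def)
  then show ?thesis
    using not_distributive_not_2_Gorenstein[where 'k = 'k and 'l = 'l]
      distributive_Auslander_regular[where 'k = 'k and 'l = 'l] by blast
qed

end
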